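(* Assume that $a$ is known, let $\widehat Q(t)=(1-a)t/\widehat G(t)$, and let $T_{\mathrm{PI}}=\widehat Q^{-1}(\alpha)$. Let $t_0=Q^{-1}(\alpha)$ and assume $G\neq U$. Then, as $m\to\infty$, $$\sqrt m\,(T_{\mathrm{PI}}-t_0)\rightsquigarrow N\bigl(0,\ K_{Q^{-1}}(\alpha,\alpha)\bigr),$$ $$\sqrt m\,(Q(T_{\mathrm{PI}})-\alpha)\rightsquigarrow N\bigl(0,\ (Q'(t_0))^2K_{Q^{-1}}(\alpha,\alpha)\bigr),$$ and $$\mathsf E\,\Gamma(T_{\mathrm{PI}})=\alpha+o(1).$$ Here $$K_{Q^{-1}}(u,v)=\frac{K_Q(s,t)}{Q'(s)Q'(t)}\quad\text{with } s=Q^{-1}(u),\ t=Q^{-1}(v),$$ $$K_Q(s,t)=Q(s)Q(t)\,\frac{G(s\wedge t)-G(s)G(t)}{G(s)G(t)},$$ so that $K_{Q^{-1}}(\alpha,\alpha)=K_Q(t_0,t_0)/(Q'(t_0))^2$.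
   Context: Model: for each $m$, the pairs $(P_i,H_i)$, $i=1,\dots,m$, are i.i.d. with $H_i\sim\text{Bernoulli}(a)$, $0\le a\le1$; conditionally on $H_i=0$, $P_i$ is Uniform$(0,1)$; conditionally on $H_i=1$, $P_i$ has distribution function $F$ on $[0,1]$ with $F(t)\ge t$ for all $t$. The marginal distribution function of $P_i$ is $G(t)=(1-a)t+aF(t)$, and $U(t)=t$ is the Uniform$(0,1)$ distribution function. Standing assumption: $G$ is strictly concave with density $g=G'$. $\alpha\in(0,1)$ is the target level. $Q(t)=(1-a)t/G(t)$, and the inverses are $\widehat Q^{-1}(c)=\sup\{0\le t\le1:\widehat Q(t)\le c\}$ and, likewise, $Q^{-1}(c)=\sup\{0\le t\le1:Q(t)\le c\}$. The FDP (false discovery proportion) process is $$\Gamma(t)=\frac{\sum_{i=1}^m \mathbf 1\{P_i\le t\}(1-H_i)}{\sum_{i=1}^m \mathbf 1\{P_i\le t\}+\mathbf 1\{\text{all }P_i>t\}},$$ and $\Gamma(T)$ is its evaluation at the random threshold $T$. $\widehat G$ is the estimator of $G$ given by $\widehat G(t)=\max\{\mathbb G_m(t),t\}$, where $\mathbb G_m$ is the empirical distribution function of $P_1,\dots,P_m$, or by the same formula with $\mathbb G_m$ replaced by its least concave majorant. The symbol $\rightsquigarrow$ denotes convergence in distribution.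
   Formalization: The formal theorem also assumes that α = Q(t) for some t in (0,1]; otherwise either α > 1−a, where T_PI = 1 and Q(T_PI) = 1−a ≠ α, or t_0 = 0, where K_Q(t_0,t_0) is 0/0, so the joint claim fails or is undefined. *)

theory Defs
  imports "HOL-Probability.Probability"
begin

definition cdf_on_unit_interval :: "(real \<Rightarrow> real) \<Rightarrow> bool" where
  "cdf_on_unit_interval F \<longleftrightarrow>
     mono F \<and> (\<forall>t. continuous (at_right t) F) \<and> (\<forall>t<0. F t = 0) \<and> (\<forall>t\<ge>1. F t = 1)"

definition strictly_concave_on :: "real set \<Rightarrow> (real \<Rightarrow> real) \<Rightarrow> bool" where
  "strictly_concave_on S f \<longleftrightarrow>
     convex S \<and>
     (\<forall>x\<in>S. \<forall>y\<in>S. \<forall>u\<in>{0<..<1}. x \<noteq> y \<longrightarrow>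
        (1 - u) * f x + u * f y < f ((1 - u) * x + u * y))"

(* The truth values H i play the role of the 0/1 indicators. The conditional laws are those of P i
   under uniform_measure M A, i.e. M conditioned on the event A; they are required only when
   the conditioning event has positive probability. *)
definition mixture_sample ::
  "real \<Rightarrow> (real \<Rightarrow> real) \<Rightarrow> nat \<Rightarrow> 'a measure \<Rightarrow> (nat \<Rightarrow> 'a \<Rightarrow> real) \<Rightarrow> (nat \<Rightarrow> 'a \<Rightarrow> bool) \<Rightarrow> bool" where
  "mixture_sample a F m M P H \<longleftrightarrow>
     prob_space M \<and>
     prob_space.indep_vars M (\<lambda>_. borel \<Otimes>\<^sub>M count_space UNIV) (\<lambda>i \<omega>. (P i \<omega>, H i \<omega>)) {1..m} \<and>
     (\<forall>i\<in>{1..m}.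
        distr M (count_space UNIV) (H i) = measure_pmf (bernoulli_pmf a) \<and>
        (a < 1 \<longrightarrow> distr (uniform_measure M {\<omega> \<in> space M. \<not> H i \<omega>}) borel (P i)
                    = uniform_measure lborel {0<..<1}) \<and>
        (0 < a \<longrightarrow> cdf (distr (uniform_measure M {\<omega> \<in> space M. H i \<omega>}) borel (P i)) = F))"

(* Meaningful for t in [0,1] only: the linear term is not truncated. *)
definition mixture_cdf :: "real \<Rightarrow> (real \<Rightarrow> real) \<Rightarrow> real \<Rightarrow> real" where
  "mixture_cdf a F t = (1 - a) * t + a * F t"

(* Gives Q for the true marginal distribution function and its estimate for an estimated one. *)
definition Q_fun :: "real \<Rightarrow> (real \<Rightarrow> real) \<Rightarrow> real \<Rightarrow> real" where
  "Q_fun a G t = (1 - a) * t / G t"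

definition sup_inverse :: "(real \<Rightarrow> real) \<Rightarrow> real \<Rightarrow> real" where
  "sup_inverse q c = Sup {t. 0 \<le> t \<and> t \<le> 1 \<and> q t \<le> c}"

(* Derivative relative to [0,1]; this is the ordinary derivative at interior points
   and the one-sided derivative at the endpoints. *)
definition unit_deriv :: "(real \<Rightarrow> real) \<Rightarrow> real \<Rightarrow> real" where
  "unit_deriv q t = vector_derivative q (at t within {0..1})"

definition K_Q :: "real \<Rightarrow> (real \<Rightarrow> real) \<Rightarrow> real \<Rightarrow> real \<Rightarrow> real" where
  "K_Q a G s t = Q_fun a G s * Q_fun a G t * ((G (min s t) - G s * G t) / (G s * G t))"

definition K_Q_inv :: "real \<Rightarrow> (real \<Rightarrow> real) \<Rightarrow> real \<Rightarrow> real \<Rightarrow> real" where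
  "K_Q_inv a G u v =
     (let s = sup_inverse (Q_fun a G) u; t = sup_inverse (Q_fun a G) v
      in K_Q a G s t / (unit_deriv (Q_fun a G) s * unit_deriv (Q_fun a G) t))"

definition empirical_cdf :: "nat \<Rightarrow> (nat \<Rightarrow> real) \<Rightarrow> real \<Rightarrow> real" where
  "empirical_cdf m p t = real (card {i \<in> {1..m}. p i \<le> t}) / real m"

(* Least concave majorant on [0,1]. *)
definition least_concave_majorant :: "(real \<Rightarrow> real) \<Rightarrow> real \<Rightarrow> real" where
  "least_concave_majorant f t =
     Inf {h t | h. concave_on {0..1} h \<and> (\<forall>s\<in>{0..1}. f s \<le> h s)}"

(* Phi is the identity or least_concave_majorant. *)
definition G_hat ::
  "((real \<Rightarrow> real) \<Rightarrow> real \<Rightarrow> real) \<Rightarrow> nat \<Rightarrow> (nat \<Rightarrow> real) \<Rightarrow> real \<Rightarrow> real" where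
  "G_hat \<Phi> m p t = max (\<Phi> (empirical_cdf m p) t) t"

definition T_PI ::
  "((real \<Rightarrow> real) \<Rightarrow> real \<Rightarrow> real) \<Rightarrow> real \<Rightarrow> real \<Rightarrow> nat \<Rightarrow> (nat \<Rightarrow> real) \<Rightarrow> real" where
  "T_PI \<Phi> a \<alpha> m p = sup_inverse (Q_fun a (G_hat \<Phi> m p)) \<alpha>"

definition FDP :: "nat \<Rightarrow> (nat \<Rightarrow> real) \<Rightarrow> (nat \<Rightarrow> bool) \<Rightarrow> real \<Rightarrow> real" where
  "FDP m p h t =
     (\<Sum>i=1..m. of_bool (p i \<le> t) * (1 - of_bool (h i)))
     / ((\<Sum>i=1..m. of_bool (p i \<le> t)) + of_bool (\<forall>i\<in>{1..m}. p i > t))"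

(* Normal law with mean mu and variance v; for v = 0 it is the point mass at mu. *)
definition normal_law :: "real \<Rightarrow> real \<Rightarrow> real measure" where
  "normal_law \<mu> v = distr std_normal_distribution borel (\<lambda>x. \<mu> + sqrt v * x)"

end

theory Submission
  imports Defs
begin

text \<open>Put \<open>\<beta> = (1 - a) / \<alpha>\<close>. Since \<open>\<beta> > 1\<close> off a degenerate case, \<open>(1 - a) * t / max (C t) t \<le> \<alpha>\<close> says, for \<open>t > 0\<close>, that
\<open>C t\<close> lies on or above the line \<open>\<beta> * t\<close>. So the threshold \<open>T\<close> is the last point at which the estimate \<open>C\<close>
of \<open>G\<close> crosses that line, and \<open>t\<^sub>0\<close> is the crossing point of \<open>G\<close> itself
(\<open>T_PI_eq_last_crossing\<close>). At \<open>t\<^sub>0\<close> the strictly concave \<open>G\<close> has slope \<open>g\<^sub>0 < \<beta>\<close>, so the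
line and the graph cross transversally.

Let \<open>\<nu>\<close> be the empirical process, \<open>sqrt m\<close> times the difference of the empirical distribution function and
\<open>G\<close>. The theorem rests on the linearization \<open>sqrt m * (T - t\<^sub>0) = \<nu> t\<^sub>0 / (\<beta> - g\<^sub>0) + o(1)\<close> in probability,
which is stated as the two one-sided implications \<open>crossing_upper\<close> and \<open>crossing_lower\<close>. The lower bound is easy:
if the empirical distribution function is on or above the line at \<open>t\<close> then so is its majorant, and \<open>T \<ge> t\<close>. For the upper bound
it is enough to find one affine function that dominates the empirical distribution function on \<open>[0, 1]\<close> and is
below the line at \<open>t\<close>; the least concave majorant is then dominated as well, so both estimators are treated at once.
The affine function is the tangent of \<open>G\<close> at \<open>t\<^sub>0\<close>, lifted by \<open>(\<nu> t\<^sub>0 + e / 2) / sqrt m\<close>. Away from \<open>t\<^sub>0\<close> the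
strict concavity of \<open>G\<close> leaves room of constant order, which beats the uniform error of the empirical distribution
function. Near \<open>t\<^sub>0\<close> there is no such room, because nothing is assumed on the curvature of \<open>G\<close>, and the
oscillation of \<open>\<nu>\<close> must itself be small: this is stochastic equicontinuity, obtained in \<open>emp_process_modulus\<close> by
dyadic chaining from a fourth moment bound for counts.

The variable \<open>\<nu> t\<^sub>0\<close> is a normalized binomial count, so the central limit theorem gives its limit law.
\<open>weak_conv_sandwich\<close> carries the law over to \<open>T\<close>, and, composed with an increasing function that is differentiable
at \<open>t\<^sub>0\<close>, to \<open>Q(T)\<close> (\<open>threshold_clt\<close>). The false discovery proportion is the ratio of two counts that are
monotone in the threshold, so consistency of \<open>T\<close> and the weak law of large numbers at fixed points give
convergence in probability to \<open>(1 - a) * t\<^sub>0 / G t\<^sub>0 = \<alpha>\<close>; the proportion is bounded, so expectations converge.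

The degenerate case is \<open>\<alpha> = 1 - a\<close>, where \<open>t\<^sub>0 = 1\<close>. There \<open>T = 1\<close> for every sample, and the asymptotic variance
vanishes because \<open>G 1 = 1\<close>.\<close>

section \<open>Independent counts: fourth moments and the central limit theorem\<close>

lemma card_filter_eq_sum: "finite A \<Longrightarrow> real (card {i \<in> A. P i}) = (\<Sum>i\<in>A. of_bool (P i))"
  by (simp add: Collect_conj_eq)

text \<open>Expand \<open>(Y + S)^4\<close> for a new summand \<open>Y\<close> independent of the previous sum \<open>S\<close>: the terms that are linear in \<open>Y\<close> or
in \<open>S\<close> have mean zero, and the mixed term contributes \<open>6 * E Y\<^sup>2 * E S\<^sup>2\<close>. The statement carries the first and second moments
along because the induction step needs them.\<close>
lemma (in prob_space) indep_sum_fourth_moment: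
  fixes Y :: "'i \<Rightarrow> 'a \<Rightarrow> real"
  assumes "finite I" "indep_vars (\<lambda>_. borel) Y I"
    and bnd: "\<And>i \<omega>. i \<in> I \<Longrightarrow> \<bar>Y i \<omega>\<bar> \<le> 1"
    and mean: "\<And>i. i \<in> I \<Longrightarrow> expectation (Y i) = 0"
    and var: "\<And>i. i \<in> I \<Longrightarrow> expectation (\<lambda>\<omega>. (Y i \<omega>)\<^sup>2) \<le> q"
  shows "expectation (\<lambda>\<omega>. \<Sum>i\<in>I. Y i \<omega>) = 0 \<and>
         expectation (\<lambda>\<omega>. (\<Sum>i\<in>I. Y i \<omega>)\<^sup>2) \<le> real (card I) * q \<and>
         expectation (\<lambda>\<omega>. (\<Sum>i\<in>I. Y i \<omega>) ^ 4) \<le> 3 * (real (card I))\<^sup>2 * q\<^sup>2 + real (card I) * q"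
  using assms
proof (induction I rule: finite_induct)
  case empty
  then show ?case by simp
next
  case (insert j I)
  define S where "S = (\<lambda>\<omega>. \<Sum>i\<in>I. Y i \<omega>)"
  have meas[measurable]: "Y i \<in> borel_measurable M" if "i \<in> insert j I" for i
    using insert.prems(1) that unfolding indep_vars_def by auto
  have [measurable]: "S \<in> borel_measurable M" "Y j \<in> borel_measurable M"
    unfolding S_def by (auto intro!: borel_measurable_sum)
  have Yb: "\<bar>Y j \<omega>\<bar> \<le> 1" for \<omega>
    using insert.prems(2) by auto
  have Sb: "\<bar>S \<omega>\<bar> \<le> real (card I)" for \<omega>
  proof -
    have "\<bar>S \<omega>\<bar> \<le> (\<Sum>i\<in>I. \<bar>Y i \<omega>\<bar>)"
      unfolding S_def by (rule sum_abs)
    also have "\<dots> \<le> (\<Sum>i\<in>I. 1)"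
      using insert.prems(2) by (intro sum_mono) auto
    finally show ?thesis by simp
  qed
  have bp: "\<bar>x ^ k\<bar> \<le> b ^ k" if "\<bar>x\<bar> \<le> b" for x b :: real and k :: nat
    using that by (simp add: power_abs power_mono)
  have intS: "integrable M (\<lambda>\<omega>. S \<omega> ^ k)" for k
    by (rule integrable_const_bound[where B = "real (card I) ^ k"]) (use bp[OF Sb] in auto)
  have intY: "integrable M (\<lambda>\<omega>. Y j \<omega> ^ k)" for k
    by (rule integrable_const_bound[where B = "1 ^ k"]) (use bp[OF Yb] in auto)
  have ind: "indep_var borel (Y j) borel S"
    unfolding S_def using indep_vars_sum[OF insert.hyps insert.prems(1)] .
  have indk: "indep_var borel (\<lambda>\<omega>. Y j \<omega> ^ k) borel (\<lambda>\<omega>. S \<omega> ^ l)" for k l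
    using indep_var_compose[OF ind, of "\<lambda>x. x ^ k" borel "\<lambda>x. x ^ l" borel]
    by (simp add: comp_def)
  have prodE: "expectation (\<lambda>\<omega>. Y j \<omega> ^ k * S \<omega> ^ l) = expectation (\<lambda>\<omega>. Y j \<omega> ^ k) * expectation (\<lambda>\<omega>. S \<omega> ^ l)"
    and intP: "integrable M (\<lambda>\<omega>. Y j \<omega> ^ k * S \<omega> ^ l)" for k l
    using indep_var_lebesgue_integral[OF indk intY intS] indep_var_integrable[OF indk intY intS] by auto
  have IH: "expectation S = 0" "expectation (\<lambda>\<omega>. (S \<omega>)\<^sup>2) \<le> real (card I) * q"
    "expectation (\<lambda>\<omega>. (S \<omega>) ^ 4) \<le> 3 * (real (card I))\<^sup>2 * q\<^sup>2 + real (card I) * q"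
    using insert.IH[OF indep_vars_subset[OF insert.prems(1)]] insert.prems unfolding S_def by auto
  have mY: "expectation (Y j) = 0" and vY: "expectation (\<lambda>\<omega>. (Y j \<omega>)\<^sup>2) \<le> q"
    using insert.prems by auto
  have fY: "expectation (\<lambda>\<omega>. (Y j \<omega>) ^ 4) \<le> q"
  proof -
    have "expectation (\<lambda>\<omega>. (Y j \<omega>) ^ 4) \<le> expectation (\<lambda>\<omega>. (Y j \<omega>)\<^sup>2)"
    proof (rule integral_mono[OF intY intY])
      fix \<omega>
      have "(Y j \<omega>)\<^sup>2 \<le> 1" using Yb[of \<omega>] by (simp add: abs_square_le_1)
      then have "(Y j \<omega>)\<^sup>2 * (Y j \<omega>)\<^sup>2 \<le> (Y j \<omega>)\<^sup>2 * 1"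
        by (intro mult_left_mono) auto
      then show "(Y j \<omega>) ^ 4 \<le> (Y j \<omega>)\<^sup>2"
        by (simp add: power4_eq_xxxx power2_eq_square mult.assoc)
    qed
    then show ?thesis using vY by simp
  qed
  have q0: "0 \<le> q"
    using vY order_trans[OF integral_nonneg_AE[of "\<lambda>\<omega>. (Y j \<omega>)\<^sup>2" M]] by auto
  have sum_eq: "(\<Sum>i\<in>insert j I. Y i \<omega>) = Y j \<omega> + S \<omega>" for \<omega>
    unfolding S_def using insert.hyps by simp
  have E1: "expectation (\<lambda>\<omega>. Y j \<omega> + S \<omega>) = 0"
    using intY[of 1] intS[of 1] mY IH(1) by simp
  have e2: "(Y j \<omega> + S \<omega>)\<^sup>2 = (Y j \<omega>)\<^sup>2 + 2 * (Y j \<omega> * S \<omega>) + (S \<omega>)\<^sup>2" for \<omega>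
    by (simp add: power2_sum)
  have E2: "expectation (\<lambda>\<omega>. (Y j \<omega> + S \<omega>)\<^sup>2) =
      expectation (\<lambda>\<omega>. (Y j \<omega>)\<^sup>2) + expectation (\<lambda>\<omega>. (S \<omega>)\<^sup>2)"
    unfolding e2 using intP[of 1 1] prodE[of 1 1] mY intY[of 2] intS[of 2] by simp
  have e4: "(Y j \<omega> + S \<omega>) ^ 4 = Y j \<omega> ^ 4 + 4 * (Y j \<omega> ^ 3 * S \<omega>)
      + 6 * ((Y j \<omega>)\<^sup>2 * (S \<omega>)\<^sup>2) + 4 * (Y j \<omega> * S \<omega> ^ 3) + S \<omega> ^ 4" for \<omega>
    by (simp add: power4_eq_xxxx power3_eq_cube power2_eq_square algebra_simps)
  have E4: "expectation (\<lambda>\<omega>. (Y j \<omega> + S \<omega>) ^ 4) =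
      expectation (\<lambda>\<omega>. (Y j \<omega>) ^ 4) + 6 * (expectation (\<lambda>\<omega>. (Y j \<omega>)\<^sup>2) * expectation (\<lambda>\<omega>. (S \<omega>)\<^sup>2))
      + expectation (\<lambda>\<omega>. (S \<omega>) ^ 4)"
    unfolding e4 using intP[of 3 1] prodE[of 3 1] intP[of 2 2] prodE[of 2 2] intP[of 1 3] prodE[of 1 3]
      mY IH(1) intY[of 4] intS[of 4] by simp
  have "expectation (\<lambda>\<omega>. (Y j \<omega>)\<^sup>2) * expectation (\<lambda>\<omega>. (S \<omega>)\<^sup>2) \<le> q * (real (card I) * q)"
    using vY IH(2) q0 by (intro mult_mono) auto
  then have "expectation (\<lambda>\<omega>. (Y j \<omega> + S \<omega>) ^ 4) \<le>
      q + 6 * (q * (real (card I) * q)) + (3 * (real (card I))\<^sup>2 * q\<^sup>2 + real (card I) * q)"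
    unfolding E4 using fY IH(3) by linarith
  also have "\<dots> \<le> 3 * (real (card I) + 1)\<^sup>2 * q\<^sup>2 + (real (card I) + 1) * q"
    by (simp add: power2_eq_square algebra_simps)
  finally have "expectation (\<lambda>\<omega>. (Y j \<omega> + S \<omega>) ^ 4) \<le> 3 * (real (card I) + 1)\<^sup>2 * q\<^sup>2 + (real (card I) + 1) * q" .
  then show ?case
    using E1 E2 vY IH(2) insert.hyps unfolding sum_eq by (auto simp: algebra_simps)
qed

text \<open>Markov's inequality for the fourth moment. The assumption \<open>1 \<le> m * q\<close> makes the Gaussian part
\<open>3 * m\<^sup>2 * q\<^sup>2\<close> of the moment dominate the part \<open>m * q\<close>, so that the bound is quadratic in \<open>q\<close>. A variance bound would only be
linear in \<open>q\<close>, and a linear bound is not summable in the chaining argument.\<close>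
lemma (in prob_space) indep_count_tail:
  fixes X :: "nat \<Rightarrow> 'a \<Rightarrow> 'b"
  assumes ind: "indep_vars (\<lambda>_. N) X {1..m}" and B: "B \<in> sets N"
    and p: "\<And>i. i \<in> {1..m} \<Longrightarrow> prob {\<omega> \<in> space M. X i \<omega> \<in> B} = p"
    and q: "p \<le> q" "1 \<le> real m * q" and lam: "0 < c"
  shows "prob {\<omega> \<in> space M. c * sqrt (real m) \<le> \<bar>real (card {i \<in> {1..m}. X i \<omega> \<in> B}) - real m * p\<bar>}
         \<le> 4 * q\<^sup>2 / c ^ 4"
proof -
  have m0: "m \<ge> 1" using q(2) by (cases "m = 0") auto
  have p01: "0 \<le> p" "p \<le> 1"
    using p[of 1] m0 by (auto simp flip: p[of 1])
  define Y where "Y = (\<lambda>i \<omega>. (indicator B (X i \<omega>) :: real) - p)"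
  have Xm[measurable]: "X i \<in> measurable M N" if "i \<in> {1..m}" for i
    using ind that unfolding indep_vars_def by auto
  have "indep_vars (\<lambda>_. borel) (\<lambda>i \<omega>. (\<lambda>x. (indicator B x :: real) - p) (X i \<omega>)) {1..m}"
    by (rule indep_vars_compose2[OF ind]) (use B in measurable)
  then have indY: "indep_vars (\<lambda>_. borel) Y {1..m}" by (simp add: Y_def)
  have Eind: "expectation (\<lambda>\<omega>. indicator B (X i \<omega>)) = p"
    and Iind: "integrable M (\<lambda>\<omega>. indicator B (X i \<omega>) :: real)" if "i \<in> {1..m}" for i
  proof -
    have *: "(\<lambda>\<omega>. indicator B (X i \<omega>)) = (indicator (X i -` B) :: 'a \<Rightarrow> real)"
      by (auto simp: indicator_def)
    have e: "X i -` B \<inter> space M = {\<omega> \<in> space M. X i \<omega> \<in> B}" by auto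
    show "expectation (\<lambda>\<omega>. indicator B (X i \<omega>)) = p"
      unfolding * using p[OF that] by (simp add: e)
    have "{\<omega> \<in> space M. X i \<omega> \<in> B} \<in> events"
      using measurable_sets[OF Xm[OF that] B] by (simp add: e)
    then show "integrable M (\<lambda>\<omega>. indicator B (X i \<omega>) :: real)"
      unfolding * by (simp add: e integrable_indicator_iff emeasure_eq_measure)
  qed
  have bnd: "\<bar>Y i \<omega>\<bar> \<le> 1" for i \<omega>
    using p01 by (auto simp: Y_def indicator_def)
  have mean: "expectation (Y i) = 0" if "i \<in> {1..m}" for i
    unfolding Y_def using Eind[OF that] Iind[OF that] by (simp add: prob_space)
  have var: "expectation (\<lambda>\<omega>. (Y i \<omega>)\<^sup>2) \<le> q" if "i \<in> {1..m}" for i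
  proof -
    have "(Y i \<omega>)\<^sup>2 = (1 - 2 * p) * indicator B (X i \<omega>) + p\<^sup>2" for \<omega>
      by (auto simp: Y_def indicator_def power2_eq_square algebra_simps)
    then have "expectation (\<lambda>\<omega>. (Y i \<omega>)\<^sup>2) = (1 - 2 * p) * p + p\<^sup>2"
      using Eind[OF that] Iind[OF that] by (simp add: prob_space)
    also have "\<dots> \<le> p"
      by (simp add: power2_eq_square algebra_simps)
    finally show ?thesis using q by simp
  qed
  define S where "S = (\<lambda>\<omega>. \<Sum>i\<in>{1..m}. Y i \<omega>)"
  have Seq: "real (card {i \<in> {1..m}. X i \<omega> \<in> B}) - real m * p = S \<omega>" for \<omega>
  proof -
    have "(\<Sum>i\<in>{1..m}. indicator B (X i \<omega>) :: real) = real (card {i \<in> {1..m}. X i \<omega> \<in> B})"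
      by (simp only: card_filter_eq_sum finite_atLeastAtMost) (auto intro!: sum.cong simp: indicator_def)
    then show ?thesis by (simp add: S_def Y_def sum_subtractf)
  qed
  have [measurable]: "S \<in> borel_measurable M"
    using indY unfolding S_def indep_vars_def by (auto intro!: borel_measurable_sum)
  have m4: "expectation (\<lambda>\<omega>. S \<omega> ^ 4) \<le> 3 * (real m)\<^sup>2 * q\<^sup>2 + real m * q"
    using indep_sum_fourth_moment[OF _ indY bnd mean var] by (auto simp: S_def)
  have "\<bar>S \<omega>\<bar> \<le> real m" for \<omega>
  proof -
    have "\<bar>S \<omega>\<bar> \<le> (\<Sum>i\<in>{1..m}. \<bar>Y i \<omega>\<bar>)" unfolding S_def by (rule sum_abs)
    also have "\<dots> \<le> (\<Sum>i\<in>{1..m}. 1)" using bnd by (intro sum_mono) auto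
    finally show ?thesis by simp
  qed
  then have "\<bar>S \<omega> ^ 4\<bar> \<le> real m ^ 4" for \<omega>
    by (metis power_abs power_mono abs_ge_zero)
  then have int4: "integrable M (\<lambda>\<omega>. S \<omega> ^ 4)"
    by (intro integrable_const_bound[where B = "real m ^ 4"]) auto
  have sq4: "(sqrt (real m)) ^ 4 = (real m)\<^sup>2"
    by (metis (no_types) mult_2 numeral_Bit0 of_nat_0_le_iff power_add power2_eq_square real_sqrt_pow2)
  have "prob {\<omega> \<in> space M. c * sqrt (real m) \<le> \<bar>S \<omega>\<bar>} \<le> prob {\<omega> \<in> space M. c ^ 4 * (real m)\<^sup>2 \<le> S \<omega> ^ 4}"
  proof (rule finite_measure_mono)
    show "{\<omega> \<in> space M. c * sqrt (real m) \<le> \<bar>S \<omega>\<bar>} \<subseteq> {\<omega> \<in> space M. c ^ 4 * (real m)\<^sup>2 \<le> S \<omega> ^ 4}"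
    proof safe
      fix \<omega> assume "c * sqrt (real m) \<le> \<bar>S \<omega>\<bar>"
      then have "(c * sqrt (real m)) ^ 4 \<le> \<bar>S \<omega>\<bar> ^ 4"
        using lam by (intro power_mono) auto
      then show "c ^ 4 * (real m)\<^sup>2 \<le> S \<omega> ^ 4"
        by (simp add: power_mult_distrib sq4)
    qed
  qed measurable
  also have "\<dots> \<le> expectation (\<lambda>\<omega>. S \<omega> ^ 4) / (c ^ 4 * (real m)\<^sup>2)"
    by (rule integral_Markov_inequality_measure[OF int4]) (use lam m0 in auto)
  also have "\<dots> \<le> (4 * q\<^sup>2 * (real m)\<^sup>2) / (c ^ 4 * (real m)\<^sup>2)"
  proof (rule divide_right_mono)
    have "(real m * q) * 1 \<le> (real m * q) * (real m * q)"
      using q(2) by (intro mult_left_mono) auto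
    then have "real m * q \<le> (real m)\<^sup>2 * q\<^sup>2"
      by (simp add: power2_eq_square ac_simps)
    then show "expectation (\<lambda>\<omega>. S \<omega> ^ 4) \<le> 4 * q\<^sup>2 * (real m)\<^sup>2"
      using m4 by (simp add: ac_simps)
  qed (use lam in auto)
  also have "\<dots> = 4 * q\<^sup>2 / c ^ 4"
    using m0 by simp
  finally show ?thesis by (simp only: Seq)
qed

text \<open>The samples for different \<open>m\<close> live on unrelated spaces, while the classical theorem speaks of one infinite
sequence. But the law of the normalized count depends on \<open>m\<close> and \<open>p\<close> only, so it may be computed on an infinite
product of Bernoulli laws; the two laws agree because their characteristic functions do.\<close>
lemma indep_count_clt:
  fixes M :: "nat \<Rightarrow> 'a measure" and X :: "nat \<Rightarrow> nat \<Rightarrow> 'a \<Rightarrow> 'b"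
  assumes M: "\<And>m. prob_space (M m)"
    and ind: "\<And>m. prob_space.indep_vars (M m) (\<lambda>_. N) (X m) {1..m}" and B: "B \<in> sets N"
    and p: "\<And>m i. i \<in> {1..m} \<Longrightarrow> measure (M m) {\<omega> \<in> space (M m). X m i \<omega> \<in> B} = p"
    and p01: "0 < p" "p < 1"
  shows "weak_conv_m (\<lambda>m. distr (M m) borel
      (\<lambda>\<omega>. (real (card {i \<in> {1..m}. X m i \<omega> \<in> B}) - real m * p) / sqrt (real m * (p * (1 - p)))))
      std_normal_distribution"
proof -
  define b where "b = measure_pmf (bernoulli_pmf p)"
  define K where "K = PiM (UNIV :: nat set) (\<lambda>_. b)"
  interpret b: prob_space b unfolding b_def by (rule measure_pmf.prob_space_axioms)
  interpret K: product_prob_space "\<lambda>_ :: nat. b" UNIV ..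
  have pK: "prob_space K" unfolding K_def by (rule K.P.prob_space_axioms)
  interpret PK: prob_space K by (rule pK)
  have sb: "sets b = UNIV" "space b = UNIV" by (auto simp: b_def)
  have coordm: "(\<lambda>\<omega>. \<omega> i) \<in> measurable K b" for i
    unfolding K_def by measurable
  have coordd: "distr K b (\<lambda>\<omega>. \<omega> i) = b" for i
    unfolding K_def by (rule K.PiM_component) simp
  have indK: "PK.indep_vars (\<lambda>_. b) (\<lambda>i \<omega>. \<omega> i) UNIV"
  proof (subst PK.indep_vars_iff_distr_eq_PiM)
    show "distr K (Pi\<^sub>M UNIV (\<lambda>i. b)) (\<lambda>x. \<lambda>i\<in>UNIV. x i) = Pi\<^sub>M UNIV (\<lambda>i. distr K b (\<lambda>\<omega>. \<omega> i))"
      by (simp only: coordd restrict_UNIV) (simp add: K_def distr_id2)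
  qed (use coordm in auto)
  define f where "f = (\<lambda>x. of_bool x :: real)"
  define Y where "Y = (\<lambda>i (\<omega> :: nat \<Rightarrow> bool). f (\<omega> i))"
  have fm: "f \<in> borel_measurable b" by (simp add: b_def)
  have indY: "PK.indep_vars (\<lambda>_. borel) Y UNIV"
    unfolding Y_def by (rule PK.indep_vars_compose2[OF indK]) (use fm in auto)
  have distY: "distr K borel (Y i) = distr b borel f" for i
  proof -
    have "distr (distr K b (\<lambda>\<omega>. \<omega> i)) borel f = distr K borel (Y i)"
      by (subst distr_distr) (use coordm fm in \<open>auto simp: comp_def Y_def\<close>)
    then show ?thesis by (simp add: coordd)
  qed
  have Ym[measurable]: "Y i \<in> borel_measurable K" for i
    using indY unfolding PK.indep_vars_def by auto
  have EY: "PK.expectation (\<lambda>\<omega>. h (Y i \<omega>)) = p * h 1 + (1 - p) * h 0" for i and h :: "real \<Rightarrow> real"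
  proof -
    have "PK.expectation (\<lambda>\<omega>. h (f (\<omega> i))) = integral\<^sup>L (distr K b (\<lambda>\<omega>. \<omega> i)) (\<lambda>x. h (f x))"
      by (subst integral_distr) (use coordm in \<open>auto simp: b_def\<close>)
    also have "\<dots> = p * h 1 + (1 - p) * h 0"
      unfolding coordd unfolding b_def using p01 by (subst integral_bernoulli_pmf) (auto simp: f_def)
    finally show ?thesis by (simp add: Y_def)
  qed
  have sg: "sqrt (p * (1 - p)) > 0" "(sqrt (p * (1 - p)))\<^sup>2 = p * (1 - p)"
    using p01 by auto
  have clt: "weak_conv_m (\<lambda>n. distr K borel (\<lambda>x. (\<Sum>i<n. Y i x - p) / sqrt (n * (sqrt (p * (1 - p)))\<^sup>2)))
      std_normal_distribution"
  proof (rule PK.central_limit_theorem[OF indY])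
    show "PK.expectation (Y n) = p" for n
      using EY[of "\<lambda>x. x" n] by simp
    show "integrable K (\<lambda>x. (Y n x)\<^sup>2)" for n
      by (rule PK.integrable_const_bound[where B = 1]) (simp add: Y_def f_def, measurable)
    show "PK.variance (Y n) = (sqrt (p * (1 - p)))\<^sup>2" for n
      using EY[of "\<lambda>x. x" n] EY[of "\<lambda>x. (x - p)\<^sup>2" n] unfolding sg
      by (simp add: power2_eq_square algebra_simps)
  qed (use sg distY in auto)
  have "distr (M m) borel
      (\<lambda>\<omega>. (real (card {i \<in> {1..m}. X m i \<omega> \<in> B}) - real m * p) / sqrt (real m * (p * (1 - p))))
     = distr K borel (\<lambda>x. (\<Sum>i<m. Y i x - p) / sqrt (real m * (sqrt (p * (1 - p)))\<^sup>2))" for m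
  proof -
    define s where "s = sqrt (real m * (p * (1 - p)))"
    interpret prob_space "M m" by (rule M)
    define V where "V = (\<lambda>i \<omega>. (indicator B (X m i \<omega>) - p) / s)"
    have Xm[measurable]: "X m i \<in> measurable (M m) N" if "i \<in> {1..m}" for i
      using ind[of m] that unfolding indep_vars_def by auto
    have indV: "indep_vars (\<lambda>_. borel) V {1..m}"
      unfolding V_def
      by (rule indep_vars_compose2[OF ind[of m], where Y = "\<lambda>_ x. (indicator B x - p) / s"]) (use B in measurable)
    have indV': "PK.indep_vars (\<lambda>_. borel) (\<lambda>i x. (Y i x - p) / s) {..<m}"
      by (rule PK.indep_vars_compose2[OF PK.indep_vars_subset[OF indY], where Y = "\<lambda>_ x. (x - p) / s"]) auto
    have Vm[measurable]: "V i \<in> borel_measurable (M m)" if "i \<in> {1..m}" for i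
      using indV that unfolding indep_vars_def by auto
    have charV: "char (distr (M m) borel (V i)) t = char (distr K borel (\<lambda>x. (Y j x - p) / s)) t"
      if i: "i \<in> {1..m}" for i j t
    proof -
      have "distr (M m) (count_space UNIV) (\<lambda>\<omega>. X m i \<omega> \<in> B) = b"
      proof (rule measure_eqI_countable)
        show "sets b = Pow UNIV" by (simp add: sb)
        have mm: "(\<lambda>\<omega>. X m i \<omega> \<in> B) \<in> measurable (M m) (count_space UNIV)"
          using B i by measurable
        fix x :: bool
        have e: "{\<omega> \<in> space (M m). X m i \<omega> \<in> B} \<in> events"
          using measurable_sets[OF Xm[OF i] B] by (simp add: vimage_def Int_def conj_commute)
        have "space (M m) - {\<omega> \<in> space (M m). X m i \<omega> \<in> B} = {\<omega> \<in> space (M m). \<not> X m i \<omega> \<in> B}"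
          by blast
        then have pr: "prob {\<omega> \<in> space (M m). \<not> X m i \<omega> \<in> B} = 1 - p"
          using prob_compl[OF e] p[OF i] by simp
        show "emeasure (distr (M m) (count_space UNIV) (\<lambda>\<omega>. X m i \<omega> \<in> B)) {x} = emeasure b {x}"
          using p[OF i] pr p01
          by (cases x) (auto simp: emeasure_distr[OF mm] b_def emeasure_pmf_single vimage_def Int_def
              emeasure_eq_measure conj_commute)
      qed auto
      then have "char (distr (M m) borel (V i)) t = char (distr b borel (\<lambda>x. (f x - p) / s)) t"
      proof -
        have "V i = (\<lambda>x. (f x - p) / s) \<circ> (\<lambda>\<omega>. X m i \<omega> \<in> B)"
          by (auto simp: V_def f_def fun_eq_iff indicator_def)
        then have "distr (distr (M m) (count_space UNIV) (\<lambda>\<omega>. X m i \<omega> \<in> B)) borel (\<lambda>x. (f x - p) / s) = distr (M m) borel (V i)"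
          by (subst distr_distr) (use B i in measurable)
        then show ?thesis using \<open>distr (M m) (count_space UNIV) (\<lambda>\<omega>. X m i \<omega> \<in> B) = b\<close> by simp
      qed
      also have "distr b borel (\<lambda>x. (f x - p) / s) = distr (distr b borel f) borel (\<lambda>x. (x - p) / s)"
        by (subst distr_distr) (use fm in \<open>auto simp: comp_def\<close>)
      also have "\<dots> = distr (distr K borel (Y j)) borel (\<lambda>x. (x - p) / s)"
        by (simp add: distY)
      also have "\<dots> = distr K borel (\<lambda>x. (Y j x - p) / s)"
        by (subst distr_distr) (auto simp: comp_def)
      finally show ?thesis .
    qed
    have "distr (M m) borel (\<lambda>\<omega>. \<Sum>i\<in>{1..m}. V i \<omega>) = distr K borel (\<lambda>x. \<Sum>i<m. (Y i x - p) / s)"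
    proof (rule Levy_uniqueness)
      show "real_distribution (distr (M m) borel (\<lambda>\<omega>. \<Sum>i\<in>{1..m}. V i \<omega>))"
        by (rule real_distribution_distr) (auto intro!: borel_measurable_sum)
      show "real_distribution (distr K borel (\<lambda>x. \<Sum>i<m. (Y i x - p) / s))"
        by (rule PK.real_distribution_distr) auto
      show "char (distr (M m) borel (\<lambda>\<omega>. \<Sum>i\<in>{1..m}. V i \<omega>)) = char (distr K borel (\<lambda>x. \<Sum>i<m. (Y i x - p) / s))"
      proof
        fix t
        have "char (distr (M m) borel (\<lambda>\<omega>. \<Sum>i\<in>{1..m}. V i \<omega>)) t = (\<Prod>i\<in>{1..m}. char (distr (M m) borel (V i)) t)"
          by (rule char_distr_sum[OF indV])
        also have "\<dots> = (\<Prod>i\<in>{1..m}. char (distr K borel (\<lambda>x. (Y 0 x - p) / s)) t)"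
          by (intro prod.cong refl charV)
        also have "\<dots> = (\<Prod>i<m. char (distr K borel (\<lambda>x. (Y i x - p) / s)) t)"
        proof (cases "m = 0")
          case False
          then have eq: "char (distr K borel (\<lambda>x. (Y i x - p) / s)) t = char (distr K borel (\<lambda>x. (Y 0 x - p) / s)) t" for i
            using charV[of 1 t i] charV[of 1 t 0] by simp
          have "(\<Prod>i<m. char (distr K borel (\<lambda>x. (Y i x - p) / s)) t) =
              (\<Prod>i<m. char (distr K borel (\<lambda>x. (Y 0 x - p) / s)) t)"
            by (intro prod.cong refl eq)
          then show ?thesis by simp
        qed simp
        also have "\<dots> = char (distr K borel (\<lambda>x. \<Sum>i<m. (Y i x - p) / s)) t"
          by (rule PK.char_distr_sum[OF indV', symmetric])
        finally show "char (distr (M m) borel (\<lambda>\<omega>. \<Sum>i\<in>{1..m}. V i \<omega>)) t = char (distr K borel (\<lambda>x. \<Sum>i<m. (Y i x - p) / s)) t" .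
      qed
    qed
    moreover have "(\<Sum>i\<in>{1..m}. V i \<omega>) = (real (card {i \<in> {1..m}. X m i \<omega> \<in> B}) - real m * p) / s" for \<omega>
    proof -
      have "(\<Sum>i\<in>{1..m}. indicator B (X m i \<omega>) :: real) = real (card {i \<in> {1..m}. X m i \<omega> \<in> B})"
        by (simp only: card_filter_eq_sum finite_atLeastAtMost) (auto intro!: sum.cong simp: indicator_def)
      then show ?thesis by (simp add: V_def sum_subtractf flip: sum_divide_distrib)
    qed
    ultimately show ?thesis by (simp add: s_def sg sum_divide_distrib)
  qed
  then show ?thesis using clt by simp
qed

section \<open>Weak convergence by comparison\<close>

lemma std_normal_cdf_continuous: "isCont (cdf std_normal_distribution) x"
proof -
  interpret real_distribution std_normal_distribution by (rule real_dist_normal_dist)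
  have "emeasure std_normal_distribution {x} = 0"
    by (simp add: emeasure_density nn_integral_0_iff_AE AE_lborel_singleton)
  then show ?thesis
    by (simp add: isCont_cdf emeasure_eq_measure)
qed

lemma cdf_distr_eq:
  assumes "prob_space M" "W \<in> borel_measurable M"
  shows "cdf (distr M borel W) x = measure M {\<omega> \<in> space M. W \<omega> \<le> x}"
  using assms(2) by (simp add: cdf_def2 measure_distr vimage_def Int_def conj_commute)

text \<open>Slutsky's theorem in one-sided form. The hypotheses say that \<open>W - Z\<close> is neither noticeably positive nor
noticeably negative across any fixed level \<open>x\<close>, which is what estimates of the form "if \<open>Z \<le> x - e\<close> then
\<open>W \<le> x\<close>" provide directly.\<close>
lemma weak_conv_sandwich:
  fixes M :: "nat \<Rightarrow> 'a measure" and Z W :: "nat \<Rightarrow> 'a \<Rightarrow> real"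
  assumes M: "\<And>m. prob_space (M m)"
    and Zm: "\<And>m. Z m \<in> borel_measurable (M m)" and Wm: "\<And>m. W m \<in> borel_measurable (M m)"
    and conv: "weak_conv_m (\<lambda>m. distr (M m) borel (Z m)) \<mu>"
    and cont: "\<And>x. isCont (cdf \<mu>) x"
    and up: "\<And>x e. 0 < e \<Longrightarrow>
      (\<lambda>m. measure (M m) {\<omega> \<in> space (M m). Z m \<omega> \<le> x - e \<and> x < W m \<omega>}) \<longlonglongrightarrow> 0"
    and low: "\<And>x e. 0 < e \<Longrightarrow>
      (\<lambda>m. measure (M m) {\<omega> \<in> space (M m). x + e \<le> Z m \<omega> \<and> W m \<omega> < x}) \<longlonglongrightarrow> 0"
  shows "weak_conv_m (\<lambda>m. distr (M m) borel (W m)) \<mu>"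
  unfolding weak_conv_m_def weak_conv_def
proof (intro allI impI)
  fix x
  have cZ: "(\<lambda>m. measure (M m) {\<omega> \<in> space (M m). Z m \<omega> \<le> y}) \<longlonglongrightarrow> cdf \<mu> y" for y
    using conv cont unfolding weak_conv_m_def weak_conv_def cdf_distr_eq[OF M Zm] by blast
  have main: "(\<lambda>m. measure (M m) {\<omega> \<in> space (M m). W m \<omega> \<le> x}) \<longlonglongrightarrow> cdf \<mu> x"
  proof (rule tendstoI)
    fix r :: real assume r: "0 < r"
    obtain d where d: "d > 0" "\<And>y. \<bar>y - x\<bar> < d \<Longrightarrow> \<bar>cdf \<mu> y - cdf \<mu> x\<bar> < r / 3"
      using cont[of x] r unfolding continuous_at_eps_delta real_norm_def dist_real_def
      by (meson divide_pos_pos zero_less_numeral)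
    define e where "e = d / 3"
    have e: "e > 0" using d by (simp add: e_def)
    have c1: "\<bar>cdf \<mu> (x - e) - cdf \<mu> x\<bar> < r / 3" "\<bar>cdf \<mu> (x + 2 * e) - cdf \<mu> x\<bar> < r / 3"
      using d by (auto simp: e_def)
    have ev: "\<forall>\<^sub>F m in sequentially.
        \<bar>measure (M m) {\<omega> \<in> space (M m). Z m \<omega> \<le> x - e} - cdf \<mu> (x - e)\<bar> < r / 3 \<and>
        \<bar>measure (M m) {\<omega> \<in> space (M m). Z m \<omega> \<le> x + 2 * e} - cdf \<mu> (x + 2 * e)\<bar> < r / 3 \<and>
        \<bar>measure (M m) {\<omega> \<in> space (M m). Z m \<omega> \<le> x - e \<and> x < W m \<omega>} - 0\<bar> < r / 3 \<and>
        \<bar>measure (M m) {\<omega> \<in> space (M m). (x + e) + e \<le> Z m \<omega> \<and> W m \<omega> < x + e} - 0\<bar> < r / 3"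
      using tendstoD[OF cZ, of "r / 3" "x - e"] tendstoD[OF cZ, of "r / 3" "x + 2 * e"]
        tendstoD[OF up[OF e, of x], of "r / 3"] tendstoD[OF low[OF e, of "x + e"], of "r / 3"] r
      by (auto simp: dist_real_def intro!: eventually_conj)
    then show "\<forall>\<^sub>F m in sequentially. dist (measure (M m) {\<omega> \<in> space (M m). W m \<omega> \<le> x}) (cdf \<mu> x) < r"
    proof (rule eventually_mono)
      fix m
      interpret prob_space "M m" by (rule M)
      note [measurable] = Zm[of m] Wm[of m]
      assume A: "\<bar>prob {\<omega> \<in> space (M m). Z m \<omega> \<le> x - e} - cdf \<mu> (x - e)\<bar> < r / 3 \<and>
        \<bar>prob {\<omega> \<in> space (M m). Z m \<omega> \<le> x + 2 * e} - cdf \<mu> (x + 2 * e)\<bar> < r / 3 \<and>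
        \<bar>prob {\<omega> \<in> space (M m). Z m \<omega> \<le> x - e \<and> x < W m \<omega>} - 0\<bar> < r / 3 \<and>
        \<bar>prob {\<omega> \<in> space (M m). (x + e) + e \<le> Z m \<omega> \<and> W m \<omega> < x + e} - 0\<bar> < r / 3"
      have "prob {\<omega> \<in> space (M m). Z m \<omega> \<le> x - e} \<le>
          prob ({\<omega> \<in> space (M m). W m \<omega> \<le> x} \<union> {\<omega> \<in> space (M m). Z m \<omega> \<le> x - e \<and> x < W m \<omega>})"
        by (rule finite_measure_mono) auto
      also have "\<dots> \<le> prob {\<omega> \<in> space (M m). W m \<omega> \<le> x} + prob {\<omega> \<in> space (M m). Z m \<omega> \<le> x - e \<and> x < W m \<omega>}"
        by (rule measure_Un_le) auto
      finally have 1: "prob {\<omega> \<in> space (M m). Z m \<omega> \<le> x - e} \<le> \<dots>" .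
      have "prob {\<omega> \<in> space (M m). W m \<omega> \<le> x} \<le>
          prob ({\<omega> \<in> space (M m). Z m \<omega> \<le> x + 2 * e} \<union> {\<omega> \<in> space (M m). (x + e) + e \<le> Z m \<omega> \<and> W m \<omega> < x + e})"
        using e by (intro finite_measure_mono) auto
      also have "\<dots> \<le> prob {\<omega> \<in> space (M m). Z m \<omega> \<le> x + 2 * e} + prob {\<omega> \<in> space (M m). (x + e) + e \<le> Z m \<omega> \<and> W m \<omega> < x + e}"
        by (rule measure_Un_le) auto
      finally show "dist (prob {\<omega> \<in> space (M m). W m \<omega> \<le> x}) (cdf \<mu> x) < r"
        using 1 A c1 unfolding dist_real_def by linarith
    qed
  qed
  then show "(\<lambda>m. cdf (distr (M m) borel (W m)) x) \<longlonglongrightarrow> cdf \<mu> x"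
    unfolding cdf_distr_eq[OF M Wm] .
qed

lemma weak_conv_scale:
  fixes M :: "nat \<Rightarrow> 'a measure" and W :: "nat \<Rightarrow> 'a \<Rightarrow> real"
  assumes M: "\<And>m. prob_space (M m)" and Wm: "\<And>m. W m \<in> borel_measurable (M m)"
    and \<mu>: "prob_space \<mu>" "sets \<mu> = sets borel"
    and conv: "weak_conv_m (\<lambda>m. distr (M m) borel (W m)) \<mu>"
    and cont: "\<And>x. isCont (cdf \<mu>) x" and k: "0 < k"
  shows "weak_conv_m (\<lambda>m. distr (M m) borel (\<lambda>\<omega>. k * W m \<omega>)) (distr \<mu> borel (\<lambda>x. 0 + k * x))"
  unfolding weak_conv_m_def weak_conv_def
proof (intro allI impI)
  fix x
  have le: "k * y \<le> x \<longleftrightarrow> y \<le> x / k" for y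
    using k by (simp add: field_simps)
  have "(\<lambda>x. 0 + k * x) \<in> borel_measurable \<mu>"
    using \<mu>(2) by (simp add: measurable_cong_sets[OF \<mu>(2) refl])
  from cdf_distr_eq[OF \<mu>(1) this]
  have "cdf (distr \<mu> borel (\<lambda>x. 0 + k * x)) x = measure \<mu> {y \<in> space \<mu>. y \<le> x / k}"
    by (simp add: le)
  also have "\<dots> = cdf \<mu> (x / k)"
    using sets_eq_imp_space_eq[OF \<mu>(2)] by (simp add: cdf_def2 atMost_def)
  finally have L: "cdf (distr \<mu> borel (\<lambda>x. 0 + k * x)) x = cdf \<mu> (x / k)" .
  have "cdf (distr (M m) borel (\<lambda>\<omega>. k * W m \<omega>)) x = cdf (distr (M m) borel (W m)) (x / k)" for m
    using Wm[of m] by (simp add: cdf_distr_eq[OF M] le)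
  then show "(\<lambda>m. cdf (distr (M m) borel (\<lambda>\<omega>. k * W m \<omega>)) x) \<longlonglongrightarrow> cdf (distr \<mu> borel (\<lambda>x. 0 + k * x)) x"
    using conv cont L unfolding weak_conv_m_def weak_conv_def by auto
qed

section \<open>Stochastic equicontinuity of the empirical process\<close>

text \<open>A dyadic point of level \<open>Suc j\<close> is a point of level \<open>j\<close> or the right neighbour of one, so each level adds at
most one increment.\<close>
lemma dyadic_chaining:
  fixes D :: "real \<Rightarrow> real"
  assumes incr: "\<And>j k. j \<le> J \<Longrightarrow> k < 2 ^ j \<Longrightarrow>
      \<bar>D (b + h * real (Suc k) / 2 ^ j) - D (b + h * real k / 2 ^ j)\<bar> \<le> d * r ^ j"
    and j: "j \<le> J" and k: "k \<le> 2 ^ j" and d: "0 \<le> d" "0 \<le> r"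
  shows "\<bar>D (b + h * real k / 2 ^ j) - D b\<bar> \<le> d * (\<Sum>i\<le>j. r ^ i)"
  using j k
proof (induction j arbitrary: k)
  case 0
  then have "k = 0 \<or> k = 1" by auto
  then show ?case using incr[of 0 0] d by auto
next
  case (Suc j)
  have even: "\<bar>D (b + h * real (2 * l) / 2 ^ Suc j) - D b\<bar> \<le> d * (\<Sum>i\<le>j. r ^ i)" if "l \<le> 2 ^ j" for l
    using Suc.IH[of l] Suc.prems that by simp
  show ?case
  proof (cases "even k")
    case True
    then obtain l where l: "k = 2 * l" by auto
    have "0 \<le> d * r ^ Suc j" using d by simp
    then show ?thesis using even[of l] Suc.prems l by (simp add: distrib_left)
  next
    case False
    then obtain l where l: "k = Suc (2 * l)" by (metis oddE Suc_eq_plus1)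
    then have "2 * l < 2 ^ Suc j" using Suc.prems by simp
    then have "\<bar>D (b + h * real k / 2 ^ Suc j) - D (b + h * real (2 * l) / 2 ^ Suc j)\<bar> \<le> d * r ^ Suc j"
      and "\<bar>D (b + h * real (2 * l) / 2 ^ Suc j) - D b\<bar> \<le> d * (\<Sum>i\<le>j. r ^ i)"
      using incr[of "Suc j" "2 * l"] even[of l] Suc.prems l by auto
    then show ?thesis by (simp add: distrib_left)
  qed
qed

lemma empirical_cdf_mono: "s \<le> t \<Longrightarrow> empirical_cdf m p s \<le> empirical_cdf m p t"
  unfolding empirical_cdf_def
  by (intro divide_right_mono of_nat_mono card_mono) auto

lemma empirical_cdf_bounds: "0 \<le> empirical_cdf m p t" "empirical_cdf m p t \<le> 1"
proof -
  have "card {i \<in> {1..m}. p i \<le> t} \<le> card {1..m}"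
    by (intro card_mono) auto
  then show "empirical_cdf m p t \<le> 1"
    unfolding empirical_cdf_def by (cases "m = 0") (auto simp: field_simps)
qed (simp add: empirical_cdf_def)

definition emp_process :: "nat \<Rightarrow> (nat \<Rightarrow> real) \<Rightarrow> (real \<Rightarrow> real) \<Rightarrow> real \<Rightarrow> real" where
  "emp_process m p G t = sqrt (real m) * (empirical_cdf m p t - G t)"

lemma emp_process_increment:
  assumes "s \<le> t" "0 < m"
  shows "emp_process m p G t - emp_process m p G s =
    (real (card {i \<in> {1..m}. p i \<in> {s<..t}}) - real m * (G t - G s)) / sqrt (real m)"
proof -
  have "{i \<in> {1..m}. p i \<le> t} = {i \<in> {1..m}. p i \<le> s} \<union> {i \<in> {1..m}. p i \<in> {s<..t}}"
    using assms(1) by auto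
  moreover have "{i \<in> {1..m}. p i \<le> s} \<inter> {i \<in> {1..m}. p i \<in> {s<..t}} = {}" by auto
  ultimately have c: "card {i \<in> {1..m}. p i \<le> t} = card {i \<in> {1..m}. p i \<le> s} + card {i \<in> {1..m}. p i \<in> {s<..t}}"
    by (simp add: card_Un_disjoint)
  have s: "sqrt (real m) * sqrt (real m) = real m" "sqrt (real m) \<noteq> 0" using assms by auto
  define w where "w = sqrt (real m)"
  have m: "real m = w * w" "w \<noteq> 0" using s by (auto simp: w_def)
  show ?thesis
    unfolding emp_process_def empirical_cdf_def c w_def[symmetric] of_nat_add m(1)
    using m(2) by (simp add: field_simps)
qed

lemma (in prob_space) emp_process_increment_tail:
  assumes ind: "indep_vars (\<lambda>_. borel) P {1..m}"
    and G: "\<And>i. i \<in> {1..m} \<Longrightarrow> prob {\<omega> \<in> space M. P i \<omega> \<in> {s<..t}} = G t - G s"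
    and st: "s \<le> t" and q: "G t - G s \<le> q" "1 \<le> real m * q" and c: "0 < c"
  shows "prob {\<omega> \<in> space M. c \<le> \<bar>emp_process m (\<lambda>i. P i \<omega>) G t - emp_process m (\<lambda>i. P i \<omega>) G s\<bar>}
    \<le> 4 * q\<^sup>2 / c ^ 4"
proof -
  have m: "0 < m" using q(2) by (cases "m = 0") auto
  have "c \<le> \<bar>emp_process m (\<lambda>i. P i \<omega>) G t - emp_process m (\<lambda>i. P i \<omega>) G s\<bar> \<longleftrightarrow>
     c * sqrt (real m) \<le> \<bar>real (card {i \<in> {1..m}. P i \<omega> \<in> {s<..t}}) - real m * (G t - G s)\<bar>" for \<omega>
    unfolding emp_process_increment[OF st m] using m by (simp add: abs_divide pos_le_divide_eq)
  then show ?thesis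
    using indep_count_tail[OF ind _ G q c] by simp
qed

lemma count_measurable:
  fixes m :: nat
  assumes "\<And>i. i \<in> {1..m} \<Longrightarrow> Measurable.pred M (\<lambda>\<omega>. Q i \<omega>)"
  shows "(\<lambda>\<omega>. real (card {i \<in> {1..m}. Q i \<omega>})) \<in> borel_measurable M"
proof -
  have "real (card {i \<in> {1..m}. Q i \<omega>}) = (\<Sum>i\<in>{1..m}. of_bool (Q i \<omega>))" for \<omega>
    by (rule card_filter_eq_sum) simp
  then have "(\<lambda>\<omega>. real (card {i \<in> {1..m}. Q i \<omega>})) = (\<lambda>\<omega>. \<Sum>i\<in>{1..m}. of_bool (Q i \<omega>))"
    by (rule ext)
  moreover have "(\<lambda>\<omega>. of_bool (Q i \<omega>) :: real) \<in> borel_measurable M" if "i \<in> {1..m}" for i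
    using assms[OF that] by measurable
  ultimately show ?thesis by (simp only:) (rule borel_measurable_sum)
qed

lemma empirical_cdf_measurable:
  assumes "\<And>i. i \<in> {1..m} \<Longrightarrow> P i \<in> borel_measurable M"
  shows "(\<lambda>\<omega>. empirical_cdf m (\<lambda>i. P i \<omega>) t) \<in> borel_measurable M"
  unfolding empirical_cdf_def
  by (intro borel_measurable_divide count_measurable borel_measurable_const) (use assms in measurable)

lemma emp_process_measurable:
  assumes "\<And>i. i \<in> {1..m} \<Longrightarrow> P i \<in> borel_measurable M"
  shows "(\<lambda>\<omega>. emp_process m (\<lambda>i. P i \<omega>) G t) \<in> borel_measurable M"
  unfolding emp_process_def
  using empirical_cdf_measurable[of m P M t] assms by measurable

text \<open>Between two grid points both the empirical distribution function and \<open>G\<close> are monotone, so the process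
moves by at most the scaled increment of \<open>G\<close> over a grid cell.\<close>
lemma emp_process_grid_to_interval:
  assumes grid: "\<And>k. k \<le> 2 ^ J \<Longrightarrow> \<bar>emp_process m p G (b + h * real k / 2 ^ J) - emp_process m p G b\<bar> \<le> e"
    and Gm: "\<And>s t. b \<le> s \<Longrightarrow> s \<le> t \<Longrightarrow> t \<le> b + h \<Longrightarrow> G s \<le> G t"
    and Lip: "\<And>s t. b \<le> s \<Longrightarrow> s \<le> t \<Longrightarrow> t \<le> b + h \<Longrightarrow> G t - G s \<le> L * (t - s)"
    and small: "sqrt (real m) * (L * (h / 2 ^ J)) \<le> d" and h: "0 < h" and s: "s \<in> {b..b + h}"
  shows "\<bar>emp_process m p G s - emp_process m p G b\<bar> \<le> e + d"
proof -
  define n :: nat where "n = 2 ^ J"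
  have n0: "n > 0" by (simp add: n_def)
  have n2: "real n = 2 ^ J" by (simp add: n_def)
  define x where "x = (s - b) / h * real n"
  have x0: "0 \<le> x" "x \<le> real n"
  proof -
    have "(s - b) / h \<le> 1" using s h by simp
    then show "x \<le> real n" unfolding x_def using s h by (intro mult_left_le_one_le) auto
  qed (use s h in \<open>simp add: x_def\<close>)
  have sx: "s = b + h * x / real n" using h n0 by (simp add: x_def)
  obtain k where k: "k < n" "real k \<le> x" "x \<le> real (Suc k)"
  proof (cases "x = real n")
    case True
    show ?thesis using that[of "n - 1"] n0 True by (auto simp: of_nat_diff)
  next
    case False
    have "real (nat \<lfloor>x\<rfloor>) \<le> x" "x < real (nat \<lfloor>x\<rfloor>) + 1" using x0 by linarith+
    moreover have "nat \<lfloor>x\<rfloor> < n" using x0 False by linarith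
    moreover have "x \<le> real (Suc (nat \<lfloor>x\<rfloor>))" using x0 by linarith
    ultimately show ?thesis using that[of "nat \<lfloor>x\<rfloor>"] by auto
  qed
  define u where "u = b + h * real k / real n"
  define v where "v = b + h * real (Suc k) / real n"
  have bu: "b \<le> u" using h by (simp add: u_def)
  have us: "u \<le> s" unfolding u_def sx using k h n0 by (simp add: divide_right_mono mult_left_mono)
  have sv: "s \<le> v" unfolding v_def sx using k h n0 by (intro add_left_mono divide_right_mono mult_left_mono) auto
  have "h * real (Suc k) \<le> h * real n" using k h by (intro mult_left_mono) auto
  then have vb: "v \<le> b + h" unfolding v_def using n0 h by (simp add: divide_le_eq)
  have vu: "v - u = h / real n" unfolding u_def v_def using n0 by (simp add: field_simps)
  have gu: "\<bar>emp_process m p G u - emp_process m p G b\<bar> \<le> e"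
    and gv: "\<bar>emp_process m p G v - emp_process m p G b\<bar> \<le> e"
    using grid[of k] grid[of "Suc k"] k(1) by (simp_all add: u_def v_def n2 n_def)
  have step: "sqrt (real m) * (G v - G u) \<le> d"
  proof -
    have "sqrt (real m) * (G v - G u) \<le> sqrt (real m) * (L * (v - u))"
      using Lip[of u v] bu us sv vb by (intro mult_left_mono) auto
    then show ?thesis using small by (simp add: vu n2)
  qed
  have 1: "sqrt (real m) * (G v - G s) \<le> sqrt (real m) * (G v - G u)"
    using Gm[of u s] bu us sv vb by (intro mult_left_mono) auto
  have 2: "sqrt (real m) * (G s - G u) \<le> sqrt (real m) * (G v - G u)"
    using Gm[of s v] bu us sv vb by (intro mult_left_mono) auto
  have 3: "sqrt (real m) * empirical_cdf m p s \<le> sqrt (real m) * empirical_cdf m p v"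
    "sqrt (real m) * empirical_cdf m p u \<le> sqrt (real m) * empirical_cdf m p s"
    using empirical_cdf_mono us sv by (auto intro!: mult_left_mono)
  show ?thesis
    using gu gv step 1 2 3 unfolding emp_process_def right_diff_distrib by linarith
qed

text \<open>Chaining. At level \<open>j\<close> there are \<open>2^j\<close> increments, each over an interval of mass at most \<open>L * h / 2^j\<close>. Allowing
oscillation \<open>d * r^j\<close> at that level costs probability of order \<open>(L * h)\<^sup>2 / d^4 * (1 / (2 * r^4))^j\<close>. With \<open>r = 9/10\<close>
both \<open>r < 1\<close> and \<open>2 * r^4 > 1\<close> hold, so the oscillations and the probabilities are both summable. The quadratic
dependence on \<open>h\<close> makes the bound small on short intervals, uniformly in large \<open>m\<close>.\<close>
lemma (in prob_space) emp_process_modulus: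
  assumes ind: "indep_vars (\<lambda>_. borel) P {1..m}"
    and G: "\<And>i s t. i \<in> {1..m} \<Longrightarrow> b \<le> s \<Longrightarrow> s \<le> t \<Longrightarrow> t \<le> b + h \<Longrightarrow>
        prob {\<omega> \<in> space M. P i \<omega> \<in> {s<..t}} = G t - G s"
    and Gm: "\<And>s t. b \<le> s \<Longrightarrow> s \<le> t \<Longrightarrow> t \<le> b + h \<Longrightarrow> G s \<le> G t"
    and Lip: "\<And>s t. b \<le> s \<Longrightarrow> s \<le> t \<Longrightarrow> t \<le> b + h \<Longrightarrow> G t - G s \<le> L * (t - s)"
    and L: "0 < L" and h: "0 < h" and d: "0 < d"
    and m: "d < sqrt (real m) * (L * h)" "2 \<le> sqrt (real m) * d"
  shows "\<exists>A\<in>events. prob A \<le> 20 * (L * h)\<^sup>2 / d ^ 4 \<and>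
     (\<forall>\<omega>\<in>space M - A. \<forall>s\<in>{b..b + h}. \<bar>emp_process m (\<lambda>i. P i \<omega>) G s - emp_process m (\<lambda>i. P i \<omega>) G b\<bar> \<le> 11 * d)"
proof -
  define r :: real where "r = 9 / 10"
  define w where "w = sqrt (real m)"
  have w: "w > 0" "w * w = real m" using m(2) d by (auto simp: w_def intro: ccontr)
  have [measurable]: "P i \<in> borel_measurable M" if "i \<in> {1..m}" for i
    using ind that unfolding indep_vars_def by auto
  define pt where "pt = (\<lambda>j k. b + h * real k / 2 ^ j)"
  define V where "V = (\<lambda>\<omega> s. emp_process m (\<lambda>i. P i \<omega>) G s)"
  have Vm[measurable]: "(\<lambda>\<omega>. V \<omega> s) \<in> borel_measurable M" for s
    unfolding V_def by (rule emp_process_measurable) auto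
  \<comment> \<open>Stop at the first level whose cells have scaled mass at most \<open>d\<close>. By the second inequality the cells are not so small that the fourth moment bound fails.\<close>
  obtain J where J: "w * (L * (h / 2 ^ J)) \<le> d" "d < 2 * (w * (L * (h / 2 ^ J)))"
  proof -
    have "\<exists>j. w * (L * h) / d < 2 ^ j" using real_arch_pow[of 2 "w * (L * h) / d"] by auto
    then have ex: "\<exists>j. w * (L * h) \<le> d * 2 ^ j" using d by (auto simp: field_simps intro: less_imp_le)
    define J where "J = (LEAST j. w * (L * h) \<le> d * 2 ^ j)"
    have J1: "w * (L * h) \<le> d * 2 ^ J" unfolding J_def using LeastI_ex[OF ex] .
    have "J \<noteq> 0" using J1 m(1) by (intro notI) (simp add: w_def)
    then obtain J' where J': "J = Suc J'" by (cases J) auto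
    have "\<not> w * (L * h) \<le> d * 2 ^ J'"
      using not_less_Least[of J' "\<lambda>j. w * (L * h) \<le> d * 2 ^ j"] J' unfolding J_def by auto
    then have "d * 2 ^ J < 2 * (w * (L * h))" using J' by simp
    then show ?thesis using that[of J] J1 by (simp add: field_simps)
  qed
  define A where "A = (\<lambda>j k. {\<omega> \<in> space M. d * r ^ j \<le> \<bar>V \<omega> (pt j (Suc k)) - V \<omega> (pt j k)\<bar>})"
  have Am[measurable]: "A j k \<in> events" for j k unfolding A_def by measurable
  have pA: "prob (A j k) \<le> 4 * (L * (h / 2 ^ j))\<^sup>2 / (d * r ^ j) ^ 4" if jk: "j \<le> J" "k < 2 ^ j" for j k
  proof -
    have le: "pt j k \<le> pt j (Suc k)" using h by (simp add: pt_def divide_right_mono mult_left_mono)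
    have diff: "pt j (Suc k) - pt j k = h / 2 ^ j" by (simp add: pt_def field_simps)
    have "real (Suc k) \<le> 2 ^ j" using jk(2) by (metis Suc_leI of_nat_le_iff of_nat_numeral of_nat_power)
    then have "h * real (Suc k) \<le> h * 2 ^ j" using h by (intro mult_left_mono) auto
    then have ub: "pt j (Suc k) \<le> b + h" by (simp add: pt_def divide_le_eq)
    have lb: "b \<le> pt j k" using h by (simp add: pt_def)
    have q1: "G (pt j (Suc k)) - G (pt j k) \<le> L * (h / 2 ^ j)"
      using Lip[OF lb le ub] by (simp add: diff)
    have "2 \<le> w * (2 * (w * (L * (h / 2 ^ J))))"
      using m(2) J(2) w(1) by (smt (verit) mult_left_mono w_def)
    also have "\<dots> = 2 * (w * w * (L * (h / 2 ^ J)))"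
      by (simp only: mult.left_commute mult.commute mult.assoc)
    finally have "1 \<le> real m * (L * (h / 2 ^ J))" unfolding w(2) by linarith
    also have "\<dots> \<le> real m * (L * (h / 2 ^ j))"
      using jk(1) L h by (intro mult_left_mono divide_left_mono) (auto simp: power_increasing)
    finally have q2: "1 \<le> real m * (L * (h / 2 ^ j))" .
    show ?thesis
      using emp_process_increment_tail[OF ind G[OF _ lb le ub] le q1 q2, of "d * r ^ j"] d
      unfolding A_def V_def by (auto simp: r_def)
  qed
  define U where "U = (\<Union>j\<in>{..J}. \<Union>k\<in>{..<2 ^ j}. A j k)"
  have [measurable]: "U \<in> events" unfolding U_def by measurable
  have "prob U \<le> (\<Sum>j\<in>{..J}. prob (\<Union>k\<in>{..<2 ^ j}. A j k))"
    unfolding U_def by (rule measure_UNION_le) auto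
  also have "\<dots> \<le> (\<Sum>j\<in>{..J}. 4 * (L * h)\<^sup>2 / d ^ 4 * (1 / (2 * r ^ 4)) ^ j)"
  proof (rule sum_mono)
    fix j assume j: "j \<in> {..J}"
    have "prob (\<Union>k\<in>{..<2 ^ j}. A j k) \<le> (\<Sum>k\<in>{..<2 ^ j}. prob (A j k))"
      by (rule measure_UNION_le) auto
    also have "\<dots> \<le> (\<Sum>k\<in>{..<2 ^ j :: nat}. 4 * (L * (h / 2 ^ j))\<^sup>2 / (d * r ^ j) ^ 4)"
      using pA j by (intro sum_mono) auto
    also have "\<dots> = 2 ^ j * (4 * (L * (h / 2 ^ j))\<^sup>2 / (d * r ^ j) ^ 4)" by simp
    also have "\<dots> = 4 * (L * h)\<^sup>2 / d ^ 4 * (1 / (2 * r ^ 4)) ^ j"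
    proof -
      have *: "(r ^ j) ^ 4 = (r ^ 4) ^ j" by (metis power_mult mult.commute)
      define y :: real where "y = 2 ^ j"
      have y: "y \<noteq> 0" by (simp add: y_def)
      have "(1 / (2 * r ^ 4)) ^ j = 1 / (y * (r ^ j) ^ 4)"
        by (simp add: power_divide power_mult_distrib * y_def)
      then show ?thesis unfolding y_def[symmetric] using y
        by (simp add: power_mult_distrib power_divide power2_eq_square ac_simps)
    qed
    finally show "prob (\<Union>k\<in>{..<2 ^ j}. A j k) \<le> 4 * (L * h)\<^sup>2 / d ^ 4 * (1 / (2 * r ^ 4)) ^ j" .
  qed
  also have "\<dots> = 4 * (L * h)\<^sup>2 / d ^ 4 * (\<Sum>j\<le>J. (1 / (2 * r ^ 4)) ^ j)"
    by (simp add: sum_distrib_left)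
  also have "\<dots> \<le> 4 * (L * h)\<^sup>2 / d ^ 4 * 5"
  proof (rule mult_left_mono)
    have \<rho>: "1 / (2 * r ^ 4) = 5000 / 6561" by (simp add: r_def power_divide)
    have "(\<Sum>j\<le>J. (5000 / 6561 :: real) ^ j) \<le> (\<Sum>j. (5000 / 6561) ^ j)"
      by (rule sum_le_suminf) (auto intro!: summable_geometric simp del: power_divide)
    also have "\<dots> = 1 / (1 - 5000 / 6561)"
      by (rule suminf_geometric) simp
    finally show "(\<Sum>j\<le>J. (1 / (2 * r ^ 4)) ^ j) \<le> 5" unfolding \<rho> by simp
  qed (use d in auto)
  finally have pU: "prob U \<le> 20 * (L * h)\<^sup>2 / d ^ 4" by simp
  moreover have "\<bar>V \<omega> s - V \<omega> b\<bar> \<le> 11 * d" if \<omega>: "\<omega> \<in> space M - U" and s: "s \<in> {b..b + h}" for \<omega> s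
  proof -
    have inc: "\<bar>V \<omega> (b + h * real (Suc k) / 2 ^ j) - V \<omega> (b + h * real k / 2 ^ j)\<bar> \<le> d * r ^ j"
      if "j \<le> J" "k < 2 ^ j" for j k
    proof -
      have "\<omega> \<notin> A j k" using \<omega> that unfolding U_def by auto
      then show ?thesis using \<omega> unfolding A_def pt_def by auto
    qed
    have geo: "(\<Sum>i\<le>J. r ^ i) \<le> 10"
    proof -
      have "(\<Sum>i\<le>J. r ^ i) \<le> (\<Sum>i. r ^ i)"
        by (rule sum_le_suminf) (auto simp: r_def summable_geometric)
      also have "\<dots> = 1 / (1 - r)" by (rule suminf_geometric) (simp add: r_def)
      finally show ?thesis by (simp add: r_def)
    qed
    have "\<bar>V \<omega> (b + h * real k / 2 ^ J) - V \<omega> b\<bar> \<le> 10 * d" if "k \<le> 2 ^ J" for k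
    proof -
      have "\<bar>V \<omega> (b + h * real k / 2 ^ J) - V \<omega> b\<bar> \<le> d * (\<Sum>i\<le>J. r ^ i)"
        by (rule dyadic_chaining[OF inc _ that]) (use d in \<open>auto simp: r_def\<close>)
      also have "\<dots> \<le> d * 10" using geo d by (intro mult_left_mono) auto
      finally show ?thesis by simp
    qed
    then have "\<bar>V \<omega> s - V \<omega> b\<bar> \<le> 10 * d + d"
      unfolding V_def by (rule emp_process_grid_to_interval[OF _ Gm Lip]) (use J w h s in \<open>auto simp: w_def\<close>)
    then show ?thesis by simp
  qed
  ultimately show ?thesis unfolding V_def by (intro bexI[of _ U]) auto
qed

section \<open>The threshold as the last crossing of a line\<close>

text \<open>The point \<open>0\<close> always counts as a crossing, whatever \<open>C 0\<close> is. This matches the value \<open>0 / x = 0\<close> of the estimated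
ratio at \<open>0\<close> and keeps the set nonempty.\<close>
definition last_crossing :: "(real \<Rightarrow> real) \<Rightarrow> real \<Rightarrow> real" where
  "last_crossing C \<beta> = Sup {t. 0 \<le> t \<and> t \<le> 1 \<and> (t = 0 \<or> \<beta> * t \<le> C t)}"

text \<open>The truncation of the estimate at \<open>t\<close> from below is invisible here: the line of slope \<open>(1 - a) / \<alpha> > 1\<close> lies
strictly above the diagonal.\<close>
lemma T_PI_eq_last_crossing:
  assumes "0 < \<alpha>" "\<alpha> < 1 - a"
  shows "T_PI \<Phi> a \<alpha> m p = last_crossing (\<Phi> (empirical_cdf m p)) ((1 - a) / \<alpha>)"
proof -
  have "Q_fun a (G_hat \<Phi> m p) t \<le> \<alpha> \<longleftrightarrow> t = 0 \<or> (1 - a) / \<alpha> * t \<le> \<Phi> (empirical_cdf m p) t"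
    if t: "0 \<le> t" for t
  proof (cases "t = 0")
    case True
    then show ?thesis using assms by (simp add: Q_fun_def)
  next
    case False
    define C where "C = \<Phi> (empirical_cdf m p) t"
    have tp: "0 < t" using t False by simp
    have mx: "0 < max C t" using tp by simp
    have "1 * t < (1 - a) / \<alpha> * t" using tp assms by (intro mult_strict_right_mono) (auto simp: less_divide_eq)
    then have "(1 - a) / \<alpha> * t \<le> max C t \<longleftrightarrow> (1 - a) / \<alpha> * t \<le> C" by auto
    moreover have "(1 - a) * t / max C t \<le> \<alpha> \<longleftrightarrow> (1 - a) / \<alpha> * t \<le> max C t"
      using mx assms by (simp add: pos_divide_le_eq mult.commute)
    ultimately show ?thesis using False by (simp add: Q_fun_def G_hat_def C_def)
  qed
  then have "{t. 0 \<le> t \<and> t \<le> 1 \<and> Q_fun a (G_hat \<Phi> m p) t \<le> \<alpha>} =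
    {t. 0 \<le> t \<and> t \<le> 1 \<and> (t = 0 \<or> (1 - a) / \<alpha> * t \<le> \<Phi> (empirical_cdf m p) t)}"
    by auto
  then show ?thesis
    by (simp add: T_PI_def sup_inverse_def last_crossing_def)
qed

lemma last_crossing_ge: "0 \<le> t \<Longrightarrow> t \<le> 1 \<Longrightarrow> \<beta> * t \<le> C t \<Longrightarrow> t \<le> last_crossing C \<beta>"
  unfolding last_crossing_def by (rule cSup_upper) (auto intro!: bdd_aboveI[of _ 1])

lemma last_crossing_le:
  assumes "0 \<le> t" "\<And>s. t < s \<Longrightarrow> s \<le> 1 \<Longrightarrow> C s < \<beta> * s"
  shows "last_crossing C \<beta> \<le> t"
  unfolding last_crossing_def
proof (rule cSup_least)
  show "{t. 0 \<le> t \<and> t \<le> 1 \<and> (t = 0 \<or> \<beta> * t \<le> C t)} \<noteq> {}" by (auto intro: exI[of _ 0])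
  fix s assume "s \<in> {t. 0 \<le> t \<and> t \<le> 1 \<and> (t = 0 \<or> \<beta> * t \<le> C t)}"
  then show "s \<le> t" using assms(1) assms(2)[of s] by force
qed

lemma last_crossing_unit: "0 \<le> last_crossing C \<beta>" "last_crossing C \<beta> \<le> 1"
proof -
  show "0 \<le> last_crossing C \<beta>"
    unfolding last_crossing_def by (rule cSup_upper) (auto intro!: bdd_aboveI[of _ 1])
qed (rule last_crossing_le, auto)

lemma less_last_crossing_iff:
  assumes "0 \<le> x"
  shows "x < last_crossing C \<beta> \<longleftrightarrow> (\<exists>t. x < t \<and> t \<le> 1 \<and> \<beta> * t \<le> C t)"
proof
  assume "x < last_crossing C \<beta>"
  then have "\<exists>t\<in>{t. 0 \<le> t \<and> t \<le> 1 \<and> (t = 0 \<or> \<beta> * t \<le> C t)}. x < t"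
    unfolding last_crossing_def
    by (subst less_cSup_iff[symmetric]) (auto intro!: bdd_aboveI[of _ 1] exI[of _ 0])
  then show "\<exists>t. x < t \<and> t \<le> 1 \<and> \<beta> * t \<le> C t" using assms by force
next
  assume "\<exists>t. x < t \<and> t \<le> 1 \<and> \<beta> * t \<le> C t"
  then obtain t where "x < t" "t \<le> 1" "\<beta> * t \<le> C t" by auto
  then show "x < last_crossing C \<beta>" using last_crossing_ge[of t \<beta> C] assms by simp
qed

lemma affine_concave_on: "concave_on {0..1} (\<lambda>x. u + v * x :: real)"
proof -
  have "(c * u + d * u) + v * (c * x + d * y) = c * (u + v * x) + d * (u + v * y)" for c d x y :: real
    by (simp add: algebra_simps)
  moreover have "c * u + d * u = u" if "c + d = 1" for c d :: real
    using that by (metis distrib_right mult_1)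
  ultimately show ?thesis unfolding concave_on_iff by (metis convex_closed_interval order_refl real_scaleR_def)
qed

lemma concave_majorant_le:
  assumes "\<And>x. x \<in> {0..1} \<Longrightarrow> 0 \<le> f x" and h: "concave_on {0..1} h" "\<And>x. x \<in> {0..1} \<Longrightarrow> f x \<le> h x"
    and t: "t \<in> {0..1}"
  shows "least_concave_majorant f t \<le> h t"
  unfolding least_concave_majorant_def
proof (rule cInf_lower)
  show "bdd_below {h t |h. concave_on {0..1} h \<and> (\<forall>s\<in>{0..1}. f s \<le> h s)}"
    using assms(1)[OF t] t by (auto intro!: bdd_belowI[of _ 0] dest: bspec[of _ _ t])
qed (use h in auto)

lemma le_concave_majorant:
  assumes "\<And>x. x \<in> {0..1} \<Longrightarrow> f x \<le> b"
    and "\<And>h. concave_on {0..1} h \<Longrightarrow> (\<And>x. x \<in> {0..1} \<Longrightarrow> f x \<le> h x) \<Longrightarrow> y \<le> h t"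
  shows "y \<le> least_concave_majorant f t"
  unfolding least_concave_majorant_def
proof (rule cInf_greatest)
  show "{h t |h. concave_on {0..1} h \<and> (\<forall>s\<in>{0..1}. f s \<le> h s)} \<noteq> {}"
    using affine_concave_on[of b 0] assms(1) by auto
qed (use assms(2) in auto)

lemma least_concave_majorant_upper:
  assumes "\<And>x. x \<in> {0..1} \<Longrightarrow> f x \<le> b" "t \<in> {0..1}"
  shows "f t \<le> least_concave_majorant f t"
  using assms by (intro le_concave_majorant[of f b]) auto

text \<open>A concave function that is nonnegative at \<open>0\<close> has nonincreasing slopes as seen from the origin, and this
passes to the infimum over all concave majorants.\<close>
lemma concave_majorant_star_shaped:
  assumes "\<And>x. x \<in> {0..1} \<Longrightarrow> 0 \<le> f x" "\<And>x. x \<in> {0..1} \<Longrightarrow> f x \<le> b" and st: "0 < s" "s \<le> t" "t \<le> 1"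
  shows "(s / t) * least_concave_majorant f t \<le> least_concave_majorant f s"
proof (rule le_concave_majorant)
  fix h assume h: "concave_on {0..1} h" "\<And>x. x \<in> {0..1} \<Longrightarrow> f x \<le> h x"
  have "(s / t) * least_concave_majorant f t \<le> (s / t) * h t"
    using concave_majorant_le[of f h t] assms h st by (intro mult_left_mono) auto
  also have "\<dots> \<le> (1 - s / t) * h 0 + (s / t) * h t"
    using h(2)[of 0] assms(1)[of 0] st by simp
  also have "\<dots> \<le> h ((1 - s / t) *\<^sub>R 0 + (s / t) *\<^sub>R t)"
    using st by (intro concave_onD[OF h(1)]) auto
  finally show "(s / t) * least_concave_majorant f t \<le> h s" using st by simp
qed (use assms in auto)

text \<open>An affine function with nonnegative intercept that is below the line through the origin at \<open>t\<close> stays below it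
to the right of \<open>t\<close>.\<close>
lemma last_crossing_le_affine:
  assumes C: "\<And>s. s \<in> {0..1} \<Longrightarrow> C s \<le> u + v * s" and u: "0 \<le> u"
    and t: "0 < t" "u + v * t < \<beta> * t"
  shows "last_crossing C \<beta> \<le> t"
proof (rule last_crossing_le)
  fix s assume s: "t < s" "s \<le> 1"
  have "t * (u + v * s) \<le> s * (u + v * t)"
    using mult_right_mono[of t s u] s u by (simp add: algebra_simps)
  also have "\<dots> < s * (\<beta> * t)" using s t by (intro mult_strict_left_mono) auto
  finally have "u + v * s < \<beta> * s" using t by (simp add: mult.left_commute mult.commute)
  then show "C s < \<beta> * s" using C[of s] s t by simp
qed (use t in simp)

lemma Phi_ge_empirical:
  assumes "\<Phi> = (\<lambda>f. f) \<or> \<Phi> = least_concave_majorant" "t \<in> {0..1}"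
  shows "empirical_cdf m p t \<le> \<Phi> (empirical_cdf m p) t"
  using assms least_concave_majorant_upper[of "empirical_cdf m p" 1 t] empirical_cdf_bounds by auto

lemma Phi_le_affine:
  assumes "\<Phi> = (\<lambda>f. f) \<or> \<Phi> = least_concave_majorant" "t \<in> {0..1}"
    and "\<And>s. s \<in> {0..1} \<Longrightarrow> empirical_cdf m p s \<le> u + v * s"
  shows "\<Phi> (empirical_cdf m p) t \<le> u + v * t"
  using assms concave_majorant_le[OF _ affine_concave_on[of u v], of "empirical_cdf m p"] empirical_cdf_bounds by auto

text \<open>At an interior point a concave majorant may be replaced by its supporting line, the line by one with rational
coefficients, and, since \<open>f\<close> is monotone, the condition of being a majorant need only be checked at rational
points. This expresses the value of the majorant through countably many values of \<open>f\<close>, which gives measurability.\<close>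
lemma concave_majorant_ge_iff_rational:
  assumes f: "\<And>x. x \<in> {0..1} \<Longrightarrow> 0 \<le> f x" "\<And>x. x \<in> {0..1} \<Longrightarrow> f x \<le> b" "mono_on {0..1} f"
    and s: "0 < s" "s < 1"
  shows "y \<le> least_concave_majorant f s \<longleftrightarrow>
    (\<forall>q\<in>\<rat>. \<forall>r\<in>\<rat>. (\<forall>x\<in>\<rat> \<inter> {0..1}. f x \<le> q + r * x) \<longrightarrow> y \<le> q + r * s)" (is "_ \<longleftrightarrow> ?R")
proof
  assume L: "y \<le> least_concave_majorant f s"
  show ?R
  proof (intro ballI impI)
    fix q r :: real
    assume A: "\<forall>x\<in>\<rat> \<inter> {0..1}. f x \<le> q + r * x"
    have maj: "f x \<le> q + r * x" if x: "x \<in> {0..1}" for x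
    proof (cases "x = 1")
      case True
      then show ?thesis using bspec[OF A, of 1] by simp
    next
      case False
      show ?thesis
      proof (rule ccontr)
        assume "\<not> ?thesis"
        then have gap: "0 < f x - (q + r * x)" (is "0 < ?d") by simp
        define B where "B = \<bar>r\<bar> + 1"
        have B: "0 < B" "r \<le> B" unfolding B_def by linarith+
        have "0 < ?d / B" using gap B by simp
        moreover have x01: "0 \<le> x" "x < 1" using x False by auto
        ultimately have "x < min 1 (x + ?d / B)" by simp
        then obtain k where k: "k \<in> \<rat>" "x < k" "k < 1" "k - x < ?d / B"
          using Rats_dense_in_real[of x "min 1 (x + ?d / B)"] by auto
        have "r * (k - x) \<le> B * (k - x)" using B k by (intro mult_right_mono) auto
        also have "\<dots> < ?d" using k(4) B by (simp add: pos_less_divide_eq mult.commute)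
        finally have "q + r * k < f x" by (simp add: algebra_simps)
        also have "f x \<le> f k" using k x by (intro mono_onD[OF f(3)]) auto
        finally show False using A k x01 by (auto dest!: bspec[of _ _ k])
      qed
    qed
    have "least_concave_majorant f s \<le> q + r * s"
      by (rule concave_majorant_le[OF _ affine_concave_on]) (use f maj s in auto)
    then show "y \<le> q + r * s" using L by simp
  qed
next
  assume R: ?R
  show "y \<le> least_concave_majorant f s"
  proof (rule le_concave_majorant[OF f(2)])
    fix h assume h: "concave_on {0..1} h" "\<And>x. x \<in> {0..1} \<Longrightarrow> f x \<le> h x"
    show "y \<le> h s"
    proof (rule ccontr)
      assume "\<not> y \<le> h s"
      \<comment> \<open>Slope and intercept are each perturbed by an amount of order \<open>e\<close>; together they raise the line at \<open>s\<close> by at most \<open>3 * e\<close>, leaving it below \<open>y\<close>.\<close>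
      define e where "e = (y - h s) / 4"
      have e: "0 < e" using \<open>\<not> y \<le> h s\<close> by (simp add: e_def)
      have cv: "convex_on {0..1} (\<lambda>x. - h x)" using h(1) by (simp add: concave_on_def)
      obtain v where v: "\<And>x. x \<in> {0..1} \<Longrightarrow> h x \<le> h s + v * (x - s)"
      proof -
        define k where "k = Inf ((\<lambda>t. (- h s - - h t) / (s - t)) ` ({s<..} \<inter> {0..1}))"
        have "h x \<le> h s + (- k) * (x - s)" if "x \<in> {0..1}" for x
          using convex_le_Inf_differential[OF cv _ that, of s] s
          unfolding k_def[symmetric] by (simp add: algebra_simps)
        then show ?thesis using that by blast
      qed
      obtain r where r: "r \<in> \<rat>" "v - e < r" "r < v + e"
        using Rats_dense_in_real[of "v - e" "v + e"] e by auto
      obtain q where q: "q \<in> \<rat>" "h s - v * s + e < q" "q < h s - v * s + 2 * e"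
        using Rats_dense_in_real[of "h s - v * s + e" "h s - v * s + 2 * e"] e by auto
      have close: "\<bar>r * x - v * x\<bar> \<le> e" if "x \<in> {0..1}" for x
      proof -
        have "\<bar>r - v\<bar> * \<bar>x\<bar> \<le> e * 1" using r that by (intro mult_mono) auto
        then show ?thesis by (simp add: abs_mult[symmetric] algebra_simps)
      qed
      have "f x \<le> q + r * x" if "x \<in> {0..1}" for x
        using h(2)[OF that] v[OF that] q(2) close[OF that] unfolding right_diff_distrib by linarith
      then have "y \<le> q + r * s" using R r(1) q(1) by blast
      moreover have "q + r * s \<le> h s + 3 * e"
        using q(3) close[of s] s by simp
      moreover have "y = h s + 4 * e" by (simp add: e_def field_simps)
      ultimately show False using e by linarith
    qed
  qed
qed

text \<open>If the empirical distribution function has value \<open>k / m\<close> at a point on or above the line, then it is still on or above the line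
at the point where the line reaches height \<open>k / m\<close>. Hence only finitely many candidate points matter; this is the usual step-up
form of the procedure.\<close>
lemma less_last_crossing_empirical_iff:
  assumes \<beta>: "1 < \<beta>" and x: "0 \<le> x"
  shows "x < last_crossing (empirical_cdf m p) \<beta> \<longleftrightarrow>
     (\<exists>k\<in>{1..m}. x < real k / (real m * \<beta>) \<and> real k / real m \<le> empirical_cdf m p (real k / (real m * \<beta>)))"
proof
  assume "x < last_crossing (empirical_cdf m p) \<beta>"
  then obtain t where t: "x < t" "t \<le> 1" "\<beta> * t \<le> empirical_cdf m p t"
    using less_last_crossing_iff[OF x] by blast
  define k where "k = card {i \<in> {1..m}. p i \<le> t}"
  have Gk: "empirical_cdf m p t = real k / real m" by (simp add: empirical_cdf_def k_def)
  have pos: "0 < \<beta> * t" using t x \<beta> by simp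
  then have m: "0 < m" "1 \<le> k" using t(3) Gk by (auto intro!: Suc_leI Nat.gr0I)
  have "k \<le> card {1..m}" unfolding k_def by (intro card_mono) auto
  then have km: "k \<le> m" by simp
  have tk: "t \<le> real k / (real m * \<beta>)" using t(3) Gk m \<beta> by (simp add: field_simps)
  have "real k / real m \<le> empirical_cdf m p (real k / (real m * \<beta>))"
    using empirical_cdf_mono[OF tk, of m p] Gk by simp
  then show "\<exists>k\<in>{1..m}. x < real k / (real m * \<beta>) \<and> real k / real m \<le> empirical_cdf m p (real k / (real m * \<beta>))"
    using tk t m km by (intro bexI[of _ k]) auto
next
  assume "\<exists>k\<in>{1..m}. x < real k / (real m * \<beta>) \<and> real k / real m \<le> empirical_cdf m p (real k / (real m * \<beta>))"
  then obtain k where k: "k \<in> {1..m}" "x < real k / (real m * \<beta>)"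
    "real k / real m \<le> empirical_cdf m p (real k / (real m * \<beta>))" by blast
  have "real k * 1 \<le> real m * \<beta>" using k \<beta> by (intro mult_mono) auto
  then have "real k / (real m * \<beta>) \<le> 1" using k \<beta> by (simp add: divide_le_eq)
  then show "x < last_crossing (empirical_cdf m p) \<beta>"
    unfolding less_last_crossing_iff[OF x] using k \<beta> by (intro exI[of _ "real k / (real m * \<beta>)"]) simp
qed

text \<open>Here the points at or above the line form an interval with left end \<open>0\<close>, so rational points suffice.\<close>
lemma less_last_crossing_majorant_iff:
  assumes \<beta>: "0 < \<beta>" and x: "0 \<le> x" and f: "\<And>x. x \<in> {0..1} \<Longrightarrow> 0 \<le> f x" "\<And>x. x \<in> {0..1} \<Longrightarrow> f x \<le> b"
  shows "x < last_crossing (least_concave_majorant f) \<beta> \<longleftrightarrow>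
     (\<exists>s\<in>\<rat> \<inter> {x<..<1}. \<beta> * s \<le> least_concave_majorant f s)"
proof
  assume "x < last_crossing (least_concave_majorant f) \<beta>"
  then obtain t where t: "x < t" "t \<le> 1" "\<beta> * t \<le> least_concave_majorant f t"
    using less_last_crossing_iff[OF x] by blast
  obtain s where s: "s \<in> \<rat>" "x < s" "s < t" using Rats_dense_in_real[OF t(1)] by blast
  have "\<beta> * s = s / t * (\<beta> * t)" using s x by simp
  also have "\<dots> \<le> s / t * least_concave_majorant f t" using t s x by (intro mult_left_mono) auto
  also have "\<dots> \<le> least_concave_majorant f s"
    using s x t by (intro concave_majorant_star_shaped[OF f]) auto
  finally show "\<exists>s\<in>\<rat> \<inter> {x<..<1}. \<beta> * s \<le> least_concave_majorant f s"
    using s t by (intro bexI[of _ s]) auto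
qed (use less_last_crossing_iff[OF x] in fastforce)

lemma last_crossing_measurable:
  assumes P: "\<And>i. i \<in> {1..m} \<Longrightarrow> P i \<in> borel_measurable M"
    and \<Phi>: "\<Phi> = (\<lambda>f. f) \<or> \<Phi> = least_concave_majorant" and \<beta>: "1 < \<beta>"
  shows "(\<lambda>\<omega>. last_crossing (\<Phi> (empirical_cdf m (\<lambda>i. P i \<omega>))) \<beta>) \<in> borel_measurable M"
    (is "?T \<in> _")
proof (rule borel_measurableI_greater)
  fix x :: real
  have [measurable]: "(\<lambda>\<omega>. empirical_cdf m (\<lambda>i. P i \<omega>) t) \<in> borel_measurable M" for t
    using P by (rule empirical_cdf_measurable)
  consider "x < 0" | "0 \<le> x" "\<Phi> = (\<lambda>f. f)" | "0 \<le> x" "\<Phi> = least_concave_majorant" using \<Phi> by linarith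
  then show "{\<omega> \<in> space M. x < ?T \<omega>} \<in> sets M"
  proof cases
    case 1
    then have "{\<omega> \<in> space M. x < ?T \<omega>} = space M"
      using last_crossing_unit(1) by (auto intro: less_le_trans)
    then show ?thesis by simp
  next
    case 2
    then show ?thesis by (simp only: less_last_crossing_empirical_iff[OF \<beta>]) measurable
  next
    case 3
    let ?G = "\<lambda>\<omega>. empirical_cdf m (\<lambda>i. P i \<omega>)"
    let ?R = "\<lambda>\<omega>. \<exists>s\<in>\<rat> \<inter> {x<..<1}. \<forall>q\<in>\<rat>. \<forall>r\<in>\<rat>.
       (\<forall>y\<in>\<rat> \<inter> {0..1}. ?G \<omega> y \<le> q + r * y) \<longrightarrow> \<beta> * s \<le> q + r * s"
    have "x < ?T \<omega> \<longleftrightarrow> ?R \<omega>" for \<omega>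
    proof -
      have "x < ?T \<omega> \<longleftrightarrow> (\<exists>s\<in>\<rat> \<inter> {x<..<1}. \<beta> * s \<le> least_concave_majorant (?G \<omega>) s)"
        unfolding 3(2) using \<beta> 3 empirical_cdf_bounds
        by (intro less_last_crossing_majorant_iff[where b = 1]) auto
      also have "\<dots> \<longleftrightarrow> ?R \<omega>"
        using 3(1)
        by (intro bex_cong refl concave_majorant_ge_iff_rational[where b = 1])
          (auto simp: empirical_cdf_bounds mono_on_def empirical_cdf_mono)
      finally show ?thesis .
    qed
    then have "{\<omega> \<in> space M. x < ?T \<omega>} = {\<omega> \<in> space M. ?R \<omega>}" by simp
    also have "\<dots> \<in> sets M"
    proof -
      have [simp]: "countable (\<rat> \<inter> A)" for A :: "real set" using countable_rat by (rule countable_Int1)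
      show ?thesis using countable_rat by measurable
    qed
    finally show ?thesis .
  qed
qed

section \<open>Events of high probability\<close>

text \<open>The exceptional set is required to be measurable, but not the event \<open>E m\<close> itself: the events of interest
quantify over uncountably many points.\<close>
definition likely :: "real \<Rightarrow> (nat \<Rightarrow> 'a measure) \<Rightarrow> (nat \<Rightarrow> 'a \<Rightarrow> bool) \<Rightarrow> bool" where
  "likely r M E \<longleftrightarrow> (\<forall>\<^sub>F m in sequentially.
     \<exists>A\<in>sets (M m). measure (M m) A \<le> r \<and> (\<forall>\<omega>\<in>space (M m) - A. E m \<omega>))"

definition whp :: "(nat \<Rightarrow> 'a measure) \<Rightarrow> (nat \<Rightarrow> 'a \<Rightarrow> bool) \<Rightarrow> bool" where
  "whp M E \<longleftrightarrow> (\<forall>r>0. likely r M E)"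

lemma likely_mono:
  assumes "likely r M E" "\<forall>\<^sub>F m in sequentially. \<forall>\<omega>\<in>space (M m). E m \<omega> \<longrightarrow> E' m \<omega>"
  shows "likely r M E'"
  using assms unfolding likely_def by eventually_elim fast

lemma likely_conj:
  assumes "likely r1 M E1" "likely r2 M E2" "\<And>m. prob_space (M m)"
  shows "likely (r1 + r2) M (\<lambda>m \<omega>. E1 m \<omega> \<and> E2 m \<omega>)"
  using assms(1,2) unfolding likely_def
proof eventually_elim
  case (elim m)
  interpret prob_space "M m" by (rule assms(3))
  obtain A where A: "A \<in> events" "prob A \<le> r1" "\<forall>\<omega>\<in>space (M m) - A. E1 m \<omega>" using elim(1) by blast
  obtain B where B: "B \<in> events" "prob B \<le> r2" "\<forall>\<omega>\<in>space (M m) - B. E2 m \<omega>" using elim(2) by blast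
  have "prob (A \<union> B) \<le> r1 + r2" using measure_Un_le[OF A(1) B(1)] A(2) B(2) by linarith
  then show ?case using A B by (intro bexI[of _ "A \<union> B"]) auto
qed

lemma whp_mono:
  assumes "whp M E" "\<forall>\<^sub>F m in sequentially. \<forall>\<omega>\<in>space (M m). E m \<omega> \<longrightarrow> E' m \<omega>"
  shows "whp M E'"
  using assms likely_mono unfolding whp_def by blast

lemma whp_conj:
  assumes "whp M E1" "whp M E2" "\<And>m. prob_space (M m)"
  shows "whp M (\<lambda>m \<omega>. E1 m \<omega> \<and> E2 m \<omega>)"
  unfolding whp_def
proof (intro allI impI)
  fix r :: real assume "0 < r"
  then have "likely (r / 2 + r / 2) M (\<lambda>m \<omega>. E1 m \<omega> \<and> E2 m \<omega>)"
    using assms unfolding whp_def by (intro likely_conj) auto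
  then show "likely r M (\<lambda>m \<omega>. E1 m \<omega> \<and> E2 m \<omega>)" by simp
qed

lemma whp_True: "whp M (\<lambda>m \<omega>. True)"
  unfolding whp_def likely_def by (auto intro!: always_eventually bexI[of _ "{}"])

lemma whp_finite_ball:
  assumes "finite K" "\<And>k. k \<in> K \<Longrightarrow> whp M (E k)" "\<And>m. prob_space (M m)"
  shows "whp M (\<lambda>m \<omega>. \<forall>k\<in>K. E k m \<omega>)"
  using assms(1,2)
proof (induction K rule: finite_induct)
  case empty
  then show ?case using whp_True by simp
next
  case (insert k K)
  then have "whp M (\<lambda>m \<omega>. E k m \<omega> \<and> (\<forall>k\<in>K. E k m \<omega>))"
    by (intro whp_conj assms(3)) auto
  then show ?case by simp
qed

lemma whp_tendsto_0:
  assumes "whp M E" "\<And>m. prob_space (M m)"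
    and "\<forall>\<^sub>F m in sequentially. \<forall>\<omega>\<in>space (M m). E m \<omega> \<longrightarrow> \<not> B m \<omega>"
  shows "(\<lambda>m. measure (M m) {\<omega> \<in> space (M m). B m \<omega>}) \<longlonglongrightarrow> 0"
proof (rule tendstoI)
  fix e :: real assume e: "0 < e"
  then have "likely (e / 2) M E" using assms(1) unfolding whp_def by simp
  then show "\<forall>\<^sub>F m in sequentially. dist (measure (M m) {\<omega> \<in> space (M m). B m \<omega>}) 0 < e"
    using assms(3) unfolding likely_def
  proof eventually_elim
    case (elim m)
    interpret prob_space "M m" by (rule assms(2))
    obtain A where A: "A \<in> events" "prob A \<le> e / 2" "\<forall>\<omega>\<in>space (M m) - A. E m \<omega>" using elim(1) by blast
    have "prob {\<omega> \<in> space (M m). B m \<omega>} \<le> prob A"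
      using elim(2) A by (intro finite_measure_mono) auto
    then show ?case using A(2) e by simp
  qed
qed

lemma sqrt_real_at_top: "filterlim (\<lambda>m. sqrt (real m)) at_top sequentially"
  by (rule filterlim_compose[OF sqrt_at_top filterlim_real_sequentially])

lemma divide_sqrt_tendsto_0: "(\<lambda>m. x / sqrt (real m)) \<longlonglongrightarrow> (0 :: real)"
  by (rule tendsto_divide_0[OF tendsto_const filterlim_at_top_imp_at_infinity[OF sqrt_real_at_top]])

lemma whp_count:
  fixes M :: "nat \<Rightarrow> 'a measure" and X :: "nat \<Rightarrow> nat \<Rightarrow> 'a \<Rightarrow> 'b"
  assumes M: "\<And>m. prob_space (M m)"
    and ind: "\<And>m. prob_space.indep_vars (M m) (\<lambda>_. N) (X m) {1..m}" and B: "B \<in> sets N"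
    and p: "\<And>m i. i \<in> {1..m} \<Longrightarrow> measure (M m) {\<omega> \<in> space (M m). X m i \<omega> \<in> B} = p" and e: "0 < e"
  shows "whp M (\<lambda>m \<omega>. \<bar>real (card {i \<in> {1..m}. X m i \<omega> \<in> B}) / real m - p\<bar> < e)"
  unfolding whp_def
proof (intro allI impI)
  fix r :: real assume r: "0 < r"
  have "(\<lambda>m. 4 * ((1 / e) / sqrt (real m)) ^ 4) \<longlonglongrightarrow> 4 * 0 ^ 4"
    by (intro tendsto_intros divide_sqrt_tendsto_0)
  then have "(\<lambda>m. 4 / (e * sqrt (real m)) ^ 4) \<longlonglongrightarrow> 0"
    by (simp add: power_divide power_mult_distrib)
  then have "\<forall>\<^sub>F m in sequentially. 4 / (e * sqrt (real m)) ^ 4 < r"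
    using r by (rule order_tendstoD)
  then show "likely r M (\<lambda>m \<omega>. \<bar>real (card {i \<in> {1..m}. X m i \<omega> \<in> B}) / real m - p\<bar> < e)"
    unfolding likely_def using eventually_gt_at_top[of 0]
  proof eventually_elim
    case (elim m)
    interpret prob_space "M m" by (rule M)
    have Xm[measurable]: "X m i \<in> measurable (M m) N" if "i \<in> {1..m}" for i
      using ind[of m] that unfolding indep_vars_def by auto
    have cm[measurable]: "(\<lambda>\<omega>. real (card {i \<in> {1..m}. X m i \<omega> \<in> B})) \<in> borel_measurable (M m)"
      by (rule count_measurable) (use B in measurable)
    define A where "A = {\<omega> \<in> space (M m). (e * sqrt (real m)) * sqrt (real m) \<le>
        \<bar>real (card {i \<in> {1..m}. X m i \<omega> \<in> B}) - real m * p\<bar>}"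
    have "p = prob {\<omega> \<in> space (M m). X m 1 \<omega> \<in> B}" using p[of 1 m] elim by simp
    then have "p \<le> 1" by simp
    then have "prob A \<le> 4 * 1\<^sup>2 / (e * sqrt (real m)) ^ 4"
      unfolding A_def using elim e by (intro indep_count_tail[OF ind B p]) auto
    then have "prob A \<le> r" using elim by simp
    moreover have "A \<in> events" unfolding A_def by measurable
    moreover have "\<bar>real (card {i \<in> {1..m}. X m i \<omega> \<in> B}) / real m - p\<bar> < e" if "\<omega> \<in> space (M m) - A" for \<omega>
    proof -
      have "\<bar>real (card {i \<in> {1..m}. X m i \<omega> \<in> B}) - real m * p\<bar> < e * real m"
        using that elim by (simp add: A_def mult.assoc not_le)
      moreover have "real (card {i \<in> {1..m}. X m i \<omega> \<in> B}) / real m - p =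
          (real (card {i \<in> {1..m}. X m i \<omega> \<in> B}) - real m * p) / real m"
        using elim by (simp add: field_simps)
      ultimately show ?thesis using elim by (simp add: abs_divide pos_divide_less_eq)
    qed
    ultimately show ?case by blast
  qed
qed

section \<open>Linearization of the threshold\<close>

text \<open>The regular case: the graph of \<open>G\<close> crosses the line of slope \<open>\<beta> > 1\<close> at an interior point \<open>t\<^sub>0\<close>. This is the
case in which the threshold has a nondegenerate limit law.\<close>
locale empirical_crossing =
  fixes M :: "nat \<Rightarrow> 'a measure" and P :: "nat \<Rightarrow> nat \<Rightarrow> 'a \<Rightarrow> real" and G :: "real \<Rightarrow> real"
    and g\<^sub>0 t\<^sub>0 \<beta> :: real and \<Phi> :: "(real \<Rightarrow> real) \<Rightarrow> real \<Rightarrow> real"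
  assumes prob: "\<And>m. prob_space (M m)"
    and indep: "\<And>m. prob_space.indep_vars (M m) (\<lambda>_. borel) (P m) {1..m}"
    and law: "\<And>m i t. i \<in> {1..m} \<Longrightarrow> 0 \<le> t \<Longrightarrow> t \<le> 1 \<Longrightarrow>
        measure (M m) {\<omega> \<in> space (M m). P m i \<omega> \<le> t} = G t"
    and concave: "strictly_concave_on {0..1} G"
    and cont: "continuous_on {0..1} G" and G0: "G 0 = 0" and G1: "G 1 = 1"
    and deriv: "(G has_real_derivative g\<^sub>0) (at t\<^sub>0)"
    and t0: "0 < t\<^sub>0" "t\<^sub>0 < 1" and beta: "1 < \<beta>" and crossing: "G t\<^sub>0 = \<beta> * t\<^sub>0"
    and Phi: "\<Phi> = (\<lambda>f. f) \<or> \<Phi> = least_concave_majorant"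
begin

abbreviation Gm :: "nat \<Rightarrow> 'a \<Rightarrow> real \<Rightarrow> real" where
  "Gm m \<omega> \<equiv> empirical_cdf m (\<lambda>i. P m i \<omega>)"

abbreviation \<nu> :: "nat \<Rightarrow> 'a \<Rightarrow> real \<Rightarrow> real" where
  "\<nu> m \<omega> \<equiv> emp_process m (\<lambda>i. P m i \<omega>) G"

abbreviation T :: "nat \<Rightarrow> 'a \<Rightarrow> real" where
  "T m \<omega> \<equiv> last_crossing (\<Phi> (Gm m \<omega>)) \<beta>"

lemma P_measurable: "i \<in> {1..m} \<Longrightarrow> P m i \<in> borel_measurable (M m)"
proof -
  interpret prob_space "M m" by (rule prob)
  show "i \<in> {1..m} \<Longrightarrow> P m i \<in> borel_measurable (M m)" using indep[of m] unfolding indep_vars_def by auto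
qed

lemma T_measurable [measurable]: "T m \<in> borel_measurable (M m)"
  using P_measurable Phi beta by (rule last_crossing_measurable)

lemma \<nu>_measurable [measurable]: "(\<lambda>\<omega>. \<nu> m \<omega> t) \<in> borel_measurable (M m)"
  using P_measurable by (rule emp_process_measurable)

lemma G_mono: "0 \<le> s \<Longrightarrow> s \<le> t \<Longrightarrow> t \<le> 1 \<Longrightarrow> G s \<le> G t"
proof -
  assume st: "0 \<le> s" "s \<le> t" "t \<le> 1"
  interpret prob_space "M 1" by (rule prob)
  have [measurable]: "P (Suc 0) (Suc 0) \<in> borel_measurable (M (Suc 0))" using P_measurable by simp
  have "prob {\<omega> \<in> space (M 1). P 1 1 \<omega> \<le> s} \<le> prob {\<omega> \<in> space (M 1). P 1 1 \<omega> \<le> t}"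
    using st by (intro finite_measure_mono) auto
  then show ?thesis using law[of 1 1 s] law[of 1 1 t] st by simp
qed

lemma law_interval:
  assumes "i \<in> {1..m}" "0 \<le> s" "s \<le> t" "t \<le> 1"
  shows "measure (M m) {\<omega> \<in> space (M m). P m i \<omega> \<in> {s<..t}} = G t - G s"
proof -
  interpret prob_space "M m" by (rule prob)
  have [measurable]: "P m i \<in> borel_measurable (M m)" using P_measurable assms by simp
  have "{\<omega> \<in> space (M m). P m i \<omega> \<in> {s<..t}} =
    {\<omega> \<in> space (M m). P m i \<omega> \<le> t} - {\<omega> \<in> space (M m). P m i \<omega> \<le> s}" using assms by auto
  also have "prob \<dots> = prob {\<omega> \<in> space (M m). P m i \<omega> \<le> t} - prob {\<omega> \<in> space (M m). P m i \<omega> \<le> s}"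
    using assms by (intro finite_measure_Diff) auto
  finally show ?thesis using law assms by simp
qed

lemma G_strict_concave:
  assumes "x \<in> {0..1}" "y \<in> {0..1}" "x \<noteq> y" "0 < u" "u < 1"
  shows "(1 - u) * G x + u * G y < G ((1 - u) * x + u * y)"
  using concave assms unfolding strictly_concave_on_def by auto

lemma G_concave: "concave_on {0..1} G"
  by (rule concave_on_linorderI) (auto intro!: less_imp_le G_strict_concave)

text \<open>Strictness follows from the weak inequality at the midpoint of \<open>s\<close> and \<open>t\<^sub>0\<close>.\<close>
lemma below_tangent:
  assumes "s \<in> {0..1}" "s \<noteq> t\<^sub>0"
  shows "G s < G t\<^sub>0 + g\<^sub>0 * (s - t\<^sub>0)"
proof -
  have weak: "G x \<le> G t\<^sub>0 + g\<^sub>0 * (x - t\<^sub>0)" if "x \<in> {0..1}" for x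
  proof -
    have cv: "convex_on {0..1} (\<lambda>x. - G x)" using G_concave by (simp add: concave_on_def)
    have d: "((\<lambda>x. - G x) has_real_derivative (- g\<^sub>0)) (at t\<^sub>0 within {0..1})"
      by (rule has_field_derivative_at_within[OF DERIV_minus[OF deriv]])
    show ?thesis
      using convex_on_imp_above_tangent[OF cv _ _ that d] t0 by (simp add: algebra_simps)
  qed
  define x where "x = (1 - 1 / 2) * t\<^sub>0 + 1 / 2 * s"
  have "(1 - 1 / 2) * G t\<^sub>0 + 1 / 2 * G s < G x"
    unfolding x_def using assms t0 by (intro G_strict_concave) auto
  also have "G x \<le> G t\<^sub>0 + g\<^sub>0 * (x - t\<^sub>0)" using assms t0 by (intro weak) (auto simp: x_def)
  also have "g\<^sub>0 * (x - t\<^sub>0) = g\<^sub>0 * (s - t\<^sub>0) / 2" by (simp add: x_def algebra_simps)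
  finally show ?thesis by simp
qed

text \<open>The tangent at \<open>t\<^sub>0\<close> lies strictly above \<open>G 0 = 0\<close> at the origin, whereas the line of slope \<open>\<beta>\<close> through the same point
of the graph passes through the origin.\<close>
lemma slope_gap: "g\<^sub>0 < \<beta>"
  using below_tangent[of 0] t0 G0 crossing by (simp add: algebra_simps)

lemma G_t0: "0 < G t\<^sub>0" "G t\<^sub>0 < 1"
proof -
  show "0 < G t\<^sub>0" using crossing t0 beta by simp
  define x where "x = (1 - 1 / 2) * t\<^sub>0 + 1 / 2 * 1"
  have "(1 - 1 / 2) * G t\<^sub>0 + 1 / 2 * G 1 < G x"
    unfolding x_def using t0 by (intro G_strict_concave) auto
  also have "G x \<le> G 1" using t0 by (intro G_mono) (auto simp: x_def)
  finally show "G t\<^sub>0 < 1" using G1 by simp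
qed

lemma G_Lipschitz:
  assumes "0 < b" "b \<le> s" "s \<le> t" "t \<le> 1"
  shows "G t - G s \<le> (1 / b) * (t - s)"
proof -
  have "(1 - s / t) * G 0 + s / t * G t \<le> G ((1 - s / t) *\<^sub>R 0 + (s / t) *\<^sub>R t)"
    using assms by (intro concave_onD[OF G_concave]) auto
  then have "s / t * G t \<le> G s" using G0 assms by simp
  then have "s * G t \<le> t * G s" using assms by (simp add: field_simps)
  then have "s * (G t - G s) \<le> (t - s) * G s" by (simp add: algebra_simps)
  also have "\<dots> \<le> (t - s) * 1"
    using assms G_mono[of s 1] G1 by (intro mult_left_mono) auto
  finally have 1: "s * (G t - G s) \<le> t - s" by simp
  have "b * (G t - G s) \<le> s * (G t - G s)" using assms G_mono[of s t] by (intro mult_right_mono) auto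
  then have "b * (G t - G s) \<le> t - s" using 1 by simp
  then show ?thesis using assms by (simp add: field_simps)
qed

lemma whp_pointwise:
  assumes "0 \<le> t" "t \<le> 1" "0 < e"
  shows "whp M (\<lambda>m \<omega>. \<bar>Gm m \<omega> t - G t\<bar> < e)"
  using whp_count[OF prob indep, of "{..t}" "G t" e] law assms by (simp add: empirical_cdf_def)

text \<open>The one-sided Glivenko-Cantelli theorem: by monotonicity it is enough to compare the two functions on a finite
grid on which \<open>G\<close> varies little.\<close>
lemma whp_uniform_upper:
  assumes e: "0 < e"
  shows "whp M (\<lambda>m \<omega>. \<forall>s\<in>{0..1}. Gm m \<omega> s \<le> G s + e)"
proof -
  have "uniformly_continuous_on {0..1} G" using cont by (rule compact_uniformly_continuous) simp
  then obtain d where d: "0 < d" "\<And>x y. x \<in> {0..1} \<Longrightarrow> y \<in> {0..1} \<Longrightarrow> dist y x < d \<Longrightarrow> dist (G y) (G x) < e / 2"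
    unfolding uniformly_continuous_on_def using half_gt_zero[OF e] by metis
  obtain n :: nat where n: "0 < n" "1 / real n < d"
    using real_arch_inverse[of d] d(1) by (auto simp: inverse_eq_divide)
  have "whp M (\<lambda>m \<omega>. \<forall>k\<in>{..n}. \<bar>Gm m \<omega> (real k / real n) - G (real k / real n)\<bar> < e / 2)"
    using e n by (intro whp_finite_ball whp_pointwise prob) auto
  then show ?thesis
  proof (rule whp_mono, intro always_eventually allI ballI impI)
    fix m \<omega> s
    assume A: "\<forall>k\<in>{..n}. \<bar>Gm m \<omega> (real k / real n) - G (real k / real n)\<bar> < e / 2" and s: "s \<in> {0..1::real}"
    define k where "k = nat \<lceil>s * real n\<rceil>"
    have "s * real n \<le> 1 * real n" using s by (intro mult_right_mono) auto
    moreover have "0 \<le> s * real n" using s by simp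
    ultimately have k: "s * real n \<le> real k" "real k < s * real n + 1" "k \<le> n"
      unfolding k_def by linarith+
    have sk: "s \<le> real k / real n" "real k / real n - s < d" "real k / real n \<le> 1"
      using k n by (auto simp: field_simps)
    have "Gm m \<omega> s \<le> Gm m \<omega> (real k / real n)" using sk by (intro empirical_cdf_mono)
    also have "\<dots> \<le> G (real k / real n) + e / 2" using bspec[OF A, of k] k(3) unfolding atMost_iff by linarith
    also have "G (real k / real n) \<le> G s + e / 2"
    proof -
      have "dist (G (real k / real n)) (G s) < e / 2"
        using s sk by (intro d(2)) (auto simp: dist_real_def)
      then show ?thesis unfolding dist_real_def by linarith
    qed
    finally show "Gm m \<omega> s \<le> G s + e" by simp
  qed
qed

lemma likely_tight:
  assumes r: "0 < r"
  shows "\<exists>R>0. likely r M (\<lambda>m \<omega>. \<bar>\<nu> m \<omega> t\<^sub>0\<bar> < R)"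
proof -
  define R :: real where "R = max 1 (4 / r)"
  have R: "1 \<le> R" "4 \<le> r * R" using r by (auto simp: R_def max_def field_simps)
  have "R ^ 1 \<le> R ^ 4" using R by (intro power_increasing) auto
  then have "4 / R ^ 4 \<le> 4 / R" using R by (intro divide_left_mono) auto
  also have "\<dots> \<le> r" using R by (simp add: divide_le_eq)
  finally have R4: "4 / R ^ 4 \<le> r" .
  have "likely r M (\<lambda>m \<omega>. \<bar>\<nu> m \<omega> t\<^sub>0\<bar> < R)"
    unfolding likely_def using eventually_gt_at_top[of 0]
  proof eventually_elim
    case (elim m)
    interpret prob_space "M m" by (rule prob)
    let ?N = "\<lambda>\<omega>. real (card {i \<in> {1..m}. P m i \<omega> \<in> {..t\<^sub>0}})"
    have "prob {\<omega> \<in> space (M m). R * sqrt (real m) \<le> \<bar>?N \<omega> - real m * G t\<^sub>0\<bar>} \<le> 4 * 1\<^sup>2 / R ^ 4"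
      using elim R G_t0 law t0 by (intro indep_count_tail[OF indep]) auto
    moreover have "\<nu> m \<omega> t\<^sub>0 = (?N \<omega> - real m * G t\<^sub>0) / sqrt (real m)" for \<omega>
    proof -
      have "sqrt (real m) * sqrt (real m) = real m" "sqrt (real m) \<noteq> 0" using elim by auto
      then show ?thesis
        unfolding emp_process_def empirical_cdf_def atMost_iff using elim
        by (simp add: field_simps)
    qed
    then have "R \<le> \<bar>\<nu> m \<omega> t\<^sub>0\<bar> \<longleftrightarrow> R * sqrt (real m) \<le> \<bar>?N \<omega> - real m * G t\<^sub>0\<bar>" for \<omega>
      using elim by (simp add: abs_divide pos_le_divide_eq)
    ultimately have "prob {\<omega> \<in> space (M m). R \<le> \<bar>\<nu> m \<omega> t\<^sub>0\<bar>} \<le> r" using R4 by simp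
    then show ?case by (intro bexI[of _ "{\<omega> \<in> space (M m). R \<le> \<bar>\<nu> m \<omega> t\<^sub>0\<bar>}"]) auto
  qed
  then show ?thesis using R by (intro exI[of _ R]) auto
qed

text \<open>The radius \<open>\<eta>\<close> depends on the allowed failure probability \<open>r\<close>. For this reason the lemma speaks of \<open>likely r\<close>
and not of \<open>whp\<close>.\<close>
lemma likely_equicontinuous:
  assumes r: "0 < r" and e: "0 < e"
  shows "\<exists>\<eta>>0. t\<^sub>0 + \<eta> \<le> 1 \<and> 0 \<le> t\<^sub>0 - \<eta> \<and> likely r M (\<lambda>m \<omega>. \<forall>s\<in>{t\<^sub>0 - \<eta>..t\<^sub>0 + \<eta>}. \<bar>\<nu> m \<omega> s - \<nu> m \<omega> t\<^sub>0\<bar> \<le> e)"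
proof -
  \<comment> \<open>The chaining bound \<open>11 * d\<close> is used twice, because oscillations are measured from the left end of the interval and not from \<open>t\<^sub>0\<close>.\<close>
  define d where "d = e / 22"
  have d: "0 < d" using e by (simp add: d_def)
  define L where "L = 2 / t\<^sub>0"
  have L: "0 < L" using t0 by (simp add: L_def)
  have "((\<lambda>\<eta>. 20 * (L * (2 * \<eta>))\<^sup>2 / d ^ 4) \<longlongrightarrow> 20 * (L * (2 * 0))\<^sup>2 / d ^ 4) (at_right 0)"
    by (intro tendsto_intros) (use d in auto)
  then have "\<forall>\<^sub>F \<eta> in at_right 0. 20 * (L * (2 * \<eta>))\<^sup>2 / d ^ 4 < r"
    using r by (intro order_tendstoD) auto
  moreover have "\<forall>\<^sub>F \<eta> in at_right 0. \<eta> \<in> {0<..<min (t\<^sub>0 / 2) (1 - t\<^sub>0)}"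
    using t0 by (intro eventually_at_right_real) auto
  ultimately have "\<forall>\<^sub>F \<eta> in at_right 0. 20 * (L * (2 * \<eta>))\<^sup>2 / d ^ 4 < r \<and> \<eta> \<in> {0<..<min (t\<^sub>0 / 2) (1 - t\<^sub>0)}"
    by eventually_elim simp
  then obtain \<eta> where \<eta>: "20 * (L * (2 * \<eta>))\<^sup>2 / d ^ 4 < r" "0 < \<eta>" "\<eta> < t\<^sub>0 / 2" "\<eta> < 1 - t\<^sub>0"
    using eventually_happens[of _ "at_right (0::real)"] by (auto simp: trivial_limit_at_right_real)
  define b where "b = t\<^sub>0 - \<eta>"
  have b: "0 < b" "1 / b \<le> L" "b + 2 * \<eta> \<le> 1"
    using \<eta> t0 by (auto simp: b_def L_def field_simps)
  have Lh: "0 < L * (2 * \<eta>)" using L \<eta> by simp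
  have ev: "\<forall>\<^sub>F m in sequentially. max (d / (L * (2 * \<eta>))) (2 / d) < sqrt (real m)"
    using sqrt_real_at_top unfolding filterlim_at_top_dense by blast
  have "likely r M (\<lambda>m \<omega>. \<forall>s\<in>{t\<^sub>0 - \<eta>..t\<^sub>0 + \<eta>}. \<bar>\<nu> m \<omega> s - \<nu> m \<omega> t\<^sub>0\<bar> \<le> e)"
    unfolding likely_def using ev
  proof eventually_elim
    case (elim m)
    interpret prob_space "M m" by (rule prob)
    have "\<exists>A\<in>events. prob A \<le> 20 * (L * (2 * \<eta>))\<^sup>2 / d ^ 4 \<and>
      (\<forall>\<omega>\<in>space (M m) - A. \<forall>s\<in>{b..b + 2 * \<eta>}. \<bar>\<nu> m \<omega> s - \<nu> m \<omega> b\<bar> \<le> 11 * d)"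
    proof (rule emp_process_modulus[OF indep])
      fix i s t assume "i \<in> {1..m}" "b \<le> s" "s \<le> t" "t \<le> b + 2 * \<eta>"
      then show "prob {\<omega> \<in> space (M m). P m i \<omega> \<in> {s<..t}} = G t - G s"
        using b by (intro law_interval) auto
    next
      fix s t assume "b \<le> s" "s \<le> t" "t \<le> b + 2 * \<eta>"
      then show "G s \<le> G t" using b by (intro G_mono) auto
    next
      fix s t assume st: "b \<le> s" "s \<le> t" "t \<le> b + 2 * \<eta>"
      then have "G t - G s \<le> (1 / b) * (t - s)" using b by (intro G_Lipschitz) auto
      also have "\<dots> \<le> L * (t - s)" using b st by (intro mult_right_mono) auto
      finally show "G t - G s \<le> L * (t - s)" .
    next
      show "d < sqrt (real m) * (L * (2 * \<eta>))" using elim Lh by (simp only: max_less_iff_conj pos_divide_less_eq)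
      show "2 \<le> sqrt (real m) * d" using elim d by (simp add: pos_divide_less_eq)
    qed (use L \<eta> d in auto)
    then obtain A where A: "A \<in> events" "prob A \<le> 20 * (L * (2 * \<eta>))\<^sup>2 / d ^ 4"
      "\<And>\<omega> s. \<omega> \<in> space (M m) - A \<Longrightarrow> s \<in> {b..b + 2 * \<eta>} \<Longrightarrow> \<bar>\<nu> m \<omega> s - \<nu> m \<omega> b\<bar> \<le> 11 * d" by blast
    have "\<bar>\<nu> m \<omega> s - \<nu> m \<omega> t\<^sub>0\<bar> \<le> e" if "\<omega> \<in> space (M m) - A" "s \<in> {t\<^sub>0 - \<eta>..t\<^sub>0 + \<eta>}" for \<omega> s
    proof -
      have "s \<in> {b..b + 2 * \<eta>}" "t\<^sub>0 \<in> {b..b + 2 * \<eta>}" using that(2) \<eta> by (auto simp: b_def)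
      then show ?thesis using A(3)[OF that(1), of s] A(3)[OF that(1), of t\<^sub>0] unfolding d_def by linarith
    qed
    then show ?case using A \<eta>(1) by (intro bexI[of _ A]) auto
  qed
  then show ?thesis using \<eta> t0 by (intro exI[of _ \<eta>]) auto
qed

lemma sqrt_shrink:
  assumes "0 < e"
  shows "\<forall>\<^sub>F m in sequentially. - e < x / sqrt (real m) \<and> x / sqrt (real m) < e"
  using assms by (intro eventually_conj order_tendstoD[OF divide_sqrt_tendsto_0]) auto

text \<open>The dominating affine function is the tangent of \<open>G\<close> at \<open>t\<^sub>0\<close>, lifted by \<open>(\<nu> t\<^sub>0 + e / 2) / sqrt m\<close>. At
\<open>t\<^sub>0 + x / sqrt m\<close> it is below the line as soon as \<open>\<nu> t\<^sub>0 \<le> (\<beta> - g\<^sub>0) * x - e\<close>.\<close>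
lemma crossing_upper:
  assumes e: "0 < e"
  shows "whp M (\<lambda>m \<omega>. \<nu> m \<omega> t\<^sub>0 \<le> (\<beta> - g\<^sub>0) * x - e \<longrightarrow> T m \<omega> \<le> t\<^sub>0 + x / sqrt (real m))"
  unfolding whp_def
proof (intro allI impI)
  fix r :: real assume r: "0 < r"
  obtain \<eta> where \<eta>: "0 < \<eta>" "t\<^sub>0 + \<eta> \<le> 1" "0 \<le> t\<^sub>0 - \<eta>"
    and eq: "likely (r / 2) M (\<lambda>m \<omega>. \<forall>s\<in>{t\<^sub>0 - \<eta>..t\<^sub>0 + \<eta>}. \<bar>\<nu> m \<omega> s - \<nu> m \<omega> t\<^sub>0\<bar> \<le> e / 2)"
    using likely_equicontinuous[of "r / 2" "e / 2"] r e by auto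
  \<comment> \<open>Compactness turns the strict tangent inequality into a gap \<open>\<delta>\<close> away from \<open>t\<^sub>0\<close>.\<close>
  have "\<exists>\<delta>>0. \<forall>s\<in>{0..1}. \<eta> \<le> \<bar>s - t\<^sub>0\<bar> \<longrightarrow> G s + \<delta> \<le> G t\<^sub>0 + g\<^sub>0 * (s - t\<^sub>0)"
  proof -
    define K where "K = {0..t\<^sub>0 - \<eta>} \<union> {t\<^sub>0 + \<eta>..1}"
    have K: "compact K" "K \<noteq> {}" "K \<subseteq> {0..1}" using \<eta> t0 by (auto simp: K_def)
    have "continuous_on K (\<lambda>s. G t\<^sub>0 + g\<^sub>0 * (s - t\<^sub>0) - G s)"
      using continuous_on_subset[OF cont K(3)] by (intro continuous_intros)
    then obtain z where z: "z \<in> K" "\<And>s. s \<in> K \<Longrightarrow> G t\<^sub>0 + g\<^sub>0 * (z - t\<^sub>0) - G z \<le> G t\<^sub>0 + g\<^sub>0 * (s - t\<^sub>0) - G s"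
      using continuous_attains_inf[OF K(1,2)] by blast
    have "0 < G t\<^sub>0 + g\<^sub>0 * (z - t\<^sub>0) - G z"
      using below_tangent[of z] z(1) K(3) \<eta> by (auto simp: K_def)
    moreover have "s \<in> K" if "s \<in> {0..1}" "\<eta> \<le> \<bar>s - t\<^sub>0\<bar>" for s using that by (auto simp: K_def abs_if split: if_splits)
    ultimately show ?thesis using z(2) by (intro exI[of _ "G t\<^sub>0 + g\<^sub>0 * (z - t\<^sub>0) - G z"]) fastforce
  qed
  then obtain \<delta> where \<delta>: "0 < \<delta>" "\<And>s. s \<in> {0..1} \<Longrightarrow> \<eta> \<le> \<bar>s - t\<^sub>0\<bar> \<Longrightarrow> G s + \<delta> \<le> G t\<^sub>0 + g\<^sub>0 * (s - t\<^sub>0)"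
    by blast
  have "whp M (\<lambda>m \<omega>. (\<forall>s\<in>{0..1}. Gm m \<omega> s \<le> G s + \<delta> / 2) \<and> \<bar>Gm m \<omega> t\<^sub>0 - G t\<^sub>0\<bar> < \<delta> / 2)"
    using \<delta> t0 by (intro whp_conj whp_uniform_upper whp_pointwise prob) auto
  then have "likely (r / 2) M (\<lambda>m \<omega>. (\<forall>s\<in>{0..1}. Gm m \<omega> s \<le> G s + \<delta> / 2) \<and> \<bar>Gm m \<omega> t\<^sub>0 - G t\<^sub>0\<bar> < \<delta> / 2)"
    using r unfolding whp_def by simp
  from likely_conj[OF eq this prob]
  have "likely r M (\<lambda>m \<omega>. (\<forall>s\<in>{t\<^sub>0 - \<eta>..t\<^sub>0 + \<eta>}. \<bar>\<nu> m \<omega> s - \<nu> m \<omega> t\<^sub>0\<bar> \<le> e / 2) \<and>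
      (\<forall>s\<in>{0..1}. Gm m \<omega> s \<le> G s + \<delta> / 2) \<and> \<bar>Gm m \<omega> t\<^sub>0 - G t\<^sub>0\<bar> < \<delta> / 2)" by simp
  then show "likely r M (\<lambda>m \<omega>. \<nu> m \<omega> t\<^sub>0 \<le> (\<beta> - g\<^sub>0) * x - e \<longrightarrow> T m \<omega> \<le> t\<^sub>0 + x / sqrt (real m))"
  proof (rule likely_mono)
    show "\<forall>\<^sub>F m in sequentially. \<forall>\<omega>\<in>space (M m). (\<forall>s\<in>{t\<^sub>0 - \<eta>..t\<^sub>0 + \<eta>}. \<bar>\<nu> m \<omega> s - \<nu> m \<omega> t\<^sub>0\<bar> \<le> e / 2) \<and>
      (\<forall>s\<in>{0..1}. Gm m \<omega> s \<le> G s + \<delta> / 2) \<and> \<bar>Gm m \<omega> t\<^sub>0 - G t\<^sub>0\<bar> < \<delta> / 2 \<longrightarrow>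
      \<nu> m \<omega> t\<^sub>0 \<le> (\<beta> - g\<^sub>0) * x - e \<longrightarrow> T m \<omega> \<le> t\<^sub>0 + x / sqrt (real m)"
      using sqrt_shrink[OF t0(1), of x] eventually_gt_at_top[of 0]
    proof eventually_elim
      case (elim m)
      define w where "w = sqrt (real m)"
      have w: "0 < w" using elim by (simp add: w_def)
      define t where "t = t\<^sub>0 + x / w"
      have t: "0 < t" using elim by (simp add: t_def w_def)
      show ?case
      proof (intro ballI impI, elim conjE)
        fix \<omega> assume mod: "\<forall>s\<in>{t\<^sub>0 - \<eta>..t\<^sub>0 + \<eta>}. \<bar>\<nu> m \<omega> s - \<nu> m \<omega> t\<^sub>0\<bar> \<le> e / 2"
          and up: "\<forall>s\<in>{0..1}. Gm m \<omega> s \<le> G s + \<delta> / 2" and near: "\<bar>Gm m \<omega> t\<^sub>0 - G t\<^sub>0\<bar> < \<delta> / 2"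
          and Z: "\<nu> m \<omega> t\<^sub>0 \<le> (\<beta> - g\<^sub>0) * x - e"
        have \<nu>_eq: "Gm m \<omega> s = G s + \<nu> m \<omega> s / w" for s using w by (simp add: emp_process_def w_def)
        define u where "u = G t\<^sub>0 - g\<^sub>0 * t\<^sub>0 + (\<nu> m \<omega> t\<^sub>0 + e / 2) / w"
        have maj: "Gm m \<omega> s \<le> u + g\<^sub>0 * s" if s: "s \<in> {0..1}" for s
        proof (cases "\<eta> \<le> \<bar>s - t\<^sub>0\<bar>")
          case True
          have "Gm m \<omega> s \<le> G s + \<delta> / 2" using up s by blast
          also have "\<dots> \<le> G t\<^sub>0 + g\<^sub>0 * (s - t\<^sub>0) - \<delta> / 2" using \<delta>(2)[OF s True] by simp
          also have "\<dots> \<le> G t\<^sub>0 + g\<^sub>0 * (s - t\<^sub>0) + \<nu> m \<omega> t\<^sub>0 / w"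
            using near \<nu>_eq[of t\<^sub>0] by linarith
          also have "\<dots> \<le> u + g\<^sub>0 * s" using e w by (simp add: u_def algebra_simps add_divide_distrib)
          finally show ?thesis .
        next
          case False
          then have "s \<in> {t\<^sub>0 - \<eta>..t\<^sub>0 + \<eta>}" by (auto simp: abs_if split: if_splits)
          then have "\<nu> m \<omega> s \<le> \<nu> m \<omega> t\<^sub>0 + e / 2" using bspec[OF mod, of s] by linarith
          then have "\<nu> m \<omega> s / w \<le> (\<nu> m \<omega> t\<^sub>0 + e / 2) / w" using w by (intro divide_right_mono) auto
          moreover have "G s \<le> G t\<^sub>0 + g\<^sub>0 * (s - t\<^sub>0)" using below_tangent[OF s] by (cases "s = t\<^sub>0") auto
          ultimately show ?thesis unfolding \<nu>_eq u_def by (simp add: algebra_simps)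
        qed
        have "T m \<omega> \<le> t"
        proof (rule last_crossing_le_affine)
          show "\<Phi> (Gm m \<omega>) s \<le> u + g\<^sub>0 * s" if "s \<in> {0..1}" for s
            using Phi_le_affine[OF Phi that maj] .
          show "0 \<le> u" using maj[of 0] order_trans[OF empirical_cdf_bounds(1)] by auto
          have "(\<nu> m \<omega> t\<^sub>0 + e / 2) / w < (\<beta> - g\<^sub>0) * x / w"
            using Z e w by (intro divide_strict_right_mono) auto
          then show "u + g\<^sub>0 * t < \<beta> * t"
            unfolding u_def t_def using crossing by (simp add: algebra_simps diff_divide_distrib)
        qed (rule t)
        then show "T m \<omega> \<le> t\<^sub>0 + x / sqrt (real m)" by (simp add: t_def w_def)
      qed
    qed
  qed
qed

text \<open>Equicontinuity transfers the deviation at \<open>t\<^sub>0\<close> to the moving point \<open>t\<^sub>0 + x / sqrt m\<close>, where the expansion of \<open>G\<close> to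
first order decides the comparison with the line.\<close>
lemma crossing_lower:
  assumes e: "0 < e"
  shows "whp M (\<lambda>m \<omega>. (\<beta> - g\<^sub>0) * x + e \<le> \<nu> m \<omega> t\<^sub>0 \<longrightarrow> t\<^sub>0 + x / sqrt (real m) \<le> T m \<omega>)"
  unfolding whp_def
proof (intro allI impI)
  fix r :: real assume r: "0 < r"
  obtain \<eta> where \<eta>: "0 < \<eta>" "t\<^sub>0 + \<eta> \<le> 1" "0 \<le> t\<^sub>0 - \<eta>"
    and eq: "likely r M (\<lambda>m \<omega>. \<forall>s\<in>{t\<^sub>0 - \<eta>..t\<^sub>0 + \<eta>}. \<bar>\<nu> m \<omega> s - \<nu> m \<omega> t\<^sub>0\<bar> \<le> e / 2)"
    using likely_equicontinuous[of r "e / 2"] r e by auto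
  \<comment> \<open>The error \<open>k * \<bar>x\<bar>\<close> of the first-order expansion may use up only half of \<open>e\<close>; the other half pays for the oscillation of \<open>\<nu>\<close>.\<close>
  define k where "k = e / (2 * (\<bar>x\<bar> + 1))"
  have k: "0 < k" "k * \<bar>x\<bar> \<le> e / 2" using e by (auto simp: k_def field_simps)
  obtain d where d: "0 < d" "\<And>y. \<bar>y - t\<^sub>0\<bar> < d \<Longrightarrow> \<bar>G y - G t\<^sub>0 - g\<^sub>0 * (y - t\<^sub>0)\<bar> \<le> k * \<bar>y - t\<^sub>0\<bar>"
    using deriv k(1) unfolding has_field_derivative_def has_derivative_at_alt real_norm_def
    by blast
  show "likely r M (\<lambda>m \<omega>. (\<beta> - g\<^sub>0) * x + e \<le> \<nu> m \<omega> t\<^sub>0 \<longrightarrow> t\<^sub>0 + x / sqrt (real m) \<le> T m \<omega>)"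
    using eq
  proof (rule likely_mono)
    show "\<forall>\<^sub>F m in sequentially. \<forall>\<omega>\<in>space (M m). (\<forall>s\<in>{t\<^sub>0 - \<eta>..t\<^sub>0 + \<eta>}. \<bar>\<nu> m \<omega> s - \<nu> m \<omega> t\<^sub>0\<bar> \<le> e / 2) \<longrightarrow>
      (\<beta> - g\<^sub>0) * x + e \<le> \<nu> m \<omega> t\<^sub>0 \<longrightarrow> t\<^sub>0 + x / sqrt (real m) \<le> T m \<omega>"
      using sqrt_shrink[OF \<eta>(1), of x] sqrt_shrink[OF d(1), of x] eventually_gt_at_top[of 0]
    proof eventually_elim
      case (elim m)
      define w where "w = sqrt (real m)"
      have w: "0 < w" using elim by (simp add: w_def)
      define t where "t = t\<^sub>0 + x / w"
      have t: "t \<in> {t\<^sub>0 - \<eta>..t\<^sub>0 + \<eta>}" "\<bar>t - t\<^sub>0\<bar> < d" using elim by (auto simp: t_def w_def abs_less_iff simp del: abs_divide)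
      then have t01: "t \<in> {0..1}" using \<eta> by auto
      have "k * \<bar>t - t\<^sub>0\<bar> = k * \<bar>x\<bar> / w" using w by (simp add: t_def)
      also have "\<dots> \<le> e / 2 / w" using k w by (intro divide_right_mono) auto
      finally have Gt: "G t\<^sub>0 + g\<^sub>0 * (t - t\<^sub>0) - e / 2 / w \<le> G t"
        using d(2)[OF t(2)] by linarith
      show ?case
      proof (intro ballI impI)
        fix \<omega> assume mod: "\<forall>s\<in>{t\<^sub>0 - \<eta>..t\<^sub>0 + \<eta>}. \<bar>\<nu> m \<omega> s - \<nu> m \<omega> t\<^sub>0\<bar> \<le> e / 2"
          and Z: "(\<beta> - g\<^sub>0) * x + e \<le> \<nu> m \<omega> t\<^sub>0"
        have "(\<beta> - g\<^sub>0) * x + e / 2 \<le> \<nu> m \<omega> t" using bspec[OF mod t(1)] Z by linarith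
        then have "((\<beta> - g\<^sub>0) * x + e / 2) / w \<le> \<nu> m \<omega> t / w" using w by (intro divide_right_mono) auto
        moreover have "Gm m \<omega> t = G t + \<nu> m \<omega> t / w" using w by (simp add: emp_process_def w_def)
        ultimately have "\<beta> * t \<le> Gm m \<omega> t"
          using Gt crossing by (simp add: t_def algebra_simps add_divide_distrib diff_divide_distrib)
        also have "\<dots> \<le> \<Phi> (Gm m \<omega>) t" by (rule Phi_ge_empirical[OF Phi t01])
        finally have "t \<le> T m \<omega>" using t01 by (intro last_crossing_ge) auto
        then show "t\<^sub>0 + x / sqrt (real m) \<le> T m \<omega>" by (simp add: t_def w_def)
      qed
    qed
  qed
qed

text \<open>By tightness of \<open>\<nu> t\<^sub>0\<close> the linearization puts \<open>T\<close> within a constant multiple of \<open>1 / sqrt m\<close> of \<open>t\<^sub>0\<close>.\<close>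
lemma T_consistent:
  assumes e: "0 < e"
  shows "whp M (\<lambda>m \<omega>. \<bar>T m \<omega> - t\<^sub>0\<bar> \<le> e)"
  unfolding whp_def
proof (intro allI impI)
  fix r :: real assume r: "0 < r"
  obtain R where R: "0 < R" "likely (r / 2) M (\<lambda>m \<omega>. \<bar>\<nu> m \<omega> t\<^sub>0\<bar> < R)"
    using likely_tight[of "r / 2"] r by auto
  define x where "x = (R + 1) / (\<beta> - g\<^sub>0)"
  have x: "(\<beta> - g\<^sub>0) * x = R + 1" using slope_gap by (simp add: x_def)
  have "whp M (\<lambda>m \<omega>. (\<nu> m \<omega> t\<^sub>0 \<le> (\<beta> - g\<^sub>0) * x - 1 \<longrightarrow> T m \<omega> \<le> t\<^sub>0 + x / sqrt (real m)) \<and>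
     ((\<beta> - g\<^sub>0) * (- x) + 1 \<le> \<nu> m \<omega> t\<^sub>0 \<longrightarrow> t\<^sub>0 + (- x) / sqrt (real m) \<le> T m \<omega>))"
    by (intro whp_conj crossing_upper crossing_lower prob) auto
  then have "likely (r / 2) M (\<lambda>m \<omega>. (\<nu> m \<omega> t\<^sub>0 \<le> (\<beta> - g\<^sub>0) * x - 1 \<longrightarrow> T m \<omega> \<le> t\<^sub>0 + x / sqrt (real m)) \<and>
     ((\<beta> - g\<^sub>0) * (- x) + 1 \<le> \<nu> m \<omega> t\<^sub>0 \<longrightarrow> t\<^sub>0 + (- x) / sqrt (real m) \<le> T m \<omega>))"
    using r unfolding whp_def by simp
  from likely_conj[OF R(2) this prob]
  have "likely r M (\<lambda>m \<omega>. \<bar>\<nu> m \<omega> t\<^sub>0\<bar> < R \<and> (\<nu> m \<omega> t\<^sub>0 \<le> (\<beta> - g\<^sub>0) * x - 1 \<longrightarrow> T m \<omega> \<le> t\<^sub>0 + x / sqrt (real m)) \<and>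
     ((\<beta> - g\<^sub>0) * (- x) + 1 \<le> \<nu> m \<omega> t\<^sub>0 \<longrightarrow> t\<^sub>0 + (- x) / sqrt (real m) \<le> T m \<omega>))" by simp
  then show "likely r M (\<lambda>m \<omega>. \<bar>T m \<omega> - t\<^sub>0\<bar> \<le> e)"
  proof (rule likely_mono)
    show "\<forall>\<^sub>F m in sequentially. \<forall>\<omega>\<in>space (M m). \<bar>\<nu> m \<omega> t\<^sub>0\<bar> < R \<and> (\<nu> m \<omega> t\<^sub>0 \<le> (\<beta> - g\<^sub>0) * x - 1 \<longrightarrow> T m \<omega> \<le> t\<^sub>0 + x / sqrt (real m)) \<and>
     ((\<beta> - g\<^sub>0) * (- x) + 1 \<le> \<nu> m \<omega> t\<^sub>0 \<longrightarrow> t\<^sub>0 + (- x) / sqrt (real m) \<le> T m \<omega>) \<longrightarrow> \<bar>T m \<omega> - t\<^sub>0\<bar> \<le> e"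
      using sqrt_shrink[OF e, of x]
    proof eventually_elim
      case (elim m)
      show ?case
      proof (intro ballI impI, elim conjE)
        fix \<omega>
        assume A: "\<bar>\<nu> m \<omega> t\<^sub>0\<bar> < R" "\<nu> m \<omega> t\<^sub>0 \<le> (\<beta> - g\<^sub>0) * x - 1 \<longrightarrow> T m \<omega> \<le> t\<^sub>0 + x / sqrt (real m)"
          "(\<beta> - g\<^sub>0) * (- x) + 1 \<le> \<nu> m \<omega> t\<^sub>0 \<longrightarrow> t\<^sub>0 + (- x) / sqrt (real m) \<le> T m \<omega>"
        have "\<nu> m \<omega> t\<^sub>0 \<le> (\<beta> - g\<^sub>0) * x - 1" "(\<beta> - g\<^sub>0) * (- x) + 1 \<le> \<nu> m \<omega> t\<^sub>0"
          using A(1) x by auto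
        then show "\<bar>T m \<omega> - t\<^sub>0\<bar> \<le> e" using A(2,3) elim by auto
      qed
    qed
  qed
qed

end

section \<open>The false discovery proportion\<close>

lemma DERIV_sqrt_scaled:
  assumes "(\<psi> has_real_derivative d) (at t\<^sub>0)"
  shows "(\<lambda>m. sqrt (real m) * (\<psi> (t\<^sub>0 + y / sqrt (real m)) - \<psi> t\<^sub>0)) \<longlonglongrightarrow> d * y"
proof (cases "y = 0")
  case False
  have "((\<lambda>h. (\<psi> (t\<^sub>0 + h) - \<psi> t\<^sub>0) / h) \<longlongrightarrow> d) (at 0)"
    using assms by (simp add: DERIV_def)
  moreover have "filterlim (\<lambda>m. y / sqrt (real m)) (at 0) sequentially"
    unfolding filterlim_at using divide_sqrt_tendsto_0[of y] False
    by (auto intro!: eventually_mono[OF eventually_gt_at_top[of 0]])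
  ultimately have "(\<lambda>m. (\<psi> (t\<^sub>0 + y / sqrt (real m)) - \<psi> t\<^sub>0) / (y / sqrt (real m))) \<longlonglongrightarrow> d"
    by (rule filterlim_compose)
  from tendsto_mult_right[OF this, of y]
  have "(\<lambda>m. (\<psi> (t\<^sub>0 + y / sqrt (real m)) - \<psi> t\<^sub>0) / (y / sqrt (real m)) * y) \<longlonglongrightarrow> d * y" .
  moreover have "z / (y / w) * y = w * z" for z w using False by simp
  ultimately show ?thesis by simp
qed simp

lemma expectation_tendsto_of_whp:
  fixes M :: "nat \<Rightarrow> 'a measure" and X :: "nat \<Rightarrow> 'a \<Rightarrow> real"
  assumes M: "\<And>m. prob_space (M m)" and Xm: "\<And>m. X m \<in> borel_measurable (M m)"
    and bnd: "\<And>m \<omega>. \<bar>X m \<omega> - L\<bar> \<le> 1"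
    and conv: "\<And>e. 0 < e \<Longrightarrow> whp M (\<lambda>m \<omega>. \<bar>X m \<omega> - L\<bar> \<le> e)"
  shows "(\<lambda>m. prob_space.expectation (M m) (X m)) \<longlonglongrightarrow> L"
proof (rule tendstoI)
  fix e :: real assume e: "0 < e"
  then have "likely (e / 3) M (\<lambda>m \<omega>. \<bar>X m \<omega> - L\<bar> \<le> e / 3)"
    using conv[of "e / 3"] unfolding whp_def by simp
  then show "\<forall>\<^sub>F m in sequentially. dist (prob_space.expectation (M m) (X m)) L < e"
    unfolding likely_def
  proof eventually_elim
    case (elim m)
    interpret prob_space "M m" by (rule M)
    note [measurable] = Xm[of m]
    obtain A where A[measurable]: "A \<in> events" and A': "prob A \<le> e / 3" "\<And>\<omega>. \<omega> \<in> space (M m) - A \<Longrightarrow> \<bar>X m \<omega> - L\<bar> \<le> e / 3"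
      using elim by blast
    have "\<bar>X m \<omega>\<bar> \<le> 1 + \<bar>L\<bar>" for \<omega> using bnd[of m \<omega>] by linarith
    then have intX: "integrable (M m) (X m)"
      by (intro integrable_const_bound[where B = "1 + \<bar>L\<bar>"]) auto
    have "\<bar>expectation (X m) - L\<bar> = \<bar>expectation (\<lambda>\<omega>. X m \<omega> - L)\<bar>"
      using intX by (simp add: prob_space)
    also have "\<dots> \<le> expectation (\<lambda>\<omega>. \<bar>X m \<omega> - L\<bar>)" by (rule integral_abs_bound)
    also have "\<dots> \<le> expectation (\<lambda>\<omega>. e / 3 + indicator A \<omega>)"
    proof (rule integral_mono)
      show "integrable (M m) (\<lambda>\<omega>. e / 3 + indicator A \<omega> :: real)"
        by (auto intro!: integrable_real_indicator simp: emeasure_eq_measure)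
      fix \<omega> assume "\<omega> \<in> space (M m)"
      then show "\<bar>X m \<omega> - L\<bar> \<le> e / 3 + indicator A \<omega>"
        using A'(2)[of \<omega>] bnd[of m \<omega>] e by (auto simp: indicator_def)
    qed (use intX in auto)
    also have "\<dots> = e / 3 + prob A"
      by (subst Bochner_Integration.integral_add) (auto simp: prob_space emeasure_eq_measure)
    finally show ?case using A'(1) e by (simp add: dist_real_def)
  qed
qed

lemma FDP_eq_counts:
  "FDP m p h t = real (card {i \<in> {1..m}. p i \<le> t \<and> \<not> h i}) /
     (real (card {i \<in> {1..m}. p i \<le> t}) + of_bool (\<forall>i\<in>{1..m}. p i > t))"
proof -
  have "of_bool (p i \<le> t) * (1 - of_bool (h i)) = (of_bool (p i \<le> t \<and> \<not> h i) :: real)" for i by auto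
  then show ?thesis unfolding FDP_def by (simp only: card_filter_eq_sum[OF finite_atLeastAtMost])
qed

lemma FDP_bounds: "0 \<le> FDP m p h t" "FDP m p h t \<le> 1"
proof -
  have "card {i \<in> {1..m}. p i \<le> t \<and> \<not> h i} \<le> card {i \<in> {1..m}. p i \<le> t}"
    by (intro card_mono) auto
  then have "real (card {i \<in> {1..m}. p i \<le> t \<and> \<not> h i}) \<le>
      real (card {i \<in> {1..m}. p i \<le> t}) + of_bool (\<forall>i\<in>{1..m}. p i > t)" by simp
  then show "FDP m p h t \<le> 1" unfolding FDP_eq_counts by (auto simp: divide_le_eq_1)
qed (simp add: FDP_eq_counts)

lemma FDP_eq_ratio:
  assumes "0 < card {i \<in> {1..m}. p i \<le> t}"
  shows "FDP m p h t = (real (card {i \<in> {1..m}. p i \<le> t \<and> \<not> h i}) / real m) / empirical_cdf m p t"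
proof -
  have "{i \<in> {1..m}. p i \<le> t} \<noteq> {}" using assms by (metis card.empty less_irrefl)
  then obtain i where i: "i \<in> {1..m}" "p i \<le> t" by blast
  then have "\<not> (\<forall>i\<in>{1..m}. p i > t)" "0 < m" using leD by (blast, auto)
  then show ?thesis unfolding FDP_eq_counts empirical_cdf_def by simp
qed

lemma FDP_measurable:
  assumes P: "\<And>i. i \<in> {1..m} \<Longrightarrow> P i \<in> borel_measurable M"
    and H: "\<And>i. i \<in> {1..m} \<Longrightarrow> H i \<in> measurable M (count_space UNIV)"
    and T[measurable]: "T \<in> borel_measurable M"
  shows "(\<lambda>\<omega>. FDP m (\<lambda>i. P i \<omega>) (\<lambda>i. H i \<omega>) (T \<omega>)) \<in> borel_measurable M"
proof -
  note [measurable] = P H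
  have [measurable]: "Measurable.pred M (\<lambda>\<omega>. \<forall>i\<in>{1..m}. P i \<omega> > T \<omega>)" by measurable
  show ?thesis unfolding FDP_eq_counts
    by (intro borel_measurable_divide borel_measurable_add count_measurable) measurable
qed

lemma divide_near:
  fixes x y A B e :: real
  assumes "0 \<le> A" "A \<le> B" "0 < B" and x: "\<bar>x - A\<bar> < d" and y: "\<bar>y - B\<bar> < d"
    and d: "d \<le> B / 2" "d \<le> e * B / 4"
  shows "0 < y" "\<bar>x / y - A / B\<bar> \<le> e"
proof -
  have y2: "B / 2 \<le> y" using y d(1) by linarith
  then show y0: "0 < y" using assms(3) by linarith
  have d0: "0 < d" using x by linarith
  have "\<bar>(x - A) * B - A * (y - B)\<bar> \<le> \<bar>x - A\<bar> * B + A * \<bar>y - B\<bar>"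
    using assms(1,3) abs_triangle_ineq4[of "(x - A) * B" "A * (y - B)"] by (simp add: abs_mult)
  also have "\<dots> \<le> d * B + B * d"
    using assms by (intro add_mono mult_mono) auto
  also have "\<dots> \<le> 2 * B * (e * B / 4)"
    using mult_left_mono[OF d(2), of "2 * B"] assms(3) by simp
  also have "\<dots> = e * B * (B / 2)" by simp
  also have "\<dots> \<le> e * B * y"
  proof (rule mult_left_mono[OF y2])
    show "0 \<le> e * B" using d(2) d0 by simp
  qed
  finally have "\<bar>(x - A) * B - A * (y - B)\<bar> / (y * B) \<le> e"
    using y0 assms(3) by (simp add: pos_divide_le_eq ac_simps)
  moreover have "x / y - A / B = ((x - A) * B - A * (y - B)) / (y * B)"
    using y0 assms(3) by (simp add: field_simps)
  ultimately show "\<bar>x / y - A / B\<bar> \<le> e"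
    using y0 assms(3) by (simp add: abs_divide abs_mult)
qed

text \<open>The proportion lies between \<open>0\<close> and \<open>1\<close>, so convergence in probability of numerator and denominator is enough.
The indicator in the denominator of the proportion vanishes once the limit \<open>B\<close> of the denominator is positive.\<close>
lemma FDP_expectation_tendsto:
  fixes M :: "nat \<Rightarrow> 'a measure" and P T H
  assumes M: "\<And>m. prob_space (M m)"
    and P: "\<And>m i. i \<in> {1..m} \<Longrightarrow> P m i \<in> borel_measurable (M m)"
    and H: "\<And>m i. i \<in> {1..m} \<Longrightarrow> H m i \<in> measurable (M m) (count_space UNIV)"
    and T: "\<And>m. T m \<in> borel_measurable (M m)"
    and null: "\<And>e. 0 < e \<Longrightarrow> whp M (\<lambda>m \<omega>.
        \<bar>real (card {i \<in> {1..m}. P m i \<omega> \<le> T m \<omega> \<and> \<not> H m i \<omega>}) / real m - A\<bar> < e)"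
    and all: "\<And>e. 0 < e \<Longrightarrow> whp M (\<lambda>m \<omega>. \<bar>empirical_cdf m (\<lambda>i. P m i \<omega>) (T m \<omega>) - B\<bar> < e)"
    and AB: "0 \<le> A" "A \<le> B" "0 < B"
  shows "(\<lambda>m. prob_space.expectation (M m) (\<lambda>\<omega>. FDP m (\<lambda>i. P m i \<omega>) (\<lambda>i. H m i \<omega>) (T m \<omega>))) \<longlonglongrightarrow> A / B"
proof (rule expectation_tendsto_of_whp[OF M])
  let ?F = "\<lambda>m \<omega>. FDP m (\<lambda>i. P m i \<omega>) (\<lambda>i. H m i \<omega>) (T m \<omega>)"
  have "0 \<le> A / B" "A / B \<le> 1" using AB by auto
  then show "\<bar>?F m \<omega> - A / B\<bar> \<le> 1" for m \<omega>
    using FDP_bounds[of m "\<lambda>i. P m i \<omega>" "\<lambda>i. H m i \<omega>" "T m \<omega>"] by linarith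
  show "?F m \<in> borel_measurable (M m)" for m
    using P H T by (rule FDP_measurable)
  fix e :: real assume e: "0 < e"
  define d where "d = min (B / 2) (e * B / 4)"
  have d: "0 < d" "d \<le> B / 2" "d \<le> e * B / 4" using e AB by (auto simp: d_def)
  from whp_conj[OF null[OF d(1)] all[OF d(1)] M]
  show "whp M (\<lambda>m \<omega>. \<bar>?F m \<omega> - A / B\<bar> \<le> e)"
  proof (rule whp_mono, intro always_eventually allI ballI impI, elim conjE)
    fix m \<omega>
    assume N: "\<bar>real (card {i \<in> {1..m}. P m i \<omega> \<le> T m \<omega> \<and> \<not> H m i \<omega>}) / real m - A\<bar> < d"
      and G: "\<bar>empirical_cdf m (\<lambda>i. P m i \<omega>) (T m \<omega>) - B\<bar> < d"
    have "0 < empirical_cdf m (\<lambda>i. P m i \<omega>) (T m \<omega>)" using divide_near(1)[OF AB N G d(2,3)] .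
    then have "0 < card {i \<in> {1..m}. P m i \<omega> \<le> T m \<omega>}" unfolding empirical_cdf_def by (auto intro!: Nat.gr0I)
    then show "\<bar>?F m \<omega> - A / B\<bar> \<le> e"
      using divide_near(2)[OF AB N G d(2,3)] by (simp only: FDP_eq_ratio)
  qed
qed

text \<open>Pointwise convergence of monotone functions suffices for evaluation at a random point: the random point is
caught between two fixed points close to its limit.\<close>
lemma whp_monotone_at_consistent:
  fixes f :: "nat \<Rightarrow> 'a \<Rightarrow> real \<Rightarrow> real" and T :: "nat \<Rightarrow> 'a \<Rightarrow> real"
  assumes M: "\<And>m. prob_space (M m)"
    and mono: "\<And>m \<omega> s t. s \<le> t \<Longrightarrow> f m \<omega> s \<le> f m \<omega> t"
    and conv: "\<And>t e. 0 \<le> t \<Longrightarrow> t \<le> 1 \<Longrightarrow> 0 < e \<Longrightarrow> whp M (\<lambda>m \<omega>. \<bar>f m \<omega> t - A t\<bar> < e)"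
    and T: "\<And>\<eta>. 0 < \<eta> \<Longrightarrow> whp M (\<lambda>m \<omega>. \<bar>T m \<omega> - \<tau>\<bar> \<le> \<eta>)"
    and \<tau>: "0 < \<tau>" "\<tau> < 1" and A: "isCont A \<tau>" and e: "0 < e"
  shows "whp M (\<lambda>m \<omega>. \<bar>f m \<omega> (T m \<omega>) - A \<tau>\<bar> < e)"
proof -
  obtain d where d: "0 < d" "\<And>t. \<bar>t - \<tau>\<bar> < d \<Longrightarrow> \<bar>A t - A \<tau>\<bar> < e / 2"
    using A half_gt_zero[OF e] unfolding continuous_at_eps_delta dist_real_def by blast
  define \<eta> where "\<eta> = min (d / 2) (min \<tau> (1 - \<tau>))"
  have \<eta>: "0 < \<eta>" "\<eta> < d" "0 \<le> \<tau> - \<eta>" "\<tau> + \<eta> \<le> 1" using d(1) \<tau> by (auto simp: \<eta>_def)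
  have "whp M (\<lambda>m \<omega>. \<bar>T m \<omega> - \<tau>\<bar> \<le> \<eta> \<and> \<bar>f m \<omega> (\<tau> - \<eta>) - A (\<tau> - \<eta>)\<bar> < e / 2 \<and> \<bar>f m \<omega> (\<tau> + \<eta>) - A (\<tau> + \<eta>)\<bar> < e / 2)"
    using \<eta> e \<tau> by (intro whp_conj T conv M) auto
  then show ?thesis
  proof (rule whp_mono, intro always_eventually allI ballI impI, elim conjE)
    fix m \<omega>
    assume B: "\<bar>T m \<omega> - \<tau>\<bar> \<le> \<eta>" "\<bar>f m \<omega> (\<tau> - \<eta>) - A (\<tau> - \<eta>)\<bar> < e / 2" "\<bar>f m \<omega> (\<tau> + \<eta>) - A (\<tau> + \<eta>)\<bar> < e / 2"
    have "f m \<omega> (\<tau> - \<eta>) \<le> f m \<omega> (T m \<omega>)" "f m \<omega> (T m \<omega>) \<le> f m \<omega> (\<tau> + \<eta>)"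
      using B(1) by (auto intro!: mono)
    moreover have "\<bar>A (\<tau> - \<eta>) - A \<tau>\<bar> < e / 2" "\<bar>A (\<tau> + \<eta>) - A \<tau>\<bar> < e / 2"
      using d(2)[of "\<tau> - \<eta>"] d(2)[of "\<tau> + \<eta>"] \<eta> by auto
    ultimately show "\<bar>f m \<omega> (T m \<omega>) - A \<tau>\<bar> < e" using B(2,3) by linarith
  qed
qed

section \<open>Limits at an interior threshold\<close>

context empirical_crossing
begin

lemma \<nu>_clt:
  "weak_conv_m (\<lambda>m. distr (M m) borel (\<lambda>\<omega>. \<nu> m \<omega> t\<^sub>0 / sqrt (G t\<^sub>0 * (1 - G t\<^sub>0)))) std_normal_distribution"
proof -
  have "weak_conv_m (\<lambda>m. distr (M m) borel
      (\<lambda>\<omega>. (real (card {i \<in> {1..m}. P m i \<omega> \<in> {..t\<^sub>0}}) - real m * G t\<^sub>0) / sqrt (real m * (G t\<^sub>0 * (1 - G t\<^sub>0)))))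
      std_normal_distribution"
    using t0 law G_t0 by (intro indep_count_clt[OF prob indep]) auto
  moreover have "(real (card {i \<in> {1..m}. P m i \<omega> \<in> {..t\<^sub>0}}) - real m * G t\<^sub>0) / sqrt (real m * (G t\<^sub>0 * (1 - G t\<^sub>0)))
      = \<nu> m \<omega> t\<^sub>0 / sqrt (G t\<^sub>0 * (1 - G t\<^sub>0))" for m \<omega>
  proof (cases "m = 0")
    case False
    define w where "w = sqrt (real m)"
    have w: "real m = w * w" "w \<noteq> 0" using False by (auto simp: w_def)
    have "(x - w * w * y) / (w * z) = w * (x / (w * w) - y) / z" for x y z
      using w(2) by (cases "z = 0") (simp_all add: field_simps)
    then show ?thesis
      unfolding emp_process_def empirical_cdf_def real_sqrt_mult[of "real m"] atMost_iff
      unfolding w_def[symmetric] unfolding w(1) .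
  qed (simp add: emp_process_def)
  ultimately show ?thesis by simp
qed

text \<open>The delta method, with monotonicity of \<open>\<psi>\<close> in place of a Taylor expansion at the random point: \<open>T \<le> t\<^sub>0 + y / sqrt m\<close>
gives \<open>\<psi> T \<le> \<psi> (t\<^sub>0 + y / sqrt m)\<close>, and only the deterministic right-hand side is expanded.\<close>
lemma threshold_clt:
  assumes mono: "mono_on {0..1} \<psi>" and \<psi>: "(\<psi> has_real_derivative d) (at t\<^sub>0)" and d: "0 < d"
    and [measurable]: "\<psi> \<in> borel_measurable borel"
  shows "weak_conv_m (\<lambda>m. distr (M m) borel (\<lambda>\<omega>. sqrt (real m) * (\<psi> (T m \<omega>) - \<psi> t\<^sub>0)))
    (normal_law 0 (d\<^sup>2 * (G t\<^sub>0 * (1 - G t\<^sub>0)) / (\<beta> - g\<^sub>0)\<^sup>2))"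
proof -
  define \<sigma> where "\<sigma> = sqrt (G t\<^sub>0 * (1 - G t\<^sub>0))"
  have \<sigma>: "0 < \<sigma>" "\<sigma>\<^sup>2 = G t\<^sub>0 * (1 - G t\<^sub>0)" using G_t0 by (auto simp: \<sigma>_def)
  define c where "c = \<beta> - g\<^sub>0"
  have c: "0 < c" using slope_gap by (simp add: c_def)
  define \<kappa> where "\<kappa> = d * \<sigma> / c"
  have \<kappa>: "0 < \<kappa>" using d \<sigma> c by (simp add: \<kappa>_def)
  define W where "W = (\<lambda>m \<omega>. sqrt (real m) * (\<psi> (T m \<omega>) - \<psi> t\<^sub>0) / \<kappa>)"
  have Wm[measurable]: "W m \<in> borel_measurable (M m)" for m unfolding W_def by measurable
  have \<psi>T: "\<psi> s \<le> \<psi> t" if "0 \<le> s" "s \<le> t" "t \<le> 1" for s t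
    using mono_onD[OF mono, of s t] that by auto
  have stay: "\<forall>\<^sub>F m in sequentially. t\<^sub>0 + y / sqrt (real m) \<in> {0..1}" for y
    using sqrt_shrink[of "min t\<^sub>0 (1 - t\<^sub>0)" y] t0
    by (auto elim!: eventually_mono)
  have "weak_conv_m (\<lambda>m. distr (M m) borel (W m)) std_normal_distribution"
  proof (rule weak_conv_sandwich[OF prob _ Wm \<nu>_clt std_normal_cdf_continuous, folded \<sigma>_def])
    show "(\<lambda>\<omega>. \<nu> m \<omega> t\<^sub>0 / \<sigma>) \<in> borel_measurable (M m)" for m by measurable
  next
    fix x e :: real assume e: "0 < e"
    \<comment> \<open>One half of the margin \<open>e\<close> pays for the linearization of the threshold, the other for the expansion of \<open>\<psi>\<close>.\<close>
    define y where "y = \<sigma> * (x - e / 2) / c"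
    have cy: "c * y - \<sigma> * e / 2 = \<sigma> * (x - e)" using c by (simp add: y_def field_simps)
    have dy: "d * y < \<kappa> * x"
    proof -
      have "d * y = \<kappa> * (x - e / 2)" by (simp add: y_def \<kappa>_def)
      also have "\<dots> < \<kappa> * x" using \<kappa> e by (intro mult_strict_left_mono) auto
      finally show ?thesis .
    qed
    have "whp M (\<lambda>m \<omega>. \<nu> m \<omega> t\<^sub>0 \<le> c * y - \<sigma> * e / 2 \<longrightarrow> T m \<omega> \<le> t\<^sub>0 + y / sqrt (real m))"
      unfolding c_def using \<sigma> e by (intro crossing_upper) simp
    then show "(\<lambda>m. measure (M m) {\<omega> \<in> space (M m). \<nu> m \<omega> t\<^sub>0 / \<sigma> \<le> x - e \<and> x < W m \<omega>}) \<longlonglongrightarrow> 0"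
    proof (rule whp_tendsto_0[OF _ prob])
      show "\<forall>\<^sub>F m in sequentially. \<forall>\<omega>\<in>space (M m). (\<nu> m \<omega> t\<^sub>0 \<le> c * y - \<sigma> * e / 2 \<longrightarrow> T m \<omega> \<le> t\<^sub>0 + y / sqrt (real m)) \<longrightarrow>
          \<not> (\<nu> m \<omega> t\<^sub>0 / \<sigma> \<le> x - e \<and> x < W m \<omega>)"
        using order_tendstoD(2)[OF DERIV_sqrt_scaled[OF \<psi>, of y] dy] stay[of y]
      proof eventually_elim
        case (elim m)
        show ?case
        proof (intro ballI impI notI)
          fix \<omega> assume imp: "\<nu> m \<omega> t\<^sub>0 \<le> c * y - \<sigma> * e / 2 \<longrightarrow> T m \<omega> \<le> t\<^sub>0 + y / sqrt (real m)"
            and bad: "\<nu> m \<omega> t\<^sub>0 / \<sigma> \<le> x - e \<and> x < W m \<omega>"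
          have "\<nu> m \<omega> t\<^sub>0 \<le> c * y - \<sigma> * e / 2" using bad \<sigma>(1) unfolding cy by (simp add: pos_divide_le_eq mult.commute)
          then have "\<psi> (T m \<omega>) \<le> \<psi> (t\<^sub>0 + y / sqrt (real m))"
            using imp elim(2) last_crossing_unit by (intro \<psi>T) auto
          then have "sqrt (real m) * (\<psi> (T m \<omega>) - \<psi> t\<^sub>0) \<le> sqrt (real m) * (\<psi> (t\<^sub>0 + y / sqrt (real m)) - \<psi> t\<^sub>0)"
            by (intro mult_left_mono) auto
          then have "W m \<omega> * \<kappa> < x * \<kappa>" using elim(1) \<kappa> by (simp add: W_def mult.commute)
          then show False using bad \<kappa> by simp
        qed
      qed
    qed
  next
    fix x e :: real assume e: "0 < e"
    define y where "y = \<sigma> * (x + e / 2) / c"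
    have cy: "c * y + \<sigma> * e / 2 = \<sigma> * (x + e)" using c by (simp add: y_def field_simps)
    have dy: "\<kappa> * x < d * y"
    proof -
      have "\<kappa> * x < \<kappa> * (x + e / 2)" using \<kappa> e by (intro mult_strict_left_mono) auto
      also have "\<dots> = d * y" by (simp add: y_def \<kappa>_def)
      finally show ?thesis .
    qed
    have "whp M (\<lambda>m \<omega>. c * y + \<sigma> * e / 2 \<le> \<nu> m \<omega> t\<^sub>0 \<longrightarrow> t\<^sub>0 + y / sqrt (real m) \<le> T m \<omega>)"
      unfolding c_def using \<sigma> e by (intro crossing_lower) simp
    then show "(\<lambda>m. measure (M m) {\<omega> \<in> space (M m). x + e \<le> \<nu> m \<omega> t\<^sub>0 / \<sigma> \<and> W m \<omega> < x}) \<longlonglongrightarrow> 0"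
    proof (rule whp_tendsto_0[OF _ prob])
      show "\<forall>\<^sub>F m in sequentially. \<forall>\<omega>\<in>space (M m). (c * y + \<sigma> * e / 2 \<le> \<nu> m \<omega> t\<^sub>0 \<longrightarrow> t\<^sub>0 + y / sqrt (real m) \<le> T m \<omega>) \<longrightarrow>
          \<not> (x + e \<le> \<nu> m \<omega> t\<^sub>0 / \<sigma> \<and> W m \<omega> < x)"
        using order_tendstoD(1)[OF DERIV_sqrt_scaled[OF \<psi>, of y] dy] stay[of y]
      proof eventually_elim
        case (elim m)
        show ?case
        proof (intro ballI impI notI)
          fix \<omega> assume imp: "c * y + \<sigma> * e / 2 \<le> \<nu> m \<omega> t\<^sub>0 \<longrightarrow> t\<^sub>0 + y / sqrt (real m) \<le> T m \<omega>"
            and bad: "x + e \<le> \<nu> m \<omega> t\<^sub>0 / \<sigma> \<and> W m \<omega> < x"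
          have "c * y + \<sigma> * e / 2 \<le> \<nu> m \<omega> t\<^sub>0" using bad \<sigma>(1) unfolding cy by (simp add: pos_le_divide_eq mult.commute)
          then have "\<psi> (t\<^sub>0 + y / sqrt (real m)) \<le> \<psi> (T m \<omega>)"
            using imp elim(2) last_crossing_unit by (intro \<psi>T) auto
          then have "sqrt (real m) * (\<psi> (t\<^sub>0 + y / sqrt (real m)) - \<psi> t\<^sub>0) \<le> sqrt (real m) * (\<psi> (T m \<omega>) - \<psi> t\<^sub>0)"
            by (intro mult_left_mono) auto
          then have "x * \<kappa> < W m \<omega> * \<kappa>" using elim(1) \<kappa> by (simp add: W_def mult.commute)
          then show False using bad \<kappa> by simp
        qed
      qed
    qed
  qed
  then have "weak_conv_m (\<lambda>m. distr (M m) borel (\<lambda>\<omega>. \<kappa> * W m \<omega>)) (distr std_normal_distribution borel (\<lambda>x. 0 + \<kappa> * x))"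
    using \<kappa> by (intro weak_conv_scale[OF prob Wm] std_normal_cdf_continuous)
      (auto intro: prob_space_normal_density)
  moreover have "\<kappa> * W m \<omega> = sqrt (real m) * (\<psi> (T m \<omega>) - \<psi> t\<^sub>0)" for m \<omega>
    using \<kappa> by (simp add: W_def)
  moreover have "d\<^sup>2 * (G t\<^sub>0 * (1 - G t\<^sub>0)) / (\<beta> - g\<^sub>0)\<^sup>2 = \<kappa>\<^sup>2"
    by (simp add: \<kappa>_def \<sigma>(2)[symmetric] c_def power_divide power_mult_distrib)
  ultimately show ?thesis using \<kappa> by (simp add: normal_law_def)
qed

lemma FDP_at_T_expectation:
  fixes H :: "nat \<Rightarrow> nat \<Rightarrow> 'a \<Rightarrow> bool"
  assumes indH: "\<And>m. prob_space.indep_vars (M m) (\<lambda>_. borel \<Otimes>\<^sub>M count_space UNIV) (\<lambda>i \<omega>. (P m i \<omega>, H m i \<omega>)) {1..m}"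
    and H: "\<And>m i. i \<in> {1..m} \<Longrightarrow> H m i \<in> measurable (M m) (count_space UNIV)"
    and null: "\<And>m i t. i \<in> {1..m} \<Longrightarrow> 0 \<le> t \<Longrightarrow> t \<le> 1 \<Longrightarrow>
        measure (M m) {\<omega> \<in> space (M m). P m i \<omega> \<le> t \<and> \<not> H m i \<omega>} = q * t"
    and q: "0 < q" "q \<le> \<beta>"
  shows "(\<lambda>m. prob_space.expectation (M m) (\<lambda>\<omega>. FDP m (\<lambda>i. P m i \<omega>) (\<lambda>i. H m i \<omega>) (T m \<omega>))) \<longlonglongrightarrow> q / \<beta>"
proof -
  let ?N = "\<lambda>m \<omega> t. real (card {i \<in> {1..m}. P m i \<omega> \<le> t \<and> \<not> H m i \<omega>}) / real m"
  have N_mono: "?N m \<omega> s \<le> ?N m \<omega> t" if "s \<le> t" for m \<omega> s t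
    using that by (intro divide_right_mono of_nat_mono card_mono) auto
  have N_conv: "whp M (\<lambda>m \<omega>. \<bar>?N m \<omega> t - q * t\<bar> < e)" if "0 \<le> t" "t \<le> 1" "0 < e" for t e
    using whp_count[OF prob indH, of "{..t} \<times> {False}" "q * t" e] null[of _ _ t] that by simp
  have "(\<lambda>m. prob_space.expectation (M m) (\<lambda>\<omega>. FDP m (\<lambda>i. P m i \<omega>) (\<lambda>i. H m i \<omega>) (T m \<omega>))) \<longlonglongrightarrow> q * t\<^sub>0 / G t\<^sub>0"
  proof (rule FDP_expectation_tendsto[OF prob P_measurable H T_measurable])
    fix e :: real assume e: "0 < e"
    show "whp M (\<lambda>m \<omega>. \<bar>?N m \<omega> (T m \<omega>) - q * t\<^sub>0\<bar> < e)"
      by (rule whp_monotone_at_consistent[where f = ?N and A = "\<lambda>t. q * t"])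
        (use prob N_mono N_conv T_consistent t0 e in auto)
    show "whp M (\<lambda>m \<omega>. \<bar>Gm m \<omega> (T m \<omega>) - G t\<^sub>0\<bar> < e)"
      by (rule whp_monotone_at_consistent[where f = Gm])
        (use prob empirical_cdf_mono whp_pointwise T_consistent t0 e DERIV_isCont[OF deriv] in auto)
  qed (use q t0 crossing in auto)
  then show ?thesis using crossing t0 by simp
qed

end

section \<open>The mixture model\<close>

lemma mixture_sample_measurable:
  assumes "mixture_sample a F m M P H" "i \<in> {1..m}"
  shows "P i \<in> borel_measurable M" "H i \<in> measurable M (count_space UNIV)"
proof -
  interpret prob_space M using assms by (simp add: mixture_sample_def)
  have "(\<lambda>\<omega>. (P i \<omega>, H i \<omega>)) \<in> measurable M (borel \<Otimes>\<^sub>M count_space UNIV)"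
    using assms unfolding mixture_sample_def indep_vars_def by auto
  from measurable_compose[OF this measurable_fst] measurable_compose[OF this measurable_snd]
  show "P i \<in> borel_measurable M" "H i \<in> measurable M (count_space UNIV)"
    by simp_all
qed

lemma mixture_sample_laws:
  assumes ms: "mixture_sample a F m M P H" and a: "0 < a" "a < 1"
    and i: "i \<in> {1..m}" and t: "0 \<le> t" "t \<le> 1"
  shows "measure M {\<omega> \<in> space M. P i \<omega> \<le> t \<and> \<not> H i \<omega>} = (1 - a) * t"
    and "measure M {\<omega> \<in> space M. P i \<omega> \<le> t} = mixture_cdf a F t"
proof -
  interpret prob_space M using ms by (simp add: mixture_sample_def)
  note [measurable] = mixture_sample_measurable[OF ms i]
  have dH: "distr M (count_space UNIV) (H i) = measure_pmf (bernoulli_pmf a)"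
    and dN: "distr (uniform_measure M {\<omega> \<in> space M. \<not> H i \<omega>}) borel (P i) = uniform_measure lborel {0<..<1}"
    and dA: "cdf (distr (uniform_measure M {\<omega> \<in> space M. H i \<omega>}) borel (P i)) = F"
    using ms i a unfolding mixture_sample_def by auto
  have "prob {\<omega> \<in> space M. H i \<omega> = b} = pmf (bernoulli_pmf a) b" for b
  proof -
    have "measure (distr M (count_space UNIV) (H i)) {b} = prob {\<omega> \<in> space M. H i \<omega> = b}"
      by (subst measure_distr) (auto intro!: arg_cong[where f = prob])
    then show ?thesis by (simp add: dH measure_pmf_single)
  qed
  from this[of True] this[of False]
  have pH: "prob {\<omega> \<in> space M. H i \<omega>} = a" and pN: "prob {\<omega> \<in> space M. \<not> H i \<omega>} = 1 - a"
    using a by auto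
  have cond: "measure (distr (uniform_measure M A) borel (P i)) {..t} = prob {\<omega> \<in> A. P i \<omega> \<le> t} / prob A"
    if A: "A \<in> events" "prob A \<noteq> 0" for A
  proof -
    have "measure (distr (uniform_measure M A) borel (P i)) {..t} = measure (uniform_measure M A) (P i -` {..t} \<inter> space M)"
      by (subst measure_distr) auto
    also have "\<dots> = prob (A \<inter> (P i -` {..t} \<inter> space M)) / prob A"
      using A by (intro measure_uniform_measure) (auto simp: emeasure_eq_measure)
    also have "A \<inter> (P i -` {..t} \<inter> space M) = {\<omega> \<in> A. P i \<omega> \<le> t}"
      using sets.sets_into_space[OF A(1)] by auto
    finally show ?thesis .
  qed
  have "measure (uniform_measure lborel {0<..<1}) {..t} = t"
  proof -
    have "measure (uniform_measure lborel {0<..<1::real}) {..t} = measure lborel ({0<..<1} \<inter> {..t}) / measure lborel {0<..<1::real}"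
      by (rule measure_uniform_measure) auto
    also have "\<dots> = t"
    proof (cases "t = 1")
      case False
      then have "{0<..<1} \<inter> {..t} = {0<..t}" using t by auto
      then show ?thesis using t by simp
    next
      case True
      then have "{0<..<1} \<inter> {..t} = {0<..<1}" by auto
      then show ?thesis using True by simp
    qed
    finally show ?thesis .
  qed
  then have "prob {\<omega> \<in> {\<omega> \<in> space M. \<not> H i \<omega>}. P i \<omega> \<le> t} / (1 - a) = t"
    using cond[of "{\<omega> \<in> space M. \<not> H i \<omega>}"] pN a dN by simp
  then have "prob {\<omega> \<in> {\<omega> \<in> space M. \<not> H i \<omega>}. P i \<omega> \<le> t} = (1 - a) * t"
    using a by (simp add: field_simps)
  moreover have "{\<omega> \<in> {\<omega> \<in> space M. \<not> H i \<omega>}. P i \<omega> \<le> t} = {\<omega> \<in> space M. P i \<omega> \<le> t \<and> \<not> H i \<omega>}" by auto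
  ultimately show N: "prob {\<omega> \<in> space M. P i \<omega> \<le> t \<and> \<not> H i \<omega>} = (1 - a) * t" by simp
  have "prob {\<omega> \<in> {\<omega> \<in> space M. H i \<omega>}. P i \<omega> \<le> t} / a = F t"
    using cond[of "{\<omega> \<in> space M. H i \<omega>}"] pH a fun_cong[OF dA, of t] by (simp add: cdf_def2)
  then have A: "prob {\<omega> \<in> {\<omega> \<in> space M. H i \<omega>}. P i \<omega> \<le> t} = a * F t"
    using a by (simp add: field_simps)
  have "{\<omega> \<in> space M. P i \<omega> \<le> t} = {\<omega> \<in> space M. P i \<omega> \<le> t \<and> \<not> H i \<omega>} \<union> {\<omega> \<in> {\<omega> \<in> space M. H i \<omega>}. P i \<omega> \<le> t}"
    by auto
  also have "prob \<dots> = prob {\<omega> \<in> space M. P i \<omega> \<le> t \<and> \<not> H i \<omega>} + prob {\<omega> \<in> {\<omega> \<in> space M. H i \<omega>}. P i \<omega> \<le> t}"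
    by (rule finite_measure_Union) auto
  finally show "prob {\<omega> \<in> space M. P i \<omega> \<le> t} = mixture_cdf a F t"
    unfolding N A by (simp add: mixture_cdf_def)
qed

lemma unit_deriv_eq:
  assumes "(f has_real_derivative d) (at t)" "0 < t" "t < 1"
  shows "unit_deriv f t = d"
  unfolding unit_deriv_def
  using assms by (intro vector_derivative_at_within_ivl) (auto simp: has_real_derivative_iff_has_vector_derivative)

text \<open>The ratio \<open>G t / t\<close> is strictly decreasing; this makes \<open>Q\<close> strictly increasing.\<close>
lemma star_shaped_strict:
  assumes sc: "strictly_concave_on {0..1} G" and G0: "G 0 = 0" and st: "0 < s" "s < t" "t \<le> 1"
  shows "s * G t < t * G s"
proof -
  have "(1 - u) * G 0 + u * G t < G ((1 - u) * 0 + u * t)" if "u \<in> {0<..<1}" for u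
    by (rule sc[unfolded strictly_concave_on_def, THEN conjunct2, rule_format]) (use st that in auto)
  from this[of "s / t"] have "(1 - s / t) * G 0 + s / t * G t < G s" using st by simp
  then show ?thesis using G0 st by (simp add: field_simps)
qed

text \<open>The value \<open>1\<close> of the estimated distribution function at \<open>1\<close> is exact, even when sample points exceed \<open>1\<close>,
because of the truncation from below.\<close>
lemma T_PI_at_one:
  assumes \<Phi>: "\<Phi> = (\<lambda>f. f) \<or> \<Phi> = least_concave_majorant"
  shows "T_PI \<Phi> a (1 - a) m p = 1"
proof -
  have "\<Phi> (empirical_cdf m p) 1 \<le> 1 + 0 * 1"
    using empirical_cdf_bounds by (intro Phi_le_affine[OF \<Phi>]) auto
  then have "Q_fun a (G_hat \<Phi> m p) 1 = 1 - a"
    by (simp add: Q_fun_def G_hat_def max_def)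
  then show ?thesis
    unfolding T_PI_def sup_inverse_def by (intro cSup_eq_maximum) auto
qed

lemma weak_conv_point_mass:
  assumes "\<And>m. prob_space (M m)"
  shows "weak_conv_m (\<lambda>m. distr (M m) borel (\<lambda>_. 0)) (normal_law 0 0)"
proof -
  have "distr (M m) borel (\<lambda>_. 0 :: real) = return borel 0" for m
    using prob_space.distr_const[OF assms, of 0 borel] by simp
  moreover have "normal_law 0 0 = return borel 0"
    using prob_space.distr_const[OF prob_space_normal_density, of 1 0 borel 0]
    by (simp add: normal_law_def)
  ultimately show ?thesis by (simp add: weak_conv_m_def weak_conv_def)
qed

theorem theorem5p1:
  fixes M :: "nat \<Rightarrow> 'a measure"
    and P :: "nat \<Rightarrow> nat \<Rightarrow> 'a \<Rightarrow> real"
    and H :: "nat \<Rightarrow> nat \<Rightarrow> 'a \<Rightarrow> bool"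
    and a \<alpha> t\<^sub>0 :: real
    and F G Q g :: "real \<Rightarrow> real"
    and \<Phi> :: "(real \<Rightarrow> real) \<Rightarrow> real \<Rightarrow> real"
    and T :: "nat \<Rightarrow> 'a \<Rightarrow> real"
  assumes a: "0 \<le> a" "a \<le> 1"
    and F: "cdf_on_unit_interval F" "\<And>t. 0 \<le> t \<Longrightarrow> t \<le> 1 \<Longrightarrow> t \<le> F t"
    and sample: "\<And>m. mixture_sample a F m (M m) (P m) (H m)"
    and G: "G = mixture_cdf a F"
    and G_concave: "strictly_concave_on {0..1} G"
    and G_density: "\<And>t. 0 \<le> t \<Longrightarrow> t \<le> 1 \<Longrightarrow> (g has_integral G t) {0..t}"
    and G_deriv: "\<And>t. 0 < t \<Longrightarrow> t < 1 \<Longrightarrow> (G has_real_derivative g t) (at t)"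
    and G_neq_U: "\<exists>t\<in>{0..1}. G t \<noteq> t"
    and Q: "Q = Q_fun a G"
    and \<alpha>: "0 < \<alpha>" "\<alpha> < 1"
    and \<alpha>_range: "\<alpha> \<in> Q ` {0<..1}"
    and t0: "t\<^sub>0 = sup_inverse Q \<alpha>"
    and \<Phi>: "\<Phi> = (\<lambda>f. f) \<or> \<Phi> = least_concave_majorant"
    and T: "\<And>m \<omega>. T m \<omega> = T_PI \<Phi> a \<alpha> m (\<lambda>i. P m i \<omega>)"
  shows "weak_conv_m (\<lambda>m. distr (M m) borel (\<lambda>\<omega>. sqrt (real m) * (T m \<omega> - t\<^sub>0)))
           (normal_law 0 (K_Q_inv a G \<alpha> \<alpha>)) \<and>
         weak_conv_m (\<lambda>m. distr (M m) borel (\<lambda>\<omega>. sqrt (real m) * (Q (T m \<omega>) - \<alpha>)))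
           (normal_law 0 ((unit_deriv Q t\<^sub>0)\<^sup>2 * K_Q_inv a G \<alpha> \<alpha>)) \<and>
         (\<lambda>m. prob_space.expectation (M m)
            (\<lambda>\<omega>. FDP m (\<lambda>i. P m i \<omega>) (\<lambda>i. H m i \<omega>) (T m \<omega>))) \<longlonglongrightarrow> \<alpha>"
proof -
  have prob: "prob_space (M m)" for m using sample[of m] by (simp add: mixture_sample_def)
  \<comment> \<open>For \<open>a = 0\<close> the function \<open>G\<close> is the identity; for \<open>a = 1\<close> the function \<open>Q\<close> vanishes and cannot take the value \<open>\<alpha>\<close>.\<close>
  have a0: "0 < a" using a G_neq_U unfolding G mixture_cdf_def by (cases "a = 0") auto
  obtain t1 where t1: "0 < t1" "t1 \<le> 1" "Q t1 = \<alpha>" using \<alpha>_range by auto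
  have a1: "a < 1" using a t1 \<alpha> unfolding Q Q_fun_def by (cases "a = 1") auto
  have Fmono: "mono F" and F1: "F 1 = 1" using F(1) by (auto simp: cdf_on_unit_interval_def)
  have G0: "G 0 = 0" using G_density[of 0] by (simp add: has_integral_refl(2) has_integral_unique)
  have G1: "G 1 = 1" unfolding G mixture_cdf_def F1 by simp
  have G_pos: "0 < G t" if "0 < t" "t \<le> 1" for t
  proof -
    have "0 < (1 - a) * t" "0 \<le> a * F t" using that a a1 F(2)[of t] by auto
    then show ?thesis unfolding G mixture_cdf_def by linarith
  qed
  have G_cont: "continuous_on {0..1} G"
  proof -
    have "g integrable_on {0..1}" using G_density[of 1] by (auto simp: integrable_on_def)
    then have "continuous_on {0..1} (\<lambda>x. integral {0..x} g)" by (rule indefinite_integral_continuous_1)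
    then show ?thesis
      by (rule continuous_on_eq) (use G_density in \<open>auto intro!: integral_unique\<close>)
  qed
  have Q_strict: "Q s < Q t" if st: "0 < s" "s < t" "t \<le> 1" for s t
  proof -
    have "s * G t < t * G s" by (rule star_shaped_strict[OF G_concave G0 st])
    then have "(1 - a) * (s * G t) < (1 - a) * (t * G s)" using a1 by (intro mult_strict_left_mono) auto
    then show ?thesis unfolding Q Q_fun_def using G_pos[of s] G_pos[of t] st by (simp add: divide_less_eq less_divide_eq field_simps)
  qed
  have Q0: "Q 0 = 0" by (simp add: Q Q_fun_def)
  have Q_pos: "0 < Q t" if "0 < t" "t \<le> 1" for t using that a1 G_pos[of t] by (simp add: Q Q_fun_def)
  have t01: "t\<^sub>0 = t1"
    unfolding t0 sup_inverse_def
  proof (rule cSup_eq_maximum)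
    fix s assume "s \<in> {t. 0 \<le> t \<and> t \<le> 1 \<and> Q t \<le> \<alpha>}"
    then show "s \<le> t1" using Q_strict[of t1 s] t1 by (cases "s \<le> t1") auto
  qed (use t1 in auto)
  have \<alpha>G: "\<alpha> * G t1 = (1 - a) * t1" using t1 G_pos[of t1] unfolding Q Q_fun_def by (simp add: field_simps)
  have Qinv: "sup_inverse Q \<alpha> = t1" using t0 t01 by simp
  have Q_t1: "Q_fun a G t1 = \<alpha>" using t1 Q by simp
  have K: "K_Q_inv a G \<alpha> \<alpha> = \<alpha>\<^sup>2 * (G t1 - (G t1)\<^sup>2) / (G t1)\<^sup>2 / (unit_deriv Q t1)\<^sup>2"
    using Qinv unfolding K_Q_inv_def K_Q_def Q[symmetric] Let_def by (simp add: t1(3) power2_eq_square)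
  have ind: "prob_space.indep_vars (M m) (\<lambda>_. borel \<Otimes>\<^sub>M count_space UNIV) (\<lambda>i \<omega>. (P m i \<omega>, H m i \<omega>)) {1..m}" for m
    using sample[of m] by (simp add: mixture_sample_def)
  note laws = mixture_sample_laws[OF sample a0 a1]
  show ?thesis
  proof (cases "t1 = 1")
    case True
    then have \<alpha>1: "\<alpha> = 1 - a" using \<alpha>G G1 by simp
    have T1: "T m \<omega> = 1" for m \<omega> unfolding T \<alpha>1 by (rule T_PI_at_one[OF \<Phi>])
    have K0: "K_Q_inv a G \<alpha> \<alpha> = 0" unfolding K True G1 by simp
    have "(\<lambda>m. prob_space.expectation (M m) (\<lambda>\<omega>. FDP m (\<lambda>i. P m i \<omega>) (\<lambda>i. H m i \<omega>) 1)) \<longlonglongrightarrow> (1 - a) / 1"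
    proof (rule FDP_expectation_tendsto[OF prob mixture_sample_measurable[OF sample]])
      fix e :: real assume e: "0 < e"
      show "whp M (\<lambda>m \<omega>. \<bar>real (card {i \<in> {1..m}. P m i \<omega> \<le> 1 \<and> \<not> H m i \<omega>}) / real m - (1 - a)\<bar> < e)"
        using whp_count[OF prob ind, of "{..1} \<times> {False}" "1 - a" e] laws(1)[of _ _ 1] e by simp
      show "whp M (\<lambda>m \<omega>. \<bar>empirical_cdf m (\<lambda>i. P m i \<omega>) 1 - 1\<bar> < e)"
        using whp_count[OF prob ind, of "{..1} \<times> UNIV" 1 e] laws(2)[of _ _ 1] G1 e
        by (simp add: G empirical_cdf_def)
    qed (use a0 a1 in auto)
    then show ?thesis
      using weak_conv_point_mass[of M, OF prob] by (simp add: T1 K0[unfolded \<alpha>1] t01 True \<alpha>1 t1(3)[unfolded True \<alpha>1])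
  next
    case False
    then have t1': "t1 < 1" using t1 by simp
    define \<beta> where "\<beta> = (1 - a) / \<alpha>"
    have G\<beta>: "G t1 = \<beta> * t1" using \<alpha>G \<alpha> by (simp add: \<beta>_def field_simps)
    have "t1 * G 1 < 1 * G t1" by (rule star_shaped_strict[OF G_concave G0 t1(1) t1']) simp
    then have \<beta>1: "1 < \<beta>" using G1 G\<beta> t1 by simp
    then have \<alpha>a: "\<alpha> < 1 - a" using \<alpha> by (simp add: \<beta>_def field_simps)
    interpret empirical_crossing M P G "g t1" t1 \<beta> \<Phi>
    proof (rule empirical_crossing.intro)
      show "prob_space.indep_vars (M m) (\<lambda>_. borel) (P m) {1..m}" for m
        using prob_space.indep_vars_compose2[OF prob ind, of m "\<lambda>_. fst" "\<lambda>_. borel"] by simp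
      show "measure (M m) {\<omega> \<in> space (M m). P m i \<omega> \<le> t} = G t" if "i \<in> {1..m}" "0 \<le> t" "t \<le> 1" for m i t
        using laws(2)[OF that] by (simp add: G)
      show "(G has_real_derivative g t1) (at t1)" using G_deriv t1 t1' by simp
    qed (fact prob G_concave G_cont G0 G1 t1(1) t1' \<beta>1 G\<beta> \<Phi>)+
    have T_eq: "T m \<omega> = last_crossing (\<Phi> (empirical_cdf m (\<lambda>i. P m i \<omega>))) \<beta>" for m \<omega>
      unfolding T \<beta>_def using \<alpha>(1) \<alpha>a by (rule T_PI_eq_last_crossing)
    define D where "D = \<alpha> * (\<beta> - g t1) / G t1"
    have D: "0 < D" using \<alpha> slope_gap G_t0 by (simp add: D_def)
    have Q_deriv: "(Q has_real_derivative D) (at t1)"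
    proof -
      have "((\<lambda>t. (1 - a) * t / G t) has_real_derivative ((1 - a) * G t1 - (1 - a) * t1 * g t1) / (G t1 * G t1)) (at t1)"
        using G_t0 by (auto intro!: derivative_eq_intros G_deriv t1 t1')
      moreover have "((1 - a) * G t1 - (1 - a) * t1 * g t1) / (G t1 * G t1) = D"
      proof -
        have "(1 - a) * G t1 - (1 - a) * t1 * g t1 = \<alpha> * G t1 * (\<beta> - g t1)"
          unfolding \<alpha>G using G\<beta> by (simp add: algebra_simps)
        then show ?thesis using G_t0 by (simp add: D_def)
      qed
      moreover have "Q = (\<lambda>t. (1 - a) * t / G t)" by (simp add: Q Q_fun_def fun_eq_iff)
      ultimately show ?thesis by simp
    qed
    have uD: "unit_deriv Q t1 = D" by (rule unit_deriv_eq[OF Q_deriv t1(1) t1'])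
    have K1: "K_Q_inv a G \<alpha> \<alpha> = 1\<^sup>2 * (G t1 * (1 - G t1)) / (\<beta> - g t1)\<^sup>2"
    proof -
      have "x\<^sup>2 * (p - p\<^sup>2) / p\<^sup>2 / (x * c / p)\<^sup>2 = p * (1 - p) / c\<^sup>2"
        if "x \<noteq> 0" "p \<noteq> 0" "c \<noteq> 0" for x p c :: real
        using that by (simp add: field_simps power2_eq_square)
      then show ?thesis unfolding K uD D_def using G_t0 \<alpha> slope_gap by simp
    qed
    have K2: "D\<^sup>2 * K_Q_inv a G \<alpha> \<alpha> = D\<^sup>2 * (G t1 * (1 - G t1)) / (\<beta> - g t1)\<^sup>2"
      unfolding K1 by simp
    have Q_mono: "mono_on {0..1} Q"
    proof (rule mono_onI)
      fix s t :: real assume "s \<in> {0..1}" "t \<in> {0..1}" "s \<le> t"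
      then show "Q s \<le> Q t"
        using Q_strict[of s t] Q_pos[of t] Q0 by (cases "s = 0"; cases "s = t"; cases "t = 0") auto
    qed
    have [measurable]: "F \<in> borel_measurable borel" using Fmono by (rule borel_measurable_mono)
    have Q_meas: "Q \<in> borel_measurable borel" unfolding Q Q_fun_def G mixture_cdf_def by measurable
    have "weak_conv_m (\<lambda>m. distr (M m) borel (\<lambda>\<omega>. sqrt (real m) * (T m \<omega> - t\<^sub>0))) (normal_law 0 (K_Q_inv a G \<alpha> \<alpha>))"
      unfolding T_eq t01 K1 by (rule threshold_clt[where \<psi> = "\<lambda>t. t"]) (auto intro!: mono_onI)
    moreover have "weak_conv_m (\<lambda>m. distr (M m) borel (\<lambda>\<omega>. sqrt (real m) * (Q (T m \<omega>) - \<alpha>)))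
           (normal_law 0 ((unit_deriv Q t\<^sub>0)\<^sup>2 * K_Q_inv a G \<alpha> \<alpha>))"
      using threshold_clt[OF Q_mono Q_deriv D Q_meas] unfolding T_eq t01 uD K2 t1(3) .
    moreover have "(\<lambda>m. prob_space.expectation (M m)
            (\<lambda>\<omega>. FDP m (\<lambda>i. P m i \<omega>) (\<lambda>i. H m i \<omega>) (T m \<omega>))) \<longlonglongrightarrow> (1 - a) / \<beta>"
      unfolding T_eq
      by (rule FDP_at_T_expectation[OF ind]) (use laws mixture_sample_measurable[OF sample] a1 \<beta>1 a in auto)
    moreover have "(1 - a) / \<beta> = \<alpha>" using a1 \<alpha> by (simp add: \<beta>_def)
    ultimately show ?thesis by simp
  qed
qed

end
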